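(* Let $(M^{2n},\omega)$ be a symplectic manifold of dimension $2n$, let $F=(f_1,\dots,f_n):M^{2n}\to\mathbb{R}^n$ be an integrable system on $(M^{2n},\omega)$, and let $c\in\mathbb{R}^n$. Let $L^n$ be a connected component of $F^{-1}(c)$ which is compact and all of whose points are regular points of the integrable system. Then $L^n$ is diffeomorphic to the torus $\mathbb{T}^n$.
   Context: An integrable system on a symplectic manifold $(M^{2n},\omega)$ is a set of $n$ smooth functions $f_1,\dots,f_n$ on $M^{2n}$ that are generically functionally independent (i.e. $df_1\wedge\cdots\wedge df_n\neq 0$ on a dense set) and pairwise commute with respect to the Poisson bracket: $\{f_i,f_j\}=\omega(X_{f_i},X_{f_j})=0$ for all $i,j$, where $X_f$ denotes the Hamiltonian vector field of $f$, defined by $\iota_{X_f}\omega=-df$. A point $p$ is called regular if $(df_1\wedge\cdots\wedge df_n)(p)\neq 0$. $\mathbb{T}^n=S^1\times\cdots\times S^1$ ($n$ factors). *)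

theory Defs
  imports "HOL-Analysis.Analysis"
begin

section \<open>Smooth maps between Euclidean spaces\<close>

text \<open>On an open set of a finite-dimensional space, being of class \<open>C\<close>-\<open>(k+1)\<close> means being
  differentiable with all directional derivatives of class \<open>C\<close>-\<open>k\<close>. The predicates are only meant
  to be used on open sets.\<close>

primrec C_k_on :: "nat \<Rightarrow> 'a::euclidean_space set \<Rightarrow> ('a \<Rightarrow> 'b::real_normed_vector) \<Rightarrow> bool" where
  "C_k_on 0 S f \<longleftrightarrow> continuous_on S f"
| "C_k_on (Suc k) S f \<longleftrightarrow>
     (\<forall>x\<in>S. f differentiable (at x)) \<and> (\<forall>v. C_k_on k S (\<lambda>x. frechet_derivative f (at x) v))"

definition smooth_on :: "'a::euclidean_space set \<Rightarrow> ('a \<Rightarrow> 'b::real_normed_vector) \<Rightarrow> bool" where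
  "smooth_on S f \<longleftrightarrow> (\<forall>k. C_k_on k S f)"


section \<open>Smooth manifolds\<close>

text \<open>A chart is a pair of its domain and its coordinate map; the values of the coordinate map
  outside the domain are irrelevant. A manifold modelled on \<open>'e\<close> has dimension \<open>DIM('e)\<close>.\<close>

type_synonym ('m, 'e) chart = "'m set \<times> ('m \<Rightarrow> 'e)"

abbreviation chart_inv :: "('m, 'e) chart \<Rightarrow> 'e \<Rightarrow> 'm" where
  "chart_inv c \<equiv> inv_into (fst c) (snd c)"

definition is_chart :: "'m topology \<Rightarrow> ('m, 'e::euclidean_space) chart \<Rightarrow> bool" where
  "is_chart X c \<longleftrightarrow> openin X (fst c) \<and> open (snd c ` fst c) \<and>
     homeomorphic_map (subtopology X (fst c)) (top_of_set (snd c ` fst c)) (snd c)"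

definition transition :: "('m, 'e) chart \<Rightarrow> ('m, 'e) chart \<Rightarrow> 'e \<Rightarrow> 'e" where
  "transition c d = snd d \<circ> chart_inv c"

definition compatible :: "('m, 'e::euclidean_space) chart \<Rightarrow> ('m, 'e) chart \<Rightarrow> bool" where
  "compatible c d \<longleftrightarrow>
     smooth_on (snd c ` (fst c \<inter> fst d)) (transition c d) \<and>
     smooth_on (snd d ` (fst c \<inter> fst d)) (transition d c)"

locale smooth_manifold =
  fixes X :: "'m topology" and A :: "('m, 'e::euclidean_space) chart set"
  assumes Hausdorff: "Hausdorff_space X"
    and second_countable: "second_countable X"
    and charts: "c \<in> A \<Longrightarrow> is_chart X c"
    and covering: "(\<Union>c\<in>A. fst c) = topspace X"
    and compatible: "c \<in> A \<Longrightarrow> d \<in> A \<Longrightarrow> compatible c d"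

definition maximal_atlas ::
    "'m topology \<Rightarrow> ('m, 'e::euclidean_space) chart set \<Rightarrow> ('m, 'e) chart set" where
  "maximal_atlas X A = {c. is_chart X c \<and> (\<forall>d\<in>A. compatible c d)}"

definition euclidean_charts :: "('e::euclidean_space, 'e) chart set" where
  "euclidean_charts = {(UNIV, id)}"

definition smooth_map ::
    "'m topology \<Rightarrow> ('m, 'e::euclidean_space) chart set \<Rightarrow>
     'k topology \<Rightarrow> ('k, 'f::euclidean_space) chart set \<Rightarrow> ('m \<Rightarrow> 'k) \<Rightarrow> bool" where
  "smooth_map X A Y B f \<longleftrightarrow> continuous_map X Y f \<and>
     (\<forall>c\<in>A. \<forall>d\<in>B. smooth_on (snd c ` {p \<in> fst c. f p \<in> fst d}) (snd d \<circ> f \<circ> chart_inv c))"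

definition diffeomorphic ::
    "'m topology \<Rightarrow> ('m, 'e::euclidean_space) chart set \<Rightarrow>
     'k topology \<Rightarrow> ('k, 'f::euclidean_space) chart set \<Rightarrow> bool" where
  "diffeomorphic X A Y B \<longleftrightarrow> smooth_manifold X A \<and> smooth_manifold Y B \<and>
     (\<exists>f g. smooth_map X A Y B f \<and> smooth_map Y B X A g \<and>
        (\<forall>p\<in>topspace X. g (f p) = p) \<and> (\<forall>q\<in>topspace Y. f (g q) = q))"

text \<open>The smooth structure that a subset \<open>L\<close> inherits as an embedded submanifold: the slice charts,
  that is, charts \<open>c\<close> of the maximal atlas that map \<open>L\<close> to the slice where the second component of
  the model space vanishes, restricted to \<open>L\<close>. The subset \<open>L\<close> is an embedded submanifold of
  dimension \<open>DIM('e)\<close> iff the slice charts cover it.\<close>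

definition slice_charts ::
    "'m topology \<Rightarrow> ('m, 'e::euclidean_space \<times> 'f::euclidean_space) chart set \<Rightarrow> 'm set \<Rightarrow>
     ('m, 'e) chart set" where
  "slice_charts X A L =
     {(fst c \<inter> L, fst \<circ> snd c) |c. c \<in> maximal_atlas X A \<and>
        snd c ` (fst c \<inter> L) = (snd c ` fst c) \<inter> (UNIV \<times> {0})}"


section \<open>The torus\<close>

definition circle_charts :: "(complex, real) chart set" where
  "circle_charts = {(cis ` {a<..<a + 2 * pi}, inv_into {a<..<a + 2 * pi} cis) |a. True}"

definition torus :: "(complex ^ 'n) set" where
  "torus = {z. \<forall>i. z $ i \<in> sphere 0 1}"

definition torus_charts :: "(complex ^ 'n, real ^ 'n) chart set" where
  "torus_charts =
     {({z. \<forall>i. z $ i \<in> fst (c i)}, \<lambda>z. \<chi> i. snd (c i) (z $ i)) |c. \<forall>i. c i \<in> circle_charts}"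


section \<open>Symplectic manifolds\<close>

text \<open>Tangent vectors at \<open>p\<close> are represented by their coordinate vectors in a chart around \<open>p\<close>.
  A 2-form \<open>\<omega>\<close> is a family of local representatives: \<open>\<omega> c p u v\<close> is its value at \<open>p\<close> on the
  tangent vectors whose coordinates with respect to the chart \<open>c\<close> are \<open>u\<close> and \<open>v\<close>.\<close>

type_synonym ('m, 'e) local_form2 = "('m, 'e) chart \<Rightarrow> 'm \<Rightarrow> 'e \<Rightarrow> 'e \<Rightarrow> real"

definition coord_differential ::
    "('m, 'e::euclidean_space) chart \<Rightarrow> ('m \<Rightarrow> 'b::real_normed_vector) \<Rightarrow> 'm \<Rightarrow> 'e \<Rightarrow> 'b" where
  "coord_differential c f p = frechet_derivative (f \<circ> chart_inv c) (at (snd c p))"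

text \<open>The value of \<open>d\<omega>\<close> on the constant coordinate fields \<open>u\<close>, \<open>v\<close>, \<open>w\<close>, whose Lie brackets vanish.\<close>

definition exterior_derivative2 ::
    "('m, 'e::euclidean_space) local_form2 \<Rightarrow> ('m, 'e) chart \<Rightarrow> 'm \<Rightarrow> 'e \<Rightarrow> 'e \<Rightarrow> 'e \<Rightarrow> real" where
  "exterior_derivative2 \<omega> c p u v w =
     coord_differential c (\<lambda>q. \<omega> c q v w) p u
   - coord_differential c (\<lambda>q. \<omega> c q u w) p v
   + coord_differential c (\<lambda>q. \<omega> c q u v) p w"

locale symplectic_manifold = smooth_manifold X A
  for X :: "'m topology" and A :: "('m, 'e::euclidean_space) chart set" +
  fixes \<omega> :: "('m, 'e) local_form2"
  assumes bilinear: "c \<in> A \<Longrightarrow> p \<in> fst c \<Longrightarrow> bilinear (\<omega> c p)"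
    and alternating: "c \<in> A \<Longrightarrow> p \<in> fst c \<Longrightarrow> \<omega> c p u u = 0"
    and change_of_chart:
      "c \<in> A \<Longrightarrow> d \<in> A \<Longrightarrow> p \<in> fst c \<inter> fst d \<Longrightarrow>
       \<omega> c p u v = \<omega> d p (coord_differential c (snd d) p u) (coord_differential c (snd d) p v)"
    and smooth: "c \<in> A \<Longrightarrow> smooth_on (snd c ` fst c) (\<lambda>x. \<omega> c (chart_inv c x) u v)"
    and closed: "c \<in> A \<Longrightarrow> p \<in> fst c \<Longrightarrow> exterior_derivative2 \<omega> c p u v w = 0"
    and nondegenerate: "c \<in> A \<Longrightarrow> p \<in> fst c \<Longrightarrow> (\<And>v. \<omega> c p u v = 0) \<Longrightarrow> u = 0"


section \<open>Integrable systems\<close>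

text \<open>The coordinates at \<open>p\<close> of the Hamiltonian vector field of \<open>f\<close>.\<close>

definition hamiltonian_field ::
    "('m, 'e::euclidean_space) local_form2 \<Rightarrow> ('m \<Rightarrow> real) \<Rightarrow> ('m, 'e) chart \<Rightarrow> 'm \<Rightarrow> 'e" where
  "hamiltonian_field \<omega> f c p = (THE u. \<forall>v. \<omega> c p u v = - coord_differential c f p v)"

definition poisson_bracket ::
    "('m, 'e::euclidean_space) local_form2 \<Rightarrow> ('m \<Rightarrow> real) \<Rightarrow> ('m \<Rightarrow> real) \<Rightarrow>
     ('m, 'e) chart \<Rightarrow> 'm \<Rightarrow> real" where
  "poisson_bracket \<omega> f g c p = \<omega> c p (hamiltonian_field \<omega> f c p) (hamiltonian_field \<omega> g c p)"

text \<open>The value of \<open>df\<^sub>1 \<and> \<dots> \<and> df\<^sub>n\<close> on the tangent vectors with coordinates \<open>v j\<close>.\<close>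

definition wedge_differentials ::
    "('m \<Rightarrow> real ^ 'n) \<Rightarrow> ('m, 'e::euclidean_space) chart \<Rightarrow> 'm \<Rightarrow> ('n \<Rightarrow> 'e) \<Rightarrow> real" where
  "wedge_differentials F c p v =
     det (\<chi> i j. coord_differential c (\<lambda>q. F q $ i) p (v j))"

definition regular_point ::
    "('m, 'e::euclidean_space) chart set \<Rightarrow> ('m \<Rightarrow> real ^ 'n) \<Rightarrow> 'm \<Rightarrow> bool" where
  "regular_point A F p \<longleftrightarrow> (\<exists>c\<in>A. p \<in> fst c \<and> (\<exists>v. wedge_differentials F c p v \<noteq> 0))"

text \<open>The model space \<open>(real ^ 'n) \<times> (real ^ 'n)\<close> has dimension twice the number of functions.\<close>

locale integrable_system = symplectic_manifold X A \<omega>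
  for X :: "'m topology" and A :: "('m, (real ^ 'n) \<times> (real ^ 'n)) chart set" and \<omega> +
  fixes F :: "'m \<Rightarrow> real ^ 'n"
  assumes smooth_functions: "smooth_map X A euclidean euclidean_charts (\<lambda>p. F p $ i)"
    and generically_independent: "X closure_of {p \<in> topspace X. regular_point A F p} = topspace X"
    and commuting:
      "c \<in> A \<Longrightarrow> p \<in> fst c \<Longrightarrow> poisson_bracket \<omega> (\<lambda>q. F q $ i) (\<lambda>q. F q $ j) c p = 0"

end

theory Submission
  imports Defs
begin

text \<open>No flows are needed. The fibres of \<open>F\<close> near \<open>L\<close> are Lagrangian, and the one-forms on \<open>L\<close> dual
  to the Hamiltonian fields of the \<open>f\<^sub>i\<close> are the contractions of \<open>\<omega>\<close> with lifts of the coordinate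
  fields of the base. Since \<open>\<omega>\<close> is closed, so are these forms, and their primitives are local
  coordinates on \<open>L\<close> whose transition maps are translations. A compact connected manifold with such
  an atlas is complete: straight segments of a uniform length can be developed from every point, and
  composing them doubles this length. The resulting map from \<open>real ^ 'n\<close> onto \<open>L\<close> identifies \<open>L\<close> with the
  quotient by a discrete cocompact subgroup, that is, by a lattice.\<close>

section \<open>Calculus of smooth maps\<close>

text \<open>Forms replace flows because completeness of a flat structure is easier to reach than
  completeness of vector fields. A coordinate field of the base has no canonical lift to
  \<open>L\<close>, but two lifts differ by a vector tangent to \<open>L\<close>, and
  \<open>\<omega>\<close> vanishes on pairs of such vectors; so the contracted forms on
  \<open>L\<close> depend only on \<open>\<omega>\<close> and \<open>F\<close>. Hence all action
  charts induce the same coframe on \<open>L\<close>, and this is what makes their transition maps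
  translations. The closedness of these forms cannot be seen on \<open>L\<close> alone: the term of
  \<open>d\<omega>\<close> that differentiates across the fibre vanishes only because neighbouring
  fibres are Lagrangian as well. Regularity is assumed on \<open>L\<close>, but persists nearby.
  That \<open>L\<close> is a connected component enters twice. By maximality it contains the whole
  slice of any action chart that it meets, which makes these charts slice charts; by connectedness
  the image of a developing map, being open and closed, is all of \<open>L\<close>.\<close>

lemma frechet_derivative_cong_open:
  assumes "open S" "x \<in> S" "\<And>y. y \<in> S \<Longrightarrow> f y = g y"
  shows "frechet_derivative f (at x) = frechet_derivative g (at x)"
proof -
  have "(f has_derivative D) (at x) \<longleftrightarrow> (g has_derivative D) (at x)" for D
    using assms has_derivative_transform_within_open[of f D x UNIV S g]
      has_derivative_transform_within_open[of g D x UNIV S f] by auto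
  then show ?thesis by (simp add: frechet_derivative_def)
qed

lemma C_k_on_cong:
  assumes "open S" "\<And>x. x \<in> S \<Longrightarrow> f x = g x"
  shows "C_k_on k S f \<longleftrightarrow> C_k_on k S g"
proof -
  have "C_k_on k S g" if "C_k_on k S f" "\<And>x. x \<in> S \<Longrightarrow> f x = g x" for f g :: "'a \<Rightarrow> 'b"
    using that
  proof (induction k arbitrary: f g)
    case 0
    then show ?case by (simp cong: continuous_on_cong)
  next
    case (Suc k)
    have "g differentiable (at x)" if "x \<in> S" for x
    proof -
      have "(f has_derivative frechet_derivative f (at x)) (at x)"
        using Suc.prems(1) that by (simp add: frechet_derivative_works)
      from has_derivative_transform_within_open[OF this assms(1) that Suc.prems(2)]
      show ?thesis by (auto simp: differentiable_def)
    qed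
    moreover have "C_k_on k S (\<lambda>x. frechet_derivative g (at x) v)" for v
    proof (rule Suc.IH)
      show "C_k_on k S (\<lambda>x. frechet_derivative f (at x) v)" using Suc.prems(1) by simp
      show "frechet_derivative f (at x) v = frechet_derivative g (at x) v" if "x \<in> S" for x
        using frechet_derivative_cong_open[OF assms(1) that Suc.prems(2)] by simp
    qed
    ultimately show ?case by simp
  qed
  then show ?thesis using assms(2) by metis
qed

text \<open>\<open>C_k_on\<close> speaks of \<open>frechet_derivative\<close>; uniqueness of
  derivatives on an open set lets any explicit formula stand in for it. All later inductions on the
  order go through this rule.\<close>

lemma C_k_on_SucI:
  assumes "open S" "\<And>x. x \<in> S \<Longrightarrow> (f has_derivative f' x) (at x)"
    and "\<And>v. C_k_on k S (\<lambda>x. f' x v)"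
  shows "C_k_on (Suc k) S f"
proof -
  have "C_k_on k S (\<lambda>x. frechet_derivative f (at x) v)" for v
    using assms(3)[of v] C_k_on_cong[OF assms(1), of "\<lambda>x. f' x v" "\<lambda>x. frechet_derivative f (at x) v" k]
      frechet_derivative_at[OF assms(2)] by simp
  then show ?thesis using assms(2) by (auto simp: differentiable_def)
qed

lemma C_k_on_SucD:
  assumes "C_k_on (Suc k) S f" "x \<in> S"
  shows "(f has_derivative frechet_derivative f (at x)) (at x)"
  using assms by (simp add: frechet_derivative_works)

lemma C_k_on_subset: "C_k_on k S f \<Longrightarrow> T \<subseteq> S \<Longrightarrow> C_k_on k T f"
  by (induction k arbitrary: f) (auto intro: continuous_on_subset)

text \<open>Differentiability is a pointwise condition, so only the continuity at order 0 has to be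
  localised: there the filters within \<open>S\<close> and within \<open>S \<inter> T\<close> agree
  near a point of the open set \<open>T\<close>.\<close>

lemma C_k_on_local:
  assumes "\<And>x. x \<in> S \<Longrightarrow> \<exists>T. open T \<and> x \<in> T \<and> C_k_on k (S \<inter> T) f"
  shows "C_k_on k S f"
  using assms
proof (induction k arbitrary: f)
  case 0
  show ?case unfolding C_k_on.simps continuous_on_eq_continuous_within
  proof
    fix x assume "x \<in> S"
    then obtain T where "open T" "x \<in> T" "continuous_on (S \<inter> T) f" using 0 by auto
    then show "continuous (at x within S) f"
    proof -
      have "at x within (S \<inter> T) = at x within S"
        using \<open>open T\<close> \<open>x \<in> T\<close> by (intro at_within_nhd[of x T]) auto
      then show ?thesis
        using \<open>continuous_on (S \<inter> T) f\<close> \<open>x \<in> S\<close> \<open>x \<in> T\<close>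
        by (metis IntI continuous_on_eq_continuous_within)
    qed
  qed
next
  case (Suc k)
  have "f differentiable (at x)" if "x \<in> S" for x using Suc.prems[OF that] that by auto
  moreover have "C_k_on k S (\<lambda>x. frechet_derivative f (at x) v)" for v
  proof (rule Suc.IH)
    fix x assume "x \<in> S"
    from Suc.prems[OF this] show "\<exists>T. open T \<and> x \<in> T \<and> C_k_on k (S \<inter> T) (\<lambda>x. frechet_derivative f (at x) v)"
      by auto
  qed
  ultimately show ?case by simp
qed

lemma C_k_on_Suc_imp: "C_k_on (Suc k) S f \<Longrightarrow> C_k_on k S f"
proof (induction k arbitrary: f)
  case 0
  then show ?case
    by (auto intro!: continuous_at_imp_continuous_on differentiable_imp_continuous_within)
next
  case (Suc k)
  from Suc.prems Suc.IH show ?case by (subst C_k_on.simps(2), subst (asm) C_k_on.simps(2)) blast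
qed

lemma C_k_on_imp_continuous_on: "C_k_on k S f \<Longrightarrow> continuous_on S f"
  by (induction k) (simp, metis C_k_on_Suc_imp)

lemma C_k_on_const: "C_k_on k S (\<lambda>x. c)"
  by (induction k arbitrary: c) auto

lemma C_k_on_linear:
  assumes "bounded_linear f"
  shows "C_k_on k S f"
proof (cases k)
  case 0
  then show ?thesis using assms by (simp add: linear_continuous_on)
next
  case (Suc j)
  have "frechet_derivative f (at x) = f" for x
    using frechet_derivative_at[OF bounded_linear_imp_has_derivative[OF assms], of x] by simp
  then show ?thesis using Suc assms
    by (auto simp: C_k_on_const bounded_linear_imp_differentiable)
qed

lemma C_k_on_bounded_linear:
  assumes "bounded_linear h" "open S" "C_k_on k S f"
  shows "C_k_on k S (\<lambda>x. h (f x))"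
  using assms(3)
proof (induction k arbitrary: f)
  case 0
  then show ?case using assms(1) by (auto intro: bounded_linear.continuous_on)
next
  case (Suc k)
  show ?case
  proof (rule C_k_on_SucI[OF assms(2)])
    show "((\<lambda>x. h (f x)) has_derivative (\<lambda>v. h (frechet_derivative f (at x) v))) (at x)" if "x \<in> S" for x
      using bounded_linear.has_derivative[OF assms(1) C_k_on_SucD[OF Suc.prems that]] .
    show "C_k_on k S (\<lambda>x. h (frechet_derivative f (at x) v))" for v
      using Suc by auto
  qed
qed

lemma C_k_on_add:
  assumes "open S" "C_k_on k S f" "C_k_on k S g"
  shows "C_k_on k S (\<lambda>x. f x + g x)"
  using assms(2,3)
proof (induction k arbitrary: f g)
  case 0
  then show ?case by (auto intro: continuous_on_add)
next
  case (Suc k)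
  show ?case
  proof (rule C_k_on_SucI[OF assms(1)])
    show "((\<lambda>x. f x + g x) has_derivative
        (\<lambda>v. frechet_derivative f (at x) v + frechet_derivative g (at x) v)) (at x)" if "x \<in> S" for x
      using C_k_on_SucD[OF Suc.prems(1) that] C_k_on_SucD[OF Suc.prems(2) that]
      by (rule has_derivative_add)
    show "C_k_on k S (\<lambda>x. frechet_derivative f (at x) v + frechet_derivative g (at x) v)" for v
      using Suc by auto
  qed
qed

lemma C_k_on_sum:
  assumes "open S" "\<And>i. i \<in> I \<Longrightarrow> C_k_on k S (f i)"
  shows "C_k_on k S (\<lambda>x. \<Sum>i\<in>I. f i x)"
  using assms(2)
  by (induction I rule: infinite_finite_induct) (auto intro: C_k_on_const C_k_on_add[OF assms(1)])

lemma (in bounded_bilinear) C_k_on_prod: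
  assumes "open S" "C_k_on k S f" "C_k_on k S g"
  shows "C_k_on k S (\<lambda>x. prod (f x) (g x))"
  using assms(2,3)
proof (induction k arbitrary: f g)
  case 0
  then show ?case by (auto intro: continuous_on)
next
  case (Suc k)
  show ?case
  proof (rule C_k_on_SucI[OF assms(1)])
    show "((\<lambda>x. prod (f x) (g x)) has_derivative
        (\<lambda>v. prod (f x) (frechet_derivative g (at x) v) + prod (frechet_derivative f (at x) v) (g x))) (at x)"
      if "x \<in> S" for x
      using C_k_on_SucD[OF Suc.prems(1) that] C_k_on_SucD[OF Suc.prems(2) that]
      by (rule FDERIV)
    show "C_k_on k S (\<lambda>x. prod (f x) (frechet_derivative g (at x) v) + prod (frechet_derivative f (at x) v) (g x))" for v
      using Suc.prems C_k_on_Suc_imp[OF Suc.prems(1)] C_k_on_Suc_imp[OF Suc.prems(2)]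
      by (intro C_k_on_add[OF assms(1)] Suc.IH) (simp_all only: C_k_on.simps(2))
  qed
qed

lemmas C_k_on_scaleR = bounded_bilinear.C_k_on_prod[OF bounded_bilinear_scaleR]

lemma C_k_on_inner: "open S \<Longrightarrow> C_k_on k S f \<Longrightarrow> C_k_on k S (\<lambda>x. f x \<bullet> b)"
  by (rule C_k_on_bounded_linear[OF bounded_linear_inner_left])

lemma linear_eq_sum_Basis:
  fixes f :: "'a::euclidean_space \<Rightarrow> 'b::real_vector"
  assumes "linear f"
  shows "f v = (\<Sum>b\<in>Basis. (v \<bullet> b) *\<^sub>R f b)"
proof -
  have "f v = f (\<Sum>b\<in>Basis. (v \<bullet> b) *\<^sub>R b)" by (simp add: euclidean_representation)
  also have "\<dots> = (\<Sum>b\<in>Basis. (v \<bullet> b) *\<^sub>R f b)"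
    using assms by (simp add: linear_sum linear_scale)
  finally show ?thesis .
qed

text \<open>The derivatives of a composition are expanded in a basis so that the induction hypothesis
  applies to compositions with the directional derivatives of the outer function.\<close>

lemma C_k_on_compose:
  fixes f :: "'a::euclidean_space \<Rightarrow> 'b::euclidean_space" and g :: "'b \<Rightarrow> 'c::real_normed_vector"
  assumes "open S" "open T" "f ` S \<subseteq> T" "C_k_on k S f" "C_k_on k T g"
  shows "C_k_on k S (\<lambda>x. g (f x))"
  using assms(4,5)
proof (induction k arbitrary: g)
  case 0
  then show ?case using assms(3) by (auto intro: continuous_on_compose2)
next
  case (Suc k)
  let ?f' = "\<lambda>x. frechet_derivative f (at x)" and ?g' = "\<lambda>x. frechet_derivative g (at x)"
  show ?case
  proof (rule C_k_on_SucI[OF assms(1)])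
    show "((\<lambda>x. g (f x)) has_derivative (\<lambda>v. \<Sum>b\<in>Basis. (?f' x v \<bullet> b) *\<^sub>R ?g' (f x) b)) (at x)"
      if "x \<in> S" for x
    proof -
      have gd: "(g has_derivative ?g' (f x)) (at (f x))"
        using C_k_on_SucD[OF Suc.prems(2)] that assms(3) by auto
      have "((\<lambda>x. g (f x)) has_derivative (\<lambda>v. ?g' (f x) (?f' x v))) (at x)"
        using diff_chain_at[OF C_k_on_SucD[OF Suc.prems(1) that] gd] by (simp add: o_def)
      then show ?thesis
        by (simp only: linear_eq_sum_Basis[OF has_derivative_linear[OF gd], symmetric])
    qed
    show "C_k_on k S (\<lambda>x. \<Sum>b\<in>Basis. (?f' x v \<bullet> b) *\<^sub>R ?g' (f x) b)" for v
    proof (intro C_k_on_sum C_k_on_scaleR C_k_on_inner assms(1))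
      show "C_k_on k S (\<lambda>x. ?f' x v)" using Suc.prems by auto
      show "C_k_on k S (\<lambda>x. ?g' (f x) b)" for b
        using Suc.prems C_k_on_Suc_imp[OF Suc.prems(1)] by (intro Suc.IH) auto
    qed
  qed
qed

lemma C_k_on_componentwise:
  fixes f :: "'a::euclidean_space \<Rightarrow> 'b::euclidean_space"
  assumes "open S" "\<And>b. b \<in> Basis \<Longrightarrow> C_k_on k S (\<lambda>x. f x \<bullet> b)"
  shows "C_k_on k S f"
proof -
  have "C_k_on k S (\<lambda>x. \<Sum>b\<in>Basis. (f x \<bullet> b) *\<^sub>R b)"
    using assms by (intro C_k_on_sum C_k_on_scaleR C_k_on_const) auto
  then show ?thesis by (simp add: euclidean_representation)
qed

section \<open>The rules for \<open>C_k_on\<close> carried over to smooth maps\<close>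

lemma smooth_on_cong:
  "open S \<Longrightarrow> (\<And>x. x \<in> S \<Longrightarrow> f x = g x) \<Longrightarrow> smooth_on S f \<longleftrightarrow> smooth_on S g"
  unfolding smooth_on_def using C_k_on_cong by blast

lemma smooth_on_congD:
  "open S \<Longrightarrow> smooth_on S f \<Longrightarrow> (\<And>x. x \<in> S \<Longrightarrow> f x = g x) \<Longrightarrow> smooth_on S g"
  using smooth_on_cong[of S f g] by simp

lemma smooth_on_subset: "smooth_on S f \<Longrightarrow> T \<subseteq> S \<Longrightarrow> smooth_on T f"
  unfolding smooth_on_def using C_k_on_subset by blast

lemma smooth_on_local:
  assumes "\<And>x. x \<in> S \<Longrightarrow> \<exists>T. open T \<and> x \<in> T \<and> smooth_on (S \<inter> T) f"
  shows "smooth_on S f"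
  unfolding smooth_on_def
proof
  fix k
  show "C_k_on k S f"
  proof (rule C_k_on_local)
    fix x assume "x \<in> S"
    from assms[OF this] show "\<exists>T. open T \<and> x \<in> T \<and> C_k_on k (S \<inter> T) f"
      by (auto simp: smooth_on_def)
  qed
qed

lemma smooth_on_imp_continuous_on: "smooth_on S f \<Longrightarrow> continuous_on S f"
  unfolding smooth_on_def using C_k_on_imp_continuous_on by blast

lemma smooth_on_has_derivative:
  "smooth_on S f \<Longrightarrow> x \<in> S \<Longrightarrow> (f has_derivative frechet_derivative f (at x)) (at x)"
  unfolding smooth_on_def using C_k_on_SucD by blast

lemma smooth_on_derivative: "smooth_on S f \<Longrightarrow> smooth_on S (\<lambda>x. frechet_derivative f (at x) v)"
  unfolding smooth_on_def using C_k_on.simps(2) by blast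

text \<open>A map is one order smoother than its derivative. In this way the primitives
  \<open>\<theta>\<close> of smooth forms are seen to be smooth.\<close>

lemma smooth_onI:
  assumes "open S" "\<And>x. x \<in> S \<Longrightarrow> (f has_derivative f' x) (at x)"
    and "\<And>v. smooth_on S (\<lambda>x. f' x v)"
  shows "smooth_on S f"
  unfolding smooth_on_def
proof
  fix k
  have "C_k_on (Suc k) S f"
    using assms by (intro C_k_on_SucI[of S f f']) (auto simp: smooth_on_def)
  then show "C_k_on k S f" by (rule C_k_on_Suc_imp)
qed

lemma smooth_on_const: "smooth_on S (\<lambda>x. c)"
  by (simp add: smooth_on_def C_k_on_const)

lemma smooth_on_linear: "bounded_linear f \<Longrightarrow> smooth_on S f"
  by (simp add: smooth_on_def C_k_on_linear)

lemma smooth_on_bounded_linear: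
  "bounded_linear h \<Longrightarrow> open S \<Longrightarrow> smooth_on S f \<Longrightarrow> smooth_on S (\<lambda>x. h (f x))"
  by (simp add: smooth_on_def C_k_on_bounded_linear)

lemma smooth_on_add:
  "open S \<Longrightarrow> smooth_on S f \<Longrightarrow> smooth_on S g \<Longrightarrow> smooth_on S (\<lambda>x. f x + g x)"
  by (simp add: smooth_on_def C_k_on_add)

lemma smooth_on_sum:
  "open S \<Longrightarrow> (\<And>i. i \<in> I \<Longrightarrow> smooth_on S (f i)) \<Longrightarrow> smooth_on S (\<lambda>x. \<Sum>i\<in>I. f i x)"
  by (simp add: smooth_on_def C_k_on_sum)

lemma smooth_on_scaleR:
  "open S \<Longrightarrow> smooth_on S f \<Longrightarrow> smooth_on S g \<Longrightarrow> smooth_on S (\<lambda>x. f x *\<^sub>R g x)"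
  by (simp add: smooth_on_def C_k_on_scaleR)

lemma smooth_on_inner: "open S \<Longrightarrow> smooth_on S f \<Longrightarrow> smooth_on S (\<lambda>x. f x \<bullet> b)"
  by (simp add: smooth_on_def C_k_on_inner)

lemma smooth_on_compose:
  fixes f :: "'a::euclidean_space \<Rightarrow> 'b::euclidean_space" and g :: "'b \<Rightarrow> 'c::real_normed_vector"
  assumes "open S" "open T" "f ` S \<subseteq> T" "smooth_on S f" "smooth_on T g"
  shows "smooth_on S (\<lambda>x. g (f x))"
  using C_k_on_compose[OF assms(1-3)] assms(4,5) unfolding smooth_on_def by blast

lemma smooth_on_componentwise:
  fixes f :: "'a::euclidean_space \<Rightarrow> 'b::euclidean_space"
  assumes "open S" "\<And>b. b \<in> Basis \<Longrightarrow> smooth_on S (\<lambda>x. f x \<bullet> b)"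
  shows "smooth_on S f"
  using C_k_on_componentwise[OF assms(1)] assms(2) unfolding smooth_on_def by blast

lemma smooth_on_Pair:
  fixes f :: "'a::euclidean_space \<Rightarrow> 'b::euclidean_space" and g :: "'a \<Rightarrow> 'c::euclidean_space"
  assumes "open S" "smooth_on S f" "smooth_on S g"
  shows "smooth_on S (\<lambda>x. (f x, g x))"
  by (rule smooth_on_componentwise) (use assms in \<open>auto simp: Basis_prod_def intro: smooth_on_inner smooth_on_const\<close>)

lemma smooth_on_vec:
  fixes f :: "'a::euclidean_space \<Rightarrow> real ^ 'n"
  assumes "open S" "\<And>i. smooth_on S (\<lambda>x. f x $ i)"
  shows "smooth_on S f"
  by (rule smooth_on_componentwise) (use assms in \<open>auto simp: Basis_vec_def inner_axis\<close>)

section \<open>The inverse function theorem for smooth maps\<close>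

lemma linear_inverse:
  assumes "linear A" "\<And>v. A (B v) = v" "\<And>v. B (A v) = v"
  shows "linear B"
proof (rule linearI)
  show "B (v + w) = B v + B w" for v w
    using assms(2)[of v] assms(2)[of w] assms(3)[of "B v + B w"] by (simp add: linear_add[OF assms(1)])
  show "B (r *\<^sub>R v) = r *\<^sub>R B v" for r v
    using assms(2)[of v] assms(3)[of "r *\<^sub>R B v"] by (simp add: linear_scale[OF assms(1)])
qed

text \<open>Joint differentiability follows from differentiability at each fixed vector, because
  expansion in a basis turns the family into finitely many products of a coordinate of the vector
  with a function of the parameter. No norm on the space of linear maps is involved.\<close>

lemma has_derivative_linear_family:
  fixes A :: "'a::euclidean_space \<Rightarrow> 'b::euclidean_space \<Rightarrow> 'c::real_normed_vector"
  assumes "open S" "x \<in> S" "\<And>y. y \<in> S \<Longrightarrow> linear (A y)"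
    and D: "\<And>u. ((\<lambda>y. A y u) has_derivative A' u) (at x)"
  shows "((\<lambda>p. A (fst p) (snd p)) has_derivative (\<lambda>p. A' u (fst p) + A x (snd p))) (at (x, u))"
proof -
  have expand: "A y w = (\<Sum>b\<in>Basis. (w \<bullet> b) *\<^sub>R A y b)" if "y \<in> S" for y w
    using linear_eq_sum_Basis[OF assms(3)[OF that]] .
  have "((\<lambda>y. \<Sum>b\<in>Basis. (u \<bullet> b) *\<^sub>R A y b) has_derivative (\<lambda>w. \<Sum>b\<in>Basis. (u \<bullet> b) *\<^sub>R A' b w)) (at x)"
    by (intro has_derivative_sum has_derivative_scaleR_right D)
  then have "((\<lambda>y. A y u) has_derivative (\<lambda>w. \<Sum>b\<in>Basis. (u \<bullet> b) *\<^sub>R A' b w)) (at x)"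
    by (rule has_derivative_transform_within_open[OF _ assms(1,2)]) (rule expand[symmetric])
  from fun_cong[OF has_derivative_unique[OF D this]]
  have A': "A' u w = (\<Sum>b\<in>Basis. (u \<bullet> b) *\<^sub>R A' b w)" for w .
  have Db: "((\<lambda>p. A (fst p) b) has_derivative (\<lambda>p. A' b (fst p))) (at (x, u))" for b
    by (rule has_derivative_compose[OF bounded_linear_imp_has_derivative[OF bounded_linear_fst]])
      (simp add: D)
  have Di: "((\<lambda>p. snd p \<bullet> b) has_derivative (\<lambda>p. snd p \<bullet> b)) (at (x, u))" for b :: 'b
    by (intro derivative_intros)
  have "((\<lambda>p. \<Sum>b\<in>Basis. (snd p \<bullet> b) *\<^sub>R A (fst p) b) has_derivative
      (\<lambda>p. \<Sum>b\<in>Basis. (u \<bullet> b) *\<^sub>R A' b (fst p) + (snd p \<bullet> b) *\<^sub>R A x b)) (at (x, u))"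
    using has_derivative_scaleR[OF Di Db] by (intro has_derivative_sum) simp
  moreover have "(\<Sum>b\<in>Basis. (u \<bullet> b) *\<^sub>R A' b (fst p) + (snd p \<bullet> b) *\<^sub>R A x b) = A' u (fst p) + A x (snd p)" for p
    by (simp add: sum.distrib A'[symmetric] expand[OF assms(2), symmetric])
  ultimately have *: "((\<lambda>p. \<Sum>b\<in>Basis. (snd p \<bullet> b) *\<^sub>R A (fst p) b) has_derivative
      (\<lambda>p. A' u (fst p) + A x (snd p))) (at (x, u))" by simp
  show ?thesis
    by (rule has_derivative_transform_within_open[OF *, of "S \<times> UNIV"])
      (use assms expand in \<open>auto intro: open_Times\<close>)
qed

text \<open>The map \<open>(y, u) \<mapsto> (y, A y u)\<close> is differentiable with inverse
  \<open>(y, v) \<mapsto> (y, B y v)\<close>. Its derivative is block triangular and hence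
  explicitly invertible, and the second component of the inverse yields the formula;
  differentiability of \<open>B\<close> is a conclusion.\<close>

lemma has_derivative_inverse_family:
  fixes A B :: "'a::euclidean_space \<Rightarrow> 'b::euclidean_space \<Rightarrow> 'b"
  assumes "open S" "x \<in> S" "\<And>y. y \<in> S \<Longrightarrow> linear (A y)"
    and AB: "\<And>y v. y \<in> S \<Longrightarrow> A y (B y v) = v"
    and BA: "\<And>y v. y \<in> S \<Longrightarrow> B y (A y v) = v"
    and D: "\<And>y u. y \<in> S \<Longrightarrow> ((\<lambda>y. A y u) has_derivative A' y u) (at y)"
  shows "((\<lambda>y. B y v) has_derivative (\<lambda>w. - B x (A' x (B x v) w))) (at x)"
proof -
  have linB: "linear (B x)"
    using linear_inverse[OF assms(3)[OF assms(2)] AB[OF assms(2)] BA[OF assms(2)]] .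
  let ?\<Phi> = "\<lambda>p. (fst p, A (fst p) (snd p))" and ?\<Psi> = "\<lambda>p. (fst p, B (fst p) (snd p))"
  let ?\<Phi>' = "\<lambda>x u p. (fst p, A' x u (fst p) + A x (snd p))"
  have D\<Phi>: "(?\<Phi> has_derivative ?\<Phi>' y u) (at (y, u))" if "y \<in> S" for y u
    using has_derivative_linear_family[OF assms(1) that assms(3) D[OF that]]
    by (intro has_derivative_Pair has_derivative_fst) auto
  have cont: "continuous_on (S \<times> UNIV) ?\<Phi>"
  proof (rule continuous_at_imp_continuous_on, safe)
    fix y u assume "y \<in> S"
    then show "isCont ?\<Phi> (y, u)" using D\<Phi> has_derivative_continuous by blast
  qed
  have "(?\<Psi> has_derivative (\<lambda>p. (fst p, B x (snd p - A' x (B x v) (fst p))))) (at (?\<Phi> (x, B x v)))"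
  proof (rule has_derivative_inverse_strong[OF _ _ cont _ D\<Phi>])
    show "?\<Phi>' x (B x v) \<circ> (\<lambda>p. (fst p, B x (snd p - A' x (B x v) (fst p)))) = id"
      using assms(2) by (auto simp: fun_eq_iff AB)
  qed (use assms in \<open>auto intro: open_Times simp: BA\<close>)
  then have *: "(?\<Psi> has_derivative (\<lambda>p. (fst p, B x (snd p - A' x (B x v) (fst p))))) (at (x, v))"
    using assms(2) by (simp add: AB)
  have "((\<lambda>y. snd (?\<Psi> (y, v))) has_derivative (\<lambda>w. snd (w, B x (0 - A' x (B x v) w)))) (at x)"
    using has_derivative_snd[OF diff_chain_at[OF has_derivative_Pair[OF has_derivative_ident has_derivative_const] *]]
    by (simp add: o_def)
  then show ?thesis by (simp add: linear_neg[OF linB])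
qed

text \<open>The derivative \<open>- B y (A' y (B y v) w)\<close> contains \<open>B\<close> but no
  derivative of \<open>B\<close>, so every order of smoothness yields the next. Expansion in a basis
  separates the two occurrences of \<open>B\<close> from \<open>A'\<close>.\<close>

lemma smooth_on_inverse_family:
  fixes A B :: "'a::euclidean_space \<Rightarrow> 'b::euclidean_space \<Rightarrow> 'b"
  assumes S: "open S" and lin: "\<And>y. y \<in> S \<Longrightarrow> linear (A y)"
    and AB: "\<And>y v. y \<in> S \<Longrightarrow> A y (B y v) = v"
    and BA: "\<And>y v. y \<in> S \<Longrightarrow> B y (A y v) = v"
    and smooth: "\<And>u. smooth_on S (\<lambda>y. A y u)"
  shows "smooth_on S (\<lambda>y. B y v)"
proof -
  define A' where "A' y u = frechet_derivative (\<lambda>y. A y u) (at y)" for y u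
  have DA: "((\<lambda>y. A y u) has_derivative A' y u) (at y)" if "y \<in> S" for y u
    unfolding A'_def by (rule smooth_on_has_derivative[OF smooth that])
  have DB: "((\<lambda>y. B y v) has_derivative (\<lambda>w. - B y (A' y (B y v) w))) (at y)" if "y \<in> S" for y v
    by (rule has_derivative_inverse_family[OF S that lin AB BA DA])
  have linB: "linear (B y)" if "y \<in> S" for y
    using linear_inverse[OF lin[OF that] AB[OF that] BA[OF that]] .
  have A'_sum: "A' y u w = (\<Sum>b\<in>Basis. (u \<bullet> b) *\<^sub>R A' y b w)" if "y \<in> S" for y u w
  proof -
    have "((\<lambda>y. \<Sum>b\<in>Basis. (u \<bullet> b) *\<^sub>R A y b) has_derivative (\<lambda>w. \<Sum>b\<in>Basis. (u \<bullet> b) *\<^sub>R A' y b w)) (at y)"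
      by (intro has_derivative_sum has_derivative_scaleR_right DA that)
    then have "((\<lambda>y. A y u) has_derivative (\<lambda>w. \<Sum>b\<in>Basis. (u \<bullet> b) *\<^sub>R A' y b w)) (at y)"
      by (rule has_derivative_transform_within_open[OF _ S that])
        (rule linear_eq_sum_Basis[OF lin, symmetric])
    from fun_cong[OF has_derivative_unique[OF DA[OF that] this]] show ?thesis .
  qed
  have "C_k_on k S (\<lambda>y. B y v)" for k v
  proof (induction k arbitrary: v)
    case 0
    show ?case
      by (auto intro!: continuous_at_imp_continuous_on has_derivative_continuous[OF DB])
  next
    case (Suc k)
    have eq: "(\<Sum>b\<in>Basis. ((\<Sum>b'\<in>Basis. (B y v \<bullet> b') *\<^sub>R A' y b' w) \<bullet> b) *\<^sub>R - B y b) =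
        - B y (A' y (B y v) w)" if "y \<in> S" for y w
      using linear_eq_sum_Basis[OF linB[OF that], of "A' y (B y v) w"]
      by (simp add: A'_sum[OF that, symmetric] sum_negf)
    show ?case
    proof (rule C_k_on_SucI[OF S DB])
      fix w
      have "C_k_on k S (\<lambda>y. \<Sum>b\<in>Basis. ((\<Sum>b'\<in>Basis. (B y v \<bullet> b') *\<^sub>R A' y b' w) \<bullet> b) *\<^sub>R - B y b)"
      proof (intro C_k_on_sum C_k_on_scaleR C_k_on_inner S)
        show "C_k_on k S (\<lambda>y. B y v)" by (rule Suc.IH)
        show "C_k_on k S (\<lambda>y. A' y b' w)" for b'
          using smooth_on_derivative[OF smooth] unfolding A'_def smooth_on_def by blast
        show "C_k_on k S (\<lambda>y. - B y b)" for b
          by (rule C_k_on_bounded_linear[OF bounded_linear_minus[OF bounded_linear_ident] S Suc.IH])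
      qed
      then show "C_k_on k S (\<lambda>y. - B y (A' y (B y v) w))"
        by (rule iffD1[OF C_k_on_cong[OF S], rotated]) (rule eq)
    qed
  qed
  then show ?thesis by (simp add: smooth_on_def)
qed

section \<open>Diffeomorphisms between open subsets of a Euclidean space\<close>

definition diffeo_on :: "'a::euclidean_space set \<Rightarrow> ('a \<Rightarrow> 'a) \<Rightarrow> bool" where
  "diffeo_on U f \<longleftrightarrow> open U \<and> smooth_on U f \<and> inj_on f U \<and> open (f ` U) \<and> smooth_on (f ` U) (inv_into U f)"

text \<open>Invariance of domain makes the image open. The inverse \<open>?g\<close> has derivative
  \<open>inv (?D (?g y))\<close>, the composition of \<open>?g\<close> with a family that is smooth
  by \<open>smooth_on_inverse_family\<close>; so the smoothness of \<open>?g\<close> improves one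
  order at a time.\<close>

lemma diffeo_onI:
  fixes f :: "'a::euclidean_space \<Rightarrow> 'a"
  assumes S: "open S" and sm: "smooth_on S f" and inj: "inj_on f S"
    and injD: "\<And>x. x \<in> S \<Longrightarrow> inj (frechet_derivative f (at x))"
  shows "diffeo_on S f"
proof -
  let ?D = "\<lambda>x. frechet_derivative f (at x)" and ?g = "inv_into S f"
  have lin: "linear (?D x)" if "x \<in> S" for x
    using smooth_on_has_derivative[OF sm that] by (rule has_derivative_linear)
  have DD: "?D x (inv (?D x) v) = v" "inv (?D x) (?D x v) = v" if "x \<in> S" for x v
    using injD[OF that] linear_injective_imp_surjective[OF lin[OF that]]
    by (auto simp: surj_f_inv_f)
  have op: "open (f ` S)"
    using invariance_of_domain[OF smooth_on_imp_continuous_on[OF sm] S inj] .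
  have Dg: "(?g has_derivative inv (?D (?g y))) (at y)" if y: "y \<in> f ` S" for y
  proof -
    have gy: "?g y \<in> S" "f (?g y) = y" using y by (auto intro: inv_into_into f_inv_into_f)
    show ?thesis
    proof (rule has_derivative_inverse_strong_x[where g="?g" and y=y, OF S gy(1) smooth_on_imp_continuous_on[OF sm]])
      show "(f has_derivative ?D (?g y)) (at (?g y))" by (rule smooth_on_has_derivative[OF sm gy(1)])
      show "?D (?g y) \<circ> inv (?D (?g y)) = id" using DD(1)[OF gy(1)] by (simp add: fun_eq_iff)
    qed (use inj gy in auto)
  qed
  have sminv: "smooth_on S (\<lambda>x. inv (?D x) v)" for v
    by (rule smooth_on_inverse_family[OF S lin DD smooth_on_derivative[OF sm]])
  have "C_k_on k (f ` S) ?g" for k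
  proof (induction k)
    case 0
    show ?case by (auto intro!: continuous_at_imp_continuous_on has_derivative_continuous[OF Dg])
  next
    case (Suc k)
    show ?case
    proof (rule C_k_on_SucI[OF op Dg])
      show "C_k_on k (f ` S) (\<lambda>y. inv (?D (?g y)) v)" for v
        using sminv[of v] inj Suc
        by (intro C_k_on_compose[OF op S, of ?g k "\<lambda>x. inv (?D x) v"]) (auto simp: smooth_on_def)
    qed
  qed
  then show ?thesis using S sm inj op by (simp add: diffeo_on_def smooth_on_def)
qed

text \<open>The C1 inverse function theorem supplies a neighbourhood on which the map is injective
  with bijective derivatives; \<open>diffeo_onI\<close> then upgrades the inverse from C1 to
  smooth.\<close>

lemma inverse_function_smooth:
  fixes f :: "'a::euclidean_space \<Rightarrow> 'a"
  assumes S: "open S" and sm: "smooth_on S f" and x0: "x0 \<in> S"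
    and inj: "inj (frechet_derivative f (at x0))"
  obtains U where "diffeo_on U f" "x0 \<in> U" "U \<subseteq> S"
proof -
  let ?D = "\<lambda>x. frechet_derivative f (at x)"
  have bl: "bounded_linear (?D x)" if "x \<in> S" for x
    using smooth_on_has_derivative[OF sm that] by (rule has_derivative_bounded_linear)
  define f' where "f' x = Blinfun (?D x)" for x
  have f': "blinfun_apply (f' x) = ?D x" if "x \<in> S" for x
    unfolding f'_def using bl[OF that] by (simp add: bounded_linear_Blinfun_apply)
  have der: "(f has_derivative blinfun_apply (f' x)) (at x)" if "x \<in> S" for x
    using smooth_on_has_derivative[OF sm that] f'[OF that] by simp
  have cont: "continuous_on S f'"
  proof (rule continuous_on_blinfun_componentwise)
    fix i :: 'a
    have "continuous_on S (\<lambda>x. ?D x i)"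
      by (rule smooth_on_imp_continuous_on[OF smooth_on_derivative[OF sm]])
    then show "continuous_on S (\<lambda>x. blinfun_apply (f' x) i)"
      by (simp add: f' cong: continuous_on_cong)
  qed
  have "linear (?D x0)" using bl[OF x0] by (simp add: bounded_linear.linear)
  then obtain g where g: "linear g" "g \<circ> ?D x0 = id"
    using linear_injective_left_inverse[OF _ inj] by blast
  have "Blinfun g o\<^sub>L f' x0 = id_blinfun"
    using g by (intro blinfun_eqI)
      (simp add: f'[OF x0] bounded_linear_Blinfun_apply linear_conv_bounded_linear[symmetric] pointfree_idE)
  from inverse_function_theorem[OF S der cont x0 this]
  obtain U V g g' where U: "open U" "U \<subseteq> S" "x0 \<in> U" "homeomorphism U V f g"
    and bij: "\<And>y. y \<in> V \<Longrightarrow> bij (blinfun_apply (f' (g y)))" by metis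
  have "inj_on f U" using U(4) by (metis homeomorphism_apply1 inj_on_inverseI)
  moreover have "inj (?D x)" if "x \<in> U" for x
  proof -
    have "f x \<in> V" "g (f x) = x" using U(4) that by (auto simp: homeomorphism_def)
    then show ?thesis using bij[of "f x"] f'[of x] that U(2) by (auto simp: bij_def)
  qed
  ultimately have "diffeo_on U f"
    using U(1,2) smooth_on_subset[OF sm] by (intro diffeo_onI) auto
  then show thesis using that U by blast
qed

lemma diffeo_on_subset:
  assumes "diffeo_on U f" "open V" "V \<subseteq> U"
  shows "diffeo_on V f"
proof -
  have "f ` V = f ` U \<inter> inv_into U f -` V"
    using assms(1,3) by (auto simp: diffeo_on_def f_inv_into_f)
  moreover have "continuous_on (f ` U) (inv_into U f)"
    using assms(1) by (auto simp: diffeo_on_def intro: smooth_on_imp_continuous_on)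
  ultimately have op: "open (f ` V)"
    using assms(1,2) by (metis continuous_on_open_vimage diffeo_on_def inf_commute)
  have inj: "inj_on f V" using assms by (auto simp: diffeo_on_def intro: inj_on_subset)
  have "inv_into U f y = inv_into V f y" if "y \<in> f ` V" for y
    using that assms inj by (auto simp: diffeo_on_def subset_eq)
  then have "smooth_on (f ` V) (inv_into V f)"
    using smooth_on_cong[OF op] assms smooth_on_subset[of "f ` U" _ "f ` V"]
    by (metis diffeo_on_def image_mono)
  then show ?thesis
    using assms op inj by (auto simp: diffeo_on_def intro: smooth_on_subset)
qed

lemma diffeo_on_compose:
  assumes f: "diffeo_on U f" and g: "diffeo_on V g" and sub: "f ` U \<subseteq> V"
  shows "diffeo_on U (\<lambda>x. g (f x))"
proof -
  have g': "diffeo_on (f ` U) g" using diffeo_on_subset[OF g _ sub] f by (simp add: diffeo_on_def)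
  have inj: "inj_on (\<lambda>x. g (f x)) U"
    using f g' by (auto simp: diffeo_on_def inj_on_def)
  have im: "(\<lambda>x. g (f x)) ` U = g ` f ` U" by auto
  have "smooth_on (g ` f ` U) (\<lambda>z. inv_into U f (inv_into (f ` U) g z))"
    by (rule smooth_on_compose[where T="f ` U"]) (use f g' in \<open>auto simp: diffeo_on_def\<close>)
  moreover have "inv_into U (\<lambda>x. g (f x)) z = inv_into U f (inv_into (f ` U) g z)" if "z \<in> g ` f ` U" for z
    using that f g' inv_into_f_f[OF inj] by (auto simp: diffeo_on_def)
  ultimately have "smooth_on (g ` f ` U) (inv_into U (\<lambda>x. g (f x)))"
    using smooth_on_cong[of "g ` f ` U"] g' by (metis diffeo_on_def)
  moreover have "smooth_on U (\<lambda>x. g (f x))"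
    by (rule smooth_on_compose[where T="f ` U"]) (use f g' in \<open>auto simp: diffeo_on_def\<close>)
  ultimately show ?thesis using f g' inj by (simp add: diffeo_on_def im)
qed

section \<open>Second derivatives and closed one-forms\<close>

text \<open>The second difference over a parallelogram is symmetric in \<open>u\<close> and
  \<open>v\<close>, whereas the mean value theorem, applied first along \<open>u\<close> and then
  along \<open>v\<close>, turns it into one particular mixed derivative. The bound on
  \<open>h\<close> keeps the parallelogram inside the ball.\<close>

lemma second_difference_mean_value:
  fixes f :: "'a::euclidean_space \<Rightarrow> real"
  assumes S: "open S" "ball x d \<subseteq> S" and f: "C_k_on (Suc (Suc 0)) S f"
    and h: "0 < h" "h * (norm u + norm v) < d"
  obtains y where "norm (y - x) < d"
    "f (x + h *\<^sub>R u + h *\<^sub>R v) - f (x + h *\<^sub>R u) - f (x + h *\<^sub>R v) + f x =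
      h * h * frechet_derivative (\<lambda>y. frechet_derivative f (at y) u) (at y) v"
proof -
  let ?fu = "\<lambda>y. frechet_derivative f (at y) u"
  have C1: "C_k_on (Suc 0) S ?fu" using f by auto
  have near: "norm (s *\<^sub>R u + t *\<^sub>R v) < d" if "0 \<le> s" "s \<le> h" "0 \<le> t" "t \<le> h" for s t
  proof -
    have "norm (s *\<^sub>R u + t *\<^sub>R v) \<le> s * norm u + t * norm v"
      using norm_triangle_ineq[of "s *\<^sub>R u" "t *\<^sub>R v"] that by simp
    also have "\<dots> \<le> h * norm u + h * norm v"
      using that by (intro add_mono mult_right_mono) auto
    finally show ?thesis using h by (simp add: algebra_simps)
  qed
  have inS: "x + s *\<^sub>R u + t *\<^sub>R v \<in> S" if "0 \<le> s" "s \<le> h" "0 \<le> t" "t \<le> h" for s t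
    using near[OF that] S(2) by (auto simp: subset_eq dist_norm algebra_simps norm_minus_commute)
  have line: "((\<lambda>s. g (a + s *\<^sub>R w)) has_real_derivative frechet_derivative g (at (a + s *\<^sub>R w)) w) (at s)"
    if "C_k_on (Suc 0) S g" "a + s *\<^sub>R w \<in> S" for g :: "'a \<Rightarrow> real" and a w s
  proof -
    have gd: "(g has_derivative frechet_derivative g (at (a + s *\<^sub>R w))) (at (a + s *\<^sub>R w))"
      by (rule C_k_on_SucD[OF that])
    have "((\<lambda>s. a + s *\<^sub>R w) has_derivative (\<lambda>r. r *\<^sub>R w)) (at s)"
      by (auto intro!: derivative_eq_intros)
    note this = diff_chain_at[OF this gd]
    moreover have "(\<lambda>r. frechet_derivative g (at (a + s *\<^sub>R w)) (r *\<^sub>R w)) =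
        (*) (frechet_derivative g (at (a + s *\<^sub>R w)) w)"
      by (simp add: fun_eq_iff linear_scale[OF has_derivative_linear[OF gd]])
    ultimately show ?thesis by (simp add: has_field_derivative_def o_def)
  qed
  define g where "g s = f (x + h *\<^sub>R v + s *\<^sub>R u) - f (x + s *\<^sub>R u)" for s
  have gd: "(g has_real_derivative (?fu (x + h *\<^sub>R v + s *\<^sub>R u) - ?fu (x + s *\<^sub>R u))) (at s)"
    if "0 \<le> s" "s \<le> h" for s
    unfolding g_def
    using that inS[of s h] inS[of s 0] h(1) C_k_on_Suc_imp[OF f]
    by (intro DERIV_diff line) (auto simp: algebra_simps simp del: C_k_on.simps(2))
  obtain \<xi> where \<xi>: "0 < \<xi>" "\<xi> < h"
    "g h - g 0 = (h - 0) * (?fu (x + h *\<^sub>R v + \<xi> *\<^sub>R u) - ?fu (x + \<xi> *\<^sub>R u))"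
    using MVT2[OF h(1) gd] by auto
  have kd: "((\<lambda>t. ?fu (x + \<xi> *\<^sub>R u + t *\<^sub>R v)) has_real_derivative
      frechet_derivative ?fu (at (x + \<xi> *\<^sub>R u + t *\<^sub>R v)) v) (at t)" if "0 \<le> t" "t \<le> h" for t
    using that inS[of \<xi> t] \<xi> by (intro line C1) auto
  obtain \<eta> where \<eta>: "0 < \<eta>" "\<eta> < h"
    "?fu (x + \<xi> *\<^sub>R u + h *\<^sub>R v) - ?fu (x + \<xi> *\<^sub>R u + 0 *\<^sub>R v) =
      (h - 0) * frechet_derivative ?fu (at (x + \<xi> *\<^sub>R u + \<eta> *\<^sub>R v)) v"
    using MVT2[OF h(1) kd] by blast
  show thesis
  proof (rule that[of "x + \<xi> *\<^sub>R u + \<eta> *\<^sub>R v"])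
    show "norm (x + \<xi> *\<^sub>R u + \<eta> *\<^sub>R v - x) < d" using near[of \<xi> \<eta>] \<xi> \<eta> by (simp add: algebra_simps)
    show "f (x + h *\<^sub>R u + h *\<^sub>R v) - f (x + h *\<^sub>R u) - f (x + h *\<^sub>R v) + f x =
      h * h * frechet_derivative ?fu (at (x + \<xi> *\<^sub>R u + \<eta> *\<^sub>R v)) v"
      using \<xi>(3) \<eta>(3) by (simp add: g_def algebra_simps)
  qed
qed

text \<open>The two mixed derivatives take equal values at two points near \<open>x\<close>, because
  both represent the same second difference; continuity transfers the equality to
  \<open>x\<close>.\<close>

lemma second_derivative_symmetric_real:
  fixes f :: "'a::euclidean_space \<Rightarrow> real"
  assumes S: "open S" "x \<in> S" and f: "C_k_on (Suc (Suc 0)) S f"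
  shows "frechet_derivative (\<lambda>y. frechet_derivative f (at y) u) (at x) v =
    frechet_derivative (\<lambda>y. frechet_derivative f (at y) v) (at x) u"
proof -
  define H where "H u v y = frechet_derivative (\<lambda>y. frechet_derivative f (at y) u) (at y) v" for u v y
  have cont: "continuous_on S (H u v)" for u v using f by (auto simp: H_def[abs_def])
  have "\<bar>H u v x - H v u x\<bar> \<le> e" if "e > 0" for e
  proof -
    obtain r where r: "r > 0" "ball x r \<subseteq> S" using S open_contains_ball by blast
    have *: "\<exists>d>0. \<forall>y\<in>S. dist y x < d \<longrightarrow> dist (H u v y) (H u v x) < e / 2" for u v
      using cont[of u v] S(2) \<open>e > 0\<close> unfolding continuous_on_iff by (meson half_gt_zero)
    obtain d1 d2 where d12: "d1 > 0" "d2 > 0"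
      "\<And>y. y \<in> S \<Longrightarrow> dist y x < d1 \<Longrightarrow> dist (H u v y) (H u v x) < e / 2"
      "\<And>y. y \<in> S \<Longrightarrow> dist y x < d2 \<Longrightarrow> dist (H v u y) (H v u x) < e / 2"
      using *[of u v] *[of v u] by metis
    define d where "d = min r (min d1 d2)"
    have d: "d > 0" "ball x d \<subseteq> S" using r d12 by (auto simp: d_def)
    \<comment> \<open>The summand 1 covers the case where \<open>u\<close> and \<open>v\<close> both
      vanish and makes the bound on \<open>h * (norm u + norm v)\<close> strict.\<close>
    define h where "h = d / (norm u + norm v + 1)"
    have pos: "norm u + norm v + 1 > 0"
      by (simp add: add_nonneg_pos)
    have h: "h > 0" "h * (norm u + norm v) < d" "h * (norm v + norm u) < d"
      using d(1) pos by (auto simp: h_def field_simps)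
    obtain y1 where y1: "norm (y1 - x) < d"
      "f (x + h *\<^sub>R u + h *\<^sub>R v) - f (x + h *\<^sub>R u) - f (x + h *\<^sub>R v) + f x = h * h * H u v y1"
      using second_difference_mean_value[OF S(1) d(2) f h(1,2)] unfolding H_def by metis
    obtain y2 where y2: "norm (y2 - x) < d"
      "f (x + h *\<^sub>R v + h *\<^sub>R u) - f (x + h *\<^sub>R v) - f (x + h *\<^sub>R u) + f x = h * h * H v u y2"
      using second_difference_mean_value[OF S(1) d(2) f h(1,3)] unfolding H_def by metis
    have "h * h * H u v y1 = h * h * H v u y2"
      using y1(2) y2(2) by (simp add: algebra_simps)
    then have "H u v y1 = H v u y2" using h(1) by simp
    moreover have "y1 \<in> S" "y2 \<in> S"
      using y1(1) y2(1) d(2) by (auto simp: dist_norm norm_minus_commute subset_eq)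
    then have "dist (H u v y1) (H u v x) < e / 2" "dist (H v u y2) (H v u x) < e / 2"
      using y1(1) y2(1) d12(3)[of y1] d12(4)[of y2] by (simp_all add: d_def dist_norm)
    ultimately show ?thesis unfolding dist_real_def by linarith
  qed
  then have "\<bar>H u v x - H v u x\<bar> \<le> 0" by (rule field_le_epsilon) simp
  then show ?thesis by (simp add: H_def)
qed

lemma second_derivative_symmetric:
  fixes f :: "'a::euclidean_space \<Rightarrow> 'b::euclidean_space"
  assumes S: "open S" "x \<in> S" and f: "smooth_on S f"
  shows "frechet_derivative (\<lambda>y. frechet_derivative f (at y) u) (at x) v =
    frechet_derivative (\<lambda>y. frechet_derivative f (at y) v) (at x) u"
proof (rule euclidean_eqI)
  fix b :: 'b
  have inner: "frechet_derivative (\<lambda>y. g y \<bullet> b) (at y) w = frechet_derivative g (at y) w \<bullet> b"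
    if "smooth_on S g" "y \<in> S" for g :: "'a \<Rightarrow> 'b" and y w
    using frechet_derivative_at[OF has_derivative_inner_left[OF smooth_on_has_derivative[OF that]]]
    by metis
  have *: "frechet_derivative (\<lambda>y. frechet_derivative f (at y) u) (at x) v \<bullet> b =
    frechet_derivative (\<lambda>y. frechet_derivative (\<lambda>y. f y \<bullet> b) (at y) u) (at x) v" for u v
  proof -
    have "frechet_derivative (\<lambda>y. frechet_derivative (\<lambda>y. f y \<bullet> b) (at y) u) (at x) =
      frechet_derivative (\<lambda>y. frechet_derivative f (at y) u \<bullet> b) (at x)"
      using inner[OF f] by (intro frechet_derivative_cong_open[OF S]) auto
    then show ?thesis using inner[OF smooth_on_derivative[OF f] S(2)] by simp
  qed
  have "C_k_on (Suc (Suc 0)) S (\<lambda>y. f y \<bullet> b)"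
    using smooth_on_inner[OF S(1) f] unfolding smooth_on_def by blast
  from second_derivative_symmetric_real[OF S this]
  show "frechet_derivative (\<lambda>y. frechet_derivative f (at y) u) (at x) v \<bullet> b =
    frechet_derivative (\<lambda>y. frechet_derivative f (at y) v) (at x) u \<bullet> b" by (simp add: *)
qed

text \<open>Poincare lemma: integrating the form along segments from a base point gives a primitive,
  by differentiation under the integral sign. The values are vectors so that all components of a
  coframe are integrated at once.\<close>

lemma closed_form_exact:
  fixes a :: "'a::euclidean_space \<Rightarrow> 'a \<Rightarrow> 'b::euclidean_space"
  assumes S: "open S" "convex S" and lin: "\<And>x. x \<in> S \<Longrightarrow> linear (a x)"
    and sm: "\<And>u. smooth_on S (\<lambda>x. a x u)"
    and closed: "\<And>x u v. x \<in> S \<Longrightarrow>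
      frechet_derivative (\<lambda>y. a y u) (at x) v = frechet_derivative (\<lambda>y. a y v) (at x) u"
  obtains \<theta> where "\<And>x. x \<in> S \<Longrightarrow> (\<theta> has_derivative a x) (at x)"
proof (cases "S = {}")
  case True
  then show ?thesis using that by blast
next
  case False
  then obtain x0 where x0: "x0 \<in> S" by blast
  define p where "p x t = x0 + t *\<^sub>R (x - x0)" for x and t :: real
  have p: "p x t \<in> S" if "x \<in> S" "t \<in> {0..1}" for x t
  proof -
    have "p x t = (1 - t) *\<^sub>R x0 + t *\<^sub>R x" by (simp add: p_def algebra_simps)
    then show ?thesis using convexD[OF S(2) x0 that(1), of "1 - t" t] that(2) by auto
  qed
  define a' where "a' y u = frechet_derivative (\<lambda>y. a y u) (at y)" for y u
  have Da: "((\<lambda>y. a y u) has_derivative a' y u) (at y)" if "y \<in> S" for y u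
    unfolding a'_def by (rule smooth_on_has_derivative[OF sm that])
  have cont_a: "continuous_on S (\<lambda>y. a y u)" for u by (rule smooth_on_imp_continuous_on[OF sm])
  have cont_a': "continuous_on S (\<lambda>y. a' y u v)" for u v
    unfolding a'_def by (rule smooth_on_imp_continuous_on[OF smooth_on_derivative[OF sm]])
  \<comment> \<open>Closedness exchanges the two vector arguments of \<open>a'\<close>, so linearity
    becomes available in the first one. Below, that argument is \<open>x - x0\<close> and varies
    with \<open>x\<close>; the expansion gives joint continuity.\<close>
  have a'_sum: "a' y u v = (\<Sum>b\<in>Basis. (u \<bullet> b) *\<^sub>R a' y v b)" if "y \<in> S" for y u v
    using linear_eq_sum_Basis[OF has_derivative_linear[OF Da[OF that, of v]], of u] closed[OF that]
    by (simp add: a'_def)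
  \<comment> \<open>The derivative of the integrand with respect to \<open>x\<close>, packaged as a
    bounded operator for differentiation under the integral.\<close>
  define fx where "fx x t = Blinfun (\<lambda>u. t *\<^sub>R a' (p x t) (x - x0) u + a (p x t) u)" for x t
  have fx: "blinfun_apply (fx x t) = (\<lambda>u. t *\<^sub>R a' (p x t) (x - x0) u + a (p x t) u)"
    if "x \<in> S" "t \<in> {0..1}" for x t
    unfolding fx_def
    using p[OF that] lin Da
    by (intro bounded_linear_Blinfun_apply bounded_linear_add bounded_linear_scaleR_right
        bounded_linear_const_scaleR has_derivative_bounded_linear[OF Da])
      (auto simp: linear_conv_bounded_linear)
  define \<theta> where "\<theta> x = integral (cbox 0 1) (\<lambda>t. a (p x t) (x - x0))" for x
  have "(\<theta> has_derivative a x) (at x)" if x: "x \<in> S" for x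
  proof -
    have der: "((\<lambda>x. a (p x t) (x - x0)) has_derivative blinfun_apply (fx x t)) (at x within S)"
      if "x \<in> S" "t \<in> cbox 0 1" for x t
    proof -
      have t: "t \<in> {0..1}" using that by simp
      have "((\<lambda>x. (p x t, x - x0)) has_derivative (\<lambda>u. (t *\<^sub>R u, u))) (at x)"
        unfolding p_def by (auto intro!: derivative_eq_intros simp: algebra_simps)
      from diff_chain_at[OF this has_derivative_linear_family[OF S(1) p[OF that(1) t] lin Da[OF p[OF that(1) t]]]]
      have "((\<lambda>x. a (p x t) (x - x0)) has_derivative (\<lambda>u. a' (p x t) (x - x0) (t *\<^sub>R u) + a (p x t) u)) (at x)"
        by (simp add: o_def)
      then show ?thesis
        using linear_scale[OF has_derivative_linear[OF Da[OF p[OF that(1) t]]]]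
        by (simp add: fx[OF that(1) t] has_derivative_at_withinI)
    qed
    have p_cont: "continuous_on (S \<times> {0..1}) (\<lambda>z. p (fst z) (snd z))"
      unfolding p_def by (intro continuous_intros)
    have p_im: "(\<lambda>z. p (fst z) (snd z)) ` (S \<times> {0..1}) \<subseteq> S" using p by auto
    note cont_p = continuous_on_compose2[OF _ p_cont p_im]
    have cont_fx: "continuous_on (S \<times> cbox 0 1) (\<lambda>(x, t). fx x t)"
    proof (rule continuous_on_blinfun_componentwise)
      fix i :: 'a
      have "continuous_on (S \<times> {0..1}) (\<lambda>z. snd z *\<^sub>R (\<Sum>b\<in>Basis. ((fst z - x0) \<bullet> b) *\<^sub>R
          a' (p (fst z) (snd z)) i b) + a (p (fst z) (snd z)) i)"
        by (intro continuous_intros cont_p[OF cont_a] cont_p[OF cont_a'])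
      moreover have "(snd z *\<^sub>R (\<Sum>b\<in>Basis. ((fst z - x0) \<bullet> b) *\<^sub>R
          a' (p (fst z) (snd z)) i b) + a (p (fst z) (snd z)) i) =
          blinfun_apply (case z of (x, t) \<Rightarrow> fx x t) i" if "z \<in> S \<times> {0..1}" for z
        using that by (auto simp: fx a'_sum[OF p, symmetric])
      ultimately show "continuous_on (S \<times> cbox 0 1) (\<lambda>z. blinfun_apply (case z of (x, t) \<Rightarrow> fx x t) i)"
        using continuous_on_cong by fastforce
    qed
    have cont_line: "continuous_on {0..1} (\<lambda>t. g (p x t))" if "continuous_on S g" "x \<in> S"
      for x and g :: "'a \<Rightarrow> 'b"
      using that p by (intro continuous_on_compose2[OF that(1)]) (auto simp: p_def intro!: continuous_intros)
    have int: "(\<lambda>t. a (p x t) (x - x0)) integrable_on cbox 0 1" if "x \<in> S" for x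
      using cont_line[OF cont_a that] by (intro integrable_continuous) simp
    have D: "(\<theta> has_derivative integral (cbox 0 1) (fx x)) (at x within S)"
      unfolding \<theta>_def[abs_def] by (rule leibniz_rule[OF der int cont_fx x S(2)])
    have "integral (cbox 0 1) (fx x) u = a x u" for u
    proof -
      have "continuous_on (cbox 0 1) (fx x)"
        using continuous_on_compose2[OF cont_fx, of "cbox 0 1" "\<lambda>t. (x, t)"] x
        by (auto simp: continuous_on_Pair)
      then have "fx x integrable_on cbox 0 1" by (rule integrable_continuous)
      then have eq: "integral (cbox 0 1) (fx x) u = integral (cbox 0 1) (\<lambda>t. blinfun_apply (fx x t) u)"
        using integral_linear[OF _ blinfun.bounded_linear_left, of "fx x" "cbox 0 1" u]
        by (simp add: o_def)
      \<comment> \<open>After closedness has swapped \<open>u\<close> and \<open>x - x0\<close>, the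
        integrand is the derivative of \<open>t *\<^sub>R a (p x t) u\<close>, whose boundary values
        are \<open>a x u\<close> at 1 and zero at 0.\<close>
      have "((\<lambda>t. blinfun_apply (fx x t) u) has_integral 1 *\<^sub>R a (p x 1) u - 0 *\<^sub>R a (p x 0) u) {0..1}"
      proof (rule fundamental_theorem_of_calculus)
        fix t :: real assume t: "t \<in> {0..1}"
        have "((\<lambda>t. p x t) has_derivative (\<lambda>s. s *\<^sub>R (x - x0))) (at t)"
          unfolding p_def by (auto intro!: derivative_eq_intros)
        from diff_chain_at[OF this Da[OF p[OF x t], of u]]
        have "((\<lambda>t. a (p x t) u) has_derivative (\<lambda>s. a' (p x t) u (s *\<^sub>R (x - x0)))) (at t)"
          by (simp add: o_def)
        then have "((\<lambda>t. a (p x t) u) has_vector_derivative a' (p x t) u (x - x0)) (at t)"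
          using linear_scale[OF has_derivative_linear[OF Da[OF p[OF x t]]]]
          by (simp add: has_vector_derivative_def)
        then have "((\<lambda>t. t *\<^sub>R a (p x t) u) has_vector_derivative
            (t *\<^sub>R a' (p x t) u (x - x0) + 1 *\<^sub>R a (p x t) u)) (at t)"
          by (intro has_vector_derivative_scaleR DERIV_ident)
        moreover have "a' (p x t) u (x - x0) = a' (p x t) (x - x0) u"
          unfolding a'_def by (rule closed[OF p[OF x t]])
        ultimately show "((\<lambda>t. t *\<^sub>R a (p x t) u) has_vector_derivative blinfun_apply (fx x t) u) (at t within {0..1})"
          by (simp add: fx[OF x t] has_vector_derivative_at_within)
      qed simp
      then have "integral (cbox 0 1) (\<lambda>t. blinfun_apply (fx x t) u) = a x u"
        by (simp add: integral_unique p_def)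
      with eq show ?thesis by simp
    qed
    then have "blinfun_apply (integral (cbox 0 1) (fx x)) = a x" by (rule ext)
    with D show ?thesis by (simp add: at_within_open[OF x S(1)])
  qed
  then show thesis by (rule that)
qed

section \<open>Discrete subgroups\<close>

definition int_span :: "'a::real_vector set \<Rightarrow> 'a set" where
  "int_span B = {\<Sum>b\<in>B. of_int (m b) *\<^sub>R b |m. True}"

text \<open>The coordinate functions are extended to linear forms on the whole space, so that they
  may be applied before membership in the span is known.\<close>

lemma dual_coordinates:
  fixes B :: "'a::real_vector set"
  assumes "independent B" "finite B"
  obtains \<phi> :: "'a \<Rightarrow> 'a \<Rightarrow> real" where "\<And>b. linear (\<phi> b)"
    "\<And>b b'. b' \<in> B \<Longrightarrow> \<phi> b b' = (if b = b' then 1 else 0)"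
    "\<And>x. x \<in> span B \<Longrightarrow> x = (\<Sum>b\<in>B. \<phi> b x *\<^sub>R b)"
proof -
  have "\<exists>g. linear g \<and> (\<forall>b'\<in>B. g b' = (if b = b' then 1 else (0::real)))" for b
    using linear_independent_extend[OF assms(1), of "\<lambda>b'. if b = b' then 1 else (0::real)"] by simp
  then have "\<forall>b. \<exists>g. linear g \<and> (\<forall>b'\<in>B. g b' = (if b = b' then 1 else (0::real)))" by blast
  from choice[OF this] obtain \<phi> where \<phi>: "\<And>b. linear (\<phi> b)"
    "\<And>b b'. b' \<in> B \<Longrightarrow> \<phi> b b' = (if b = b' then 1 else (0::real))" by blast
  have "x = (\<Sum>b\<in>B. \<phi> b x *\<^sub>R b)" if "x \<in> span B" for x
  proof -
    have "x \<in> range (\<lambda>u. \<Sum>b\<in>B. u b *\<^sub>R b)" using that span_finite[OF assms(2)] by simp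
    then obtain u where u: "x = (\<Sum>b\<in>B. u b *\<^sub>R b)" by (rule rangeE)
    have "\<phi> b x = u b" if "b \<in> B" for b
    proof -
      have "\<phi> b x = (\<Sum>b'\<in>B. u b' * \<phi> b b')"
        by (simp add: u linear_sum[OF \<phi>(1)] linear_scale[OF \<phi>(1)])
      also have "\<dots> = (\<Sum>b'\<in>B. if b = b' then u b' else 0)"
        by (rule sum.cong) (auto simp: \<phi>(2))
      also have "\<dots> = u b" using that assms(2) by simp
      finally show ?thesis .
    qed
    then show ?thesis using u by simp
  qed
  then show thesis using that \<phi> by blast
qed

text \<open>The induction step adds the element \<open>w\<close> whose coordinate along the new direction \<open>v\<close> is
  positive and minimal; it exists because the subgroup meets the unit box in a finite set.\<close>

lemma discrete_subgroup_basis: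
  fixes G :: "'a::euclidean_space set"
  assumes zero: "0 \<in> G" and diff: "\<And>x y. x \<in> G \<Longrightarrow> y \<in> G \<Longrightarrow> x - y \<in> G"
    and disc: "\<delta> > 0" "\<And>x. x \<in> G \<Longrightarrow> norm x < \<delta> \<Longrightarrow> x = 0"
    and S: "finite S" "independent S" "S \<subseteq> G"
  shows "\<exists>B. finite B \<and> independent B \<and> span B = span S \<and> G \<inter> span S = int_span B"
  using S
proof (induction S rule: finite_induct)
  case empty
  show ?case using zero by (intro exI[of _ "{}"]) (auto simp: int_span_def independent_empty)
next
  case (insert v S)
  have neg: "- x \<in> G" if "x \<in> G" for x using diff[OF zero that] by simp
  have add: "x + y \<in> G" if "x \<in> G" "y \<in> G" for x y using diff[OF that(1) neg[OF that(2)]] by simp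
  have nmult: "of_nat n *\<^sub>R x \<in> G" if "x \<in> G" for n x
    by (induction n) (use zero add that in \<open>auto simp: scaleR_add_left\<close>)
  have zmult: "of_int m *\<^sub>R x \<in> G" if "x \<in> G" for m :: int and x
    using nmult[OF that] neg[OF nmult[OF that]] by (cases m rule: int_cases2) auto
  have zsum: "(\<Sum>b\<in>C. of_int (m b) *\<^sub>R b) \<in> G" if "C \<subseteq> G" for C :: "'a set" and m :: "'a \<Rightarrow> int"
    using that by (induction C rule: infinite_finite_induct) (auto intro: zero add zmult)
  obtain B where B: "finite B" "independent B" "span B = span S" "G \<inter> span S = int_span B"
    using insert by (auto simp: independent_insert split: if_splits)
  have BG: "B \<subseteq> G"
  proof
    fix b assume b: "b \<in> B"
    have "(\<Sum>b'\<in>B. of_int ((\<lambda>b'. if b' = b then 1 else 0) b') *\<^sub>R b') = b"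
      using b B(1) by (simp add: if_distrib[of of_int] if_distrib[of "\<lambda>r. r *\<^sub>R _"] cong: if_cong)
    from this[symmetric] have "b \<in> int_span B"
      unfolding int_span_def by (intro CollectI exI[of _ "\<lambda>b'. if b' = b then 1 else 0"] conjI TrueI)
    then show "b \<in> G" using B(4) by auto
  qed
  have v: "v \<notin> span B" "v \<in> G" using insert.prems insert.hyps(2) by (simp_all add: independent_insert B(3))
  define B' where "B' = insert v B"
  have vB: "v \<notin> B" using v(1) span_base by blast
  have B': "finite B'" "independent B'" "B' \<subseteq> G" "span B' = span (insert v S)"
    using B v BG vB by (auto simp: B'_def independent_insert span_insert)
  obtain \<phi> where \<phi>: "\<And>b. linear (\<phi> b)" "\<And>b b'. b' \<in> B' \<Longrightarrow> \<phi> b b' = (if b = b' then 1 else (0::real))"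
    "\<And>x. x \<in> span B' \<Longrightarrow> x = (\<Sum>b\<in>B'. \<phi> b x *\<^sub>R b)"
    by (rule dual_coordinates[OF B'(2,1)]) blast
  define K where "K = {x \<in> G \<inter> span B'. \<forall>b\<in>B'. \<phi> b x \<in> {0..1}}"
  have "bounded K"
  proof (rule boundedI)
    fix x assume x: "x \<in> K"
    have "norm x \<le> (\<Sum>b\<in>B'. norm (\<phi> b x *\<^sub>R b))"
      using \<phi>(3)[of x] x norm_sum[of "\<lambda>b. \<phi> b x *\<^sub>R b" B'] by (simp add: K_def)
    also have "\<dots> \<le> (\<Sum>b\<in>B'. norm b)"
      using x by (intro sum_mono) (auto simp: K_def mult_left_le_one_le)
    finally show "norm x \<le> (\<Sum>b\<in>B'. norm b)" .
  qed
  moreover have "uniform_discrete K"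
    unfolding uniform_discrete_def
  proof (intro exI[of _ \<delta>] conjI ballI impI disc(1))
    fix x y assume "x \<in> K" "y \<in> K" "dist x y < \<delta>"
    then show "x = y" using disc(2)[OF diff[of x y]] by (auto simp: K_def dist_norm)
  qed
  ultimately have finK: "finite K" using uniform_discrete_finite_iff by blast
  let ?P = "{x \<in> K. \<phi> v x > 0}"
  have "v \<in> ?P" using v(2) \<phi>(2)[of v] by (auto simp: K_def B'_def span_base)
  then have ne: "?P \<noteq> {}" by blast
  have finP: "finite ?P" using finK by simp
  obtain w where w: "w \<in> ?P" "\<And>x. x \<in> ?P \<Longrightarrow> \<phi> v w \<le> \<phi> v x"
    using arg_min_if_finite[OF finP ne, of "\<phi> v"] by (meson not_le)
  have wG: "w \<in> G" "w \<in> span B'" "\<phi> v w > 0" "\<phi> v w \<le> 1" using w(1) by (auto simp: K_def B'_def)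
  have \<phi>v_B: "\<phi> v x = 0" if "x \<in> span B" for x
  proof -
    have "span B \<subseteq> {x. \<phi> v x = 0}"
      using \<phi>(2)[of _ v] vB
      by (intro span_minimal) (auto simp: B'_def linear_add[OF \<phi>(1)] linear_scale[OF \<phi>(1)] linear_0[OF \<phi>(1)] subspace_def)
    then show ?thesis using that by blast
  qed
  have in_span_B: "x \<in> span B" if "x \<in> span B'" "\<phi> v x = 0" for x
  proof -
    have "x = (\<Sum>b\<in>B. \<phi> b x *\<^sub>R b)"
      using \<phi>(3)[OF that(1)] vB B(1) that(2) by (simp add: B'_def)
    then show ?thesis by (metis (no_types, lifting) span_sum span_scale span_base)
  qed
  have integral: "\<exists>m::int. x - of_int m *\<^sub>R w \<in> G \<inter> span B" if x: "x \<in> G" "x \<in> span B'" for x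
  proof -
    \<comment> \<open>Division with remainder by \<open>w\<close>, measured along
      \<open>v\<close>.\<close>
    define m where "m = \<lfloor>\<phi> v x / \<phi> v w\<rfloor>"
    define x' where "x' = x - of_int m *\<^sub>R w"
    have x': "x' \<in> G" "x' \<in> span B'"
      unfolding x'_def using x wG by (auto intro: diff zmult span_diff span_scale)
    have "\<phi> v x' = \<phi> v w * frac (\<phi> v x / \<phi> v w)"
      using wG(3) by (simp add: x'_def m_def linear_diff[OF \<phi>(1)] linear_scale[OF \<phi>(1)] frac_def field_simps)
    then have r: "0 \<le> \<phi> v x'" "\<phi> v x' < \<phi> v w"
      using wG(3) frac_lt_1[of "\<phi> v x / \<phi> v w"] by auto
    \<comment> \<open>Removing integer parts along \<open>B\<close> brings the remainder into the
      unit box and leaves its coordinate along \<open>v\<close> unchanged, as \<open>v\<close> is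
      not in \<open>B\<close>. A positive coordinate would then contradict the minimality of
      \<open>w\<close>.\<close>
    define y where "y = x' - (\<Sum>b\<in>B. of_int \<lfloor>\<phi> b x'\<rfloor> *\<^sub>R b)"
    have \<phi>y: "\<phi> c y = \<phi> c x' - (\<Sum>b\<in>B. of_int \<lfloor>\<phi> b x'\<rfloor> * (if c = b then 1 else 0))" for c
      using \<phi>(2)[of _ c]
      by (auto simp: y_def linear_diff[OF \<phi>(1)] linear_scale[OF \<phi>(1)] linear_sum[OF \<phi>(1)] B'_def
          intro!: sum.cong)
    have \<phi>y_v: "\<phi> v y = \<phi> v x'" unfolding \<phi>y using vB by (auto intro: sum.neutral)
    have \<phi>y_B: "\<phi> c y = frac (\<phi> c x')" if "c \<in> B" for c
      unfolding \<phi>y frac_def using that B(1) by (simp add: if_distrib[of "\<lambda>r. _ * r"] cong: if_cong)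
    have "y \<in> G" unfolding y_def using x' zsum[OF BG] by (rule_tac diff) auto
    moreover have "y \<in> span B'" unfolding y_def
      using x' by (intro span_diff span_sum span_scale) (auto simp: B'_def span_base)
    moreover have "\<phi> c y \<in> {0..1}" if "c \<in> B'" for c
      using that r wG(4) frac_lt_1[of "\<phi> c x'"]
      by (cases "c = v") (auto simp: \<phi>y_v \<phi>y_B B'_def)
    ultimately have "y \<in> K" by (simp add: K_def)
    then have "\<phi> v x' = 0" using w(2)[of y] r by (fastforce simp: \<phi>y_v)
    then show ?thesis using x' in_span_B x'_def by blast
  qed
  define B2 where "B2 = insert w B"
  have wB: "w \<notin> span B" using \<phi>v_B wG(3) by force
  then have wB': "w \<notin> B" using span_base by blast
  have span_eq: "span B2 = span B'"
  proof
    show "span B2 \<subseteq> span B'"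
      using wG(2) by (intro span_minimal) (auto simp: B2_def B'_def span_base subspace_span)
    \<comment> \<open>The factor cancels the coordinate along \<open>v\<close>, so \<open>w\<close>
      may replace \<open>v\<close> as the new basis vector.\<close>
    have "v - (1 / \<phi> v w) *\<^sub>R w \<in> span B"
      using wG \<phi>(2)[of v v]
      by (intro in_span_B span_diff span_scale)
        (auto simp: B'_def span_base linear_diff[OF \<phi>(1)] linear_scale[OF \<phi>(1)])
    then have "v - (1 / \<phi> v w) *\<^sub>R w + (1 / \<phi> v w) *\<^sub>R w \<in> span B2"
      unfolding B2_def using span_mono[of B "insert w B"]
      by (intro span_add span_scale) (auto simp: span_base)
    then have "v \<in> span B2" by simp
    then show "span B' \<subseteq> span B2"
      by (intro span_minimal) (auto simp: B2_def B'_def span_base subspace_span)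
  qed
  have "G \<inter> span B' = int_span B2"
  proof
    show "int_span B2 \<subseteq> G \<inter> span B'"
    proof
      fix x assume "x \<in> int_span B2"
      then obtain m where m: "x = (\<Sum>b\<in>B2. of_int (m b) *\<^sub>R b)" by (auto simp: int_span_def)
      have "B2 \<subseteq> G" using BG wG by (auto simp: B2_def)
      then have "x \<in> G" using zsum m by blast
      moreover have "x \<in> span B2" unfolding m by (intro span_sum span_scale span_base)
      ultimately show "x \<in> G \<inter> span B'" using span_eq by blast
    qed
    show "G \<inter> span B' \<subseteq> int_span B2"
    proof
      fix x assume "x \<in> G \<inter> span B'"
      then obtain m where m: "x - of_int m *\<^sub>R w \<in> G \<inter> span B" using integral by blast
      then obtain k where k: "x - of_int m *\<^sub>R w = (\<Sum>b\<in>B. of_int (k b) *\<^sub>R b)"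
        using B by (auto simp: int_span_def)
      have "(\<Sum>b\<in>B2. of_int ((k(w := m)) b) *\<^sub>R b) = of_int m *\<^sub>R w + (\<Sum>b\<in>B. of_int ((k(w := m)) b) *\<^sub>R b)"
        unfolding B2_def using B(1) wB' by simp
      also have "(\<Sum>b\<in>B. of_int ((k(w := m)) b) *\<^sub>R b) = (\<Sum>b\<in>B. of_int (k b) *\<^sub>R b)"
        using wB' by (intro sum.cong) auto
      also have "of_int m *\<^sub>R w + \<dots> = x" using k by (metis add_diff_cancel_left' diff_add_cancel add.commute)
      finally have "x = (\<Sum>b\<in>B2. of_int ((k(w := m)) b) *\<^sub>R b)" by (rule sym)
      then show "x \<in> int_span B2" unfolding int_span_def by blast
    qed
  qed
  then show ?case
    using B B' wB span_eq by (intro exI[of _ B2]) (auto simp: B2_def independent_insert)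
qed

text \<open>Cocompactness forces the subgroup to span the space, since otherwise it would leave
  points arbitrarily far away in an orthogonal direction. An integral basis then has as many
  elements as the standard one, and \<open>P\<close> reads off the coordinates in it.\<close>

lemma lattice_coordinates:
  fixes G :: "(real ^ 'n) set"
  assumes zero: "0 \<in> G" and diff: "\<And>x y. x \<in> G \<Longrightarrow> y \<in> G \<Longrightarrow> x - y \<in> G"
    and disc: "\<delta> > 0" "\<And>x. x \<in> G \<Longrightarrow> norm x < \<delta> \<Longrightarrow> x = 0"
    and cocompact: "\<And>x. \<exists>g\<in>G. norm (x - g) \<le> R"
  obtains P Q :: "real ^ 'n \<Rightarrow> real ^ 'n" where "linear P" "linear Q" "\<And>x. P (Q x) = x" "\<And>x. Q (P x) = x"
    "\<And>x. x \<in> G \<longleftrightarrow> (\<forall>i. P x $ i \<in> \<int>)"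
proof -
  obtain S where S: "S \<subseteq> G" "independent S" "G \<subseteq> span S" "card S = dim G" by (rule basis_exists)
  have span: "span S = UNIV"
  proof (rule ccontr)
    assume "span S \<noteq> UNIV"
    then obtain a where a: "a \<noteq> 0" "\<forall>x\<in>span S. a \<bullet> x = 0" using span_not_UNIV_orthogonal by blast
    \<comment> \<open>A vector orthogonal to the span and of length
      \<open>\<bar>R\<bar> + 1\<close>: its distance from every element of \<open>G\<close> exceeds
      \<open>R\<close>.\<close>
    define x where "x = ((\<bar>R\<bar> + 1) / norm a) *\<^sub>R a"
    obtain g where g: "g \<in> G" "norm (x - g) \<le> R" using cocompact by blast
    have ag: "a \<bullet> g = 0" using a(2) S(3) g(1) by blast
    have "(\<bar>R\<bar> + 1) * norm a = a \<bullet> x"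
      using a(1) by (simp add: x_def power2_norm_eq_inner[symmetric] power2_eq_square field_simps)
    also have "\<dots> = a \<bullet> (x - g)" using ag by (simp add: inner_diff_right)
    also have "\<dots> \<le> norm a * norm (x - g)" by (rule norm_cauchy_schwarz)
    also have "\<dots> \<le> norm a * R" using g(2) by (intro mult_left_mono) auto
    finally have "(\<bar>R\<bar> + 1) * norm a \<le> R * norm a" by (simp add: mult.commute)
    then show False using a(1) by (simp add: mult_le_cancel_right)
  qed
  obtain B where B: "finite B" "independent B" "span B = UNIV" "G = int_span B"
    using discrete_subgroup_basis[OF zero diff disc independent_imp_finite[OF S(2)] S(2,1)] span by auto
  have "card B = CARD('n)"
    using dim_eq_card_independent[OF B(2)] dim_span[of B] B(3) by simp
  then obtain e :: "'n \<Rightarrow> real ^ 'n" where e: "bij_betw e UNIV B"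
    using B(1) finite_same_card_bij[of "UNIV :: 'n set" B] by auto
  define Q where "Q x = (\<Sum>i\<in>UNIV. x $ i *\<^sub>R e i)" for x :: "real ^ 'n"
  have Q: "linear Q"
    unfolding Q_def by (intro linearI) (simp_all add: scaleR_add_left sum.distrib scaleR_sum_right)
  have Q_sum: "Q (\<chi> i. u (e i)) = (\<Sum>b\<in>B. u b *\<^sub>R b)" for u
    unfolding Q_def using sum.reindex_bij_betw[OF e, of "\<lambda>b. u b *\<^sub>R b"] by simp
  have "surj Q"
  proof -
    have "\<exists>x. Q x = y" for y
    proof -
    have "y \<in> range (\<lambda>u. \<Sum>b\<in>B. u b *\<^sub>R b)" using B(3) span_finite[OF B(1)] by simp
    then obtain u where "y = (\<Sum>b\<in>B. u b *\<^sub>R b)" by (rule rangeE)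
    then show "\<exists>x. Q x = y" using Q_sum by blast
    qed
    then show ?thesis unfolding surj_def by metis
  qed
  then obtain P where P: "linear P" "\<And>x. P (Q x) = x" "\<And>x. Q (P x) = x"
    using linear_surjective_isomorphism[OF Q] by blast
  have "x \<in> G \<longleftrightarrow> (\<forall>i. P x $ i \<in> \<int>)" for x
  proof
    assume "x \<in> G"
    then obtain m where "x = (\<Sum>b\<in>B. of_int (m b) *\<^sub>R b)" using B(4) by (auto simp: int_span_def)
    then have "x = Q (\<chi> i. of_int (m (e i)))" by (simp only: Q_sum[of "\<lambda>b. of_int (m b)"])
    then show "\<forall>i. P x $ i \<in> \<int>" by (simp add: P(2))
  next
    assume "\<forall>i. P x $ i \<in> \<int>"
    then have "\<forall>i. \<exists>k. P x $ i = of_int k" by (auto elim: Ints_cases)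
    from choice[OF this] obtain k where k: "\<And>i. P x $ i = of_int (k i)" by blast
    define m where "m b = k (inv_into UNIV e b)" for b
    have "m (e i) = k i" for i using e by (simp add: m_def bij_betw_def)
    then have "P x = (\<chi> i. of_int (m (e i)))" by (simp add: vec_eq_iff k)
    then have "x = Q (\<chi> i. of_int (m (e i)))" by (metis P(3))
    then have "x = (\<Sum>b\<in>B. of_int (m b) *\<^sub>R b)" by (simp only: Q_sum[of "\<lambda>b. of_int (m b)"])
    then show "x \<in> G" unfolding B(4) int_span_def by blast
  qed
  then show thesis using that P Q by blast
qed

section \<open>Charts\<close>

lemma is_chart_domain: "is_chart X c \<Longrightarrow> fst c \<subseteq> topspace X"
  by (simp add: is_chart_def openin_subset)

lemma is_chart_inj:
  assumes "is_chart X c"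
  shows "inj_on (snd c) (fst c)"
proof -
  have "inj_on (snd c) (topspace (subtopology X (fst c)))"
    using assms unfolding is_chart_def by (blast intro: homeomorphic_imp_injective_map)
  then show ?thesis using is_chart_domain[OF assms] by (simp add: Int_absorb1)
qed

lemma is_chart_open_image:
  assumes "is_chart X c" "openin X W" "W \<subseteq> fst c"
  shows "open (snd c ` W)"
proof -
  have "openin (subtopology X (fst c)) W"
    using assms(2,3) by (auto simp: openin_subtopology)
  then have "openin (top_of_set (snd c ` fst c)) (snd c ` W)"
    using assms(1) homeomorphic_imp_open_map unfolding is_chart_def open_map_def by blast
  then show ?thesis using assms(1) by (auto simp: is_chart_def openin_open_trans)
qed

lemma is_chart_open_preimage:
  assumes "is_chart X c" "open V"
  shows "openin X {p \<in> fst c. snd c p \<in> V}"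
proof -
  have "continuous_map (subtopology X (fst c)) (top_of_set (snd c ` fst c)) (snd c)"
    using assms(1) by (simp add: is_chart_def homeomorphic_imp_continuous_map)
  then have "openin (subtopology X (fst c)) {p \<in> topspace (subtopology X (fst c)). snd c p \<in> snd c ` fst c \<inter> V}"
    using assms(2) by (intro openin_continuous_map_preimage) (auto simp: openin_open)
  moreover have "{p \<in> topspace (subtopology X (fst c)). snd c p \<in> snd c ` fst c \<inter> V} = {p \<in> fst c. snd c p \<in> V}"
    using is_chart_domain[OF assms(1)] by auto
  ultimately show ?thesis
    using assms(1) by (metis is_chart_def openin_trans_full)
qed

section \<open>Developing maps of translation structures\<close>

text \<open>The constant by which two charts differ may change from one component of their overlap
  to another, so it is only required to exist near each common point.\<close>

locale translation_atlas =
  fixes Y :: "'m topology" and T :: "('m, 'e::euclidean_space) chart set"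
  assumes compact: "compact_space Y" and connected: "connected_space Y" and Hausdorff: "Hausdorff_space Y"
    and charts: "c \<in> T \<Longrightarrow> is_chart Y c"
    and covering: "(\<Union>c\<in>T. fst c) = topspace Y"
    and translation: "c \<in> T \<Longrightarrow> d \<in> T \<Longrightarrow> p \<in> fst c \<Longrightarrow> p \<in> fst d \<Longrightarrow>
      \<exists>W. openin Y W \<and> p \<in> W \<and> W \<subseteq> fst c \<inter> fst d \<and>
        (\<forall>q\<in>W. snd d q - snd c q = snd d p - snd c p)"
begin

text \<open>Near \<open>t\<close> the map \<open>j\<close> inverts the charts up to a translation;
  integral curves of the dual frame, with all time parameters taken together, have this property.
  Because the condition concerns one parameter at a time, maps can be developments on any set and
  arbitrary elsewhere.\<close>

definition develops_at :: "('e \<Rightarrow> 'm) \<Rightarrow> 'e \<Rightarrow> bool" where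
  "develops_at j t \<longleftrightarrow> j t \<in> topspace Y \<and> (\<forall>c\<in>T. j t \<in> fst c \<longrightarrow>
     (\<exists>e>0. \<forall>t'\<in>ball t e. j t' \<in> fst c \<and> snd c (j t') = snd c (j t) + (t' - t)))"

lemma chart_at:
  assumes "p \<in> topspace Y"
  obtains c where "c \<in> T" "p \<in> fst c" "is_chart Y c"
  using assms covering charts by blast

lemma develops_at_topspace: "develops_at j t \<Longrightarrow> j t \<in> topspace Y"
  by (simp add: develops_at_def)

text \<open>One chart is enough, as any other chart of \<open>T\<close> differs from it by a
  constant near \<open>j t\<close>. The radius \<open>r\<close> keeps \<open>j t'\<close> inside the
  neighbourhood \<open>W\<close> where this constant is valid.\<close>

lemma develops_atI:
  assumes c: "c \<in> T" "j t \<in> fst c" and e: "e > 0"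
    and j: "\<And>t'. t' \<in> ball t e \<Longrightarrow> j t' \<in> fst c \<and> snd c (j t') = snd c (j t) + (t' - t)"
  shows "develops_at j t"
  unfolding develops_at_def
proof (intro conjI ballI impI)
  show "j t \<in> topspace Y" using covering c by blast
  fix d assume d: "d \<in> T" "j t \<in> fst d"
  obtain W where W: "openin Y W" "j t \<in> W" "W \<subseteq> fst c \<inter> fst d"
    "\<forall>q\<in>W. snd d q - snd c q = snd d (j t) - snd c (j t)"
    using translation[OF c(1) d(1) c(2) d(2)] by blast
  have "open (snd c ` W)" using is_chart_open_image[OF charts[OF c(1)] W(1)] W(3) by blast
  then obtain r where r: "r > 0" "ball (snd c (j t)) r \<subseteq> snd c ` W"
    using W(2) open_contains_ball by blast
  show "\<exists>e>0. \<forall>t'\<in>ball t e. j t' \<in> fst d \<and> snd d (j t') = snd d (j t) + (t' - t)"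
  proof (intro exI[of _ "min e r"] conjI ballI)
    show "min e r > 0" using e r(1) by simp
    fix t' assume t': "t' \<in> ball t (min e r)"
    then have jt': "j t' \<in> fst c" "snd c (j t') = snd c (j t) + (t' - t)" using j by auto
    have "snd c (j t') \<in> ball (snd c (j t)) r"
      using t' by (simp add: jt'(2) dist_norm norm_minus_commute)
    then have "snd c (j t') \<in> snd c ` W" using r(2) by blast
    then obtain q where "snd c (j t') = snd c q" "q \<in> W" by (rule imageE)
    then have jW: "j t' \<in> W"
      using inj_onD[OF is_chart_inj[OF charts[OF c(1)]]] W(3) jt'(1) by blast
    then show "j t' \<in> fst d" using W(3) by blast
    show "snd d (j t') = snd d (j t) + (t' - t)"
      using bspec[OF W(4) jW] jt'(2) by (simp add: algebra_simps)
  qed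
qed

lemma develops_atE:
  assumes "develops_at j t" "c \<in> T" "j t \<in> fst c"
  obtains e where "e > 0" "\<And>t'. t' \<in> ball t e \<Longrightarrow> j t' \<in> fst c"
    "\<And>t'. t' \<in> ball t e \<Longrightarrow> snd c (j t') = snd c (j t) + (t' - t)"
  using assms unfolding develops_at_def by blast

lemma develops_at_cong:
  assumes "develops_at j t" "e > 0" "\<And>t'. t' \<in> ball t e \<Longrightarrow> j' t' = j t'"
  shows "develops_at j' t"
proof -
  obtain c where c: "c \<in> T" "j t \<in> fst c" "is_chart Y c"
    by (rule chart_at[OF develops_at_topspace[OF assms(1)]])
  obtain r where r: "r > 0" "\<And>t'. t' \<in> ball t r \<Longrightarrow> j t' \<in> fst c"
    "\<And>t'. t' \<in> ball t r \<Longrightarrow> snd c (j t') = snd c (j t) + (t' - t)"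
    using develops_atE[OF assms(1) c(1,2)] by blast
  have jt: "j' t = j t" using assms(2,3) by simp
  show ?thesis
  proof (rule develops_atI[OF c(1)])
    show "j' t \<in> fst c" using c(2) jt by simp
    show "min e r > 0" using assms(2) r(1) by simp
    show "j' t' \<in> fst c \<and> snd c (j' t') = snd c (j' t) + (t' - t)" if "t' \<in> ball t (min e r)" for t'
      using that r(2,3)[of t'] assms(3)[of t'] jt by simp
  qed
qed

lemma develops_at_shift:
  assumes "develops_at j (t + s)"
  shows "develops_at (\<lambda>u. j (u + s)) t"
proof -
  obtain c where c: "c \<in> T" "j (t + s) \<in> fst c" "is_chart Y c"
    by (rule chart_at[OF develops_at_topspace[OF assms]])
  obtain r where r: "r > 0" "\<And>t'. t' \<in> ball (t + s) r \<Longrightarrow> j t' \<in> fst c"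
    "\<And>t'. t' \<in> ball (t + s) r \<Longrightarrow> snd c (j t') = snd c (j (t + s)) + (t' - (t + s))"
    using develops_atE[OF assms c(1,2)] by blast
  show ?thesis
  proof (rule develops_atI[of c _ _ r])
    fix t' assume "t' \<in> ball t r"
    then have "t' + s \<in> ball (t + s) r" by (simp add: dist_norm)
    then show "j (t' + s) \<in> fst c \<and> snd c (j (t' + s)) = snd c (j (t + s)) + (t' - t)"
      using r(2,3)[of "t' + s"] by simp
  qed (use c r(1) in auto)
qed

lemma develops_at_chart_inv:
  assumes c: "c \<in> T" and t: "x + t \<in> snd c ` fst c"
  shows "develops_at (\<lambda>t. chart_inv c (x + t)) t"
proof -
  have "open (snd c ` fst c)" using charts[OF c] by (simp add: is_chart_def)
  then obtain e where e: "e > 0" "ball (x + t) e \<subseteq> snd c ` fst c"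
    using t open_contains_ball by blast
  show ?thesis
  proof (rule develops_atI[OF c _ e(1)])
    show "chart_inv c (x + t) \<in> fst c" by (rule inv_into_into[OF t])
    fix t' assume "t' \<in> ball t e"
    then have "x + t' \<in> ball (x + t) e" by simp
    then have "x + t' \<in> snd c ` fst c" using e(2) by blast
    then show "chart_inv c (x + t') \<in> fst c \<and>
        snd c (chart_inv c (x + t')) = snd c (chart_inv c (x + t)) + (t' - t)"
      using t by (simp add: inv_into_into f_inv_into_f)
  qed
qed

lemma develops_at_nhd:
  assumes "develops_at j t" "openin Y W" "j t \<in> W"
  obtains e where "e > 0" "\<And>t'. t' \<in> ball t e \<Longrightarrow> j t' \<in> W"
proof -
  obtain c where c: "c \<in> T" "j t \<in> fst c" "is_chart Y c"
    by (rule chart_at[OF develops_at_topspace[OF assms(1)]])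
  obtain e where e: "e > 0" "\<And>t'. t' \<in> ball t e \<Longrightarrow> j t' \<in> fst c"
    "\<And>t'. t' \<in> ball t e \<Longrightarrow> snd c (j t') = snd c (j t) + (t' - t)"
    using develops_atE[OF assms(1) c(1,2)] by blast
  have "open (snd c ` (W \<inter> fst c))"
    using c(3) assms(2) by (intro is_chart_open_image[OF c(3)]) (auto simp: is_chart_def)
  then obtain r where r: "r > 0" "ball (snd c (j t)) r \<subseteq> snd c ` (W \<inter> fst c)"
    using assms(3) c(2) open_contains_ball by blast
  show thesis
  proof (rule that[of "min e r"])
    fix t' assume t': "t' \<in> ball t (min e r)"
    then have jt': "j t' \<in> fst c" "snd c (j t') = snd c (j t) + (t' - t)" using e(2,3)[of t'] by auto
    have "snd c (j t') \<in> ball (snd c (j t)) r"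
      using t' by (simp add: jt'(2) dist_norm norm_minus_commute)
    then have "snd c (j t') \<in> snd c ` (W \<inter> fst c)" using r(2) by blast
    then obtain q where "snd c (j t') = snd c q" "q \<in> W \<inter> fst c" by (rule imageE)
    then show "j t' \<in> W"
      using inj_onD[OF is_chart_inj[OF c(3)]] jt'(1) by blast
  qed (use e(1) r(1) in auto)
qed

lemma develops_at_unique:
  assumes "develops_at j t" "develops_at j' t" "j t = j' t"
  obtains e where "e > 0" "\<And>t'. t' \<in> ball t e \<Longrightarrow> j t' = j' t'"
proof -
  obtain c where c: "c \<in> T" "j t \<in> fst c" "is_chart Y c"
    by (rule chart_at[OF develops_at_topspace[OF assms(1)]])
  obtain e where e: "e > 0" "\<And>t'. t' \<in> ball t e \<Longrightarrow> j t' \<in> fst c"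
    "\<And>t'. t' \<in> ball t e \<Longrightarrow> snd c (j t') = snd c (j t) + (t' - t)"
    using develops_atE[OF assms(1) c(1,2)] by blast
  have "j' t \<in> fst c" using c(2) assms(3) by simp
  then obtain e' where e': "e' > 0" "\<And>t'. t' \<in> ball t e' \<Longrightarrow> j' t' \<in> fst c"
    "\<And>t'. t' \<in> ball t e' \<Longrightarrow> snd c (j' t') = snd c (j' t) + (t' - t)"
    using develops_atE[OF assms(2) c(1)] by blast
  show thesis
  proof (rule that[of "min e e'"])
    fix t' assume "t' \<in> ball t (min e e')"
    then have "snd c (j t') = snd c (j' t')" "j t' \<in> fst c" "j' t' \<in> fst c"
      using e(2,3)[of t'] e'(2,3)[of t'] assms(3) by auto
    then show "j t' = j' t'" using inj_onD[OF is_chart_inj[OF c(3)]] by blast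
  qed (use e(1) e'(1) in auto)
qed

text \<open>Agreement is an open condition because both maps invert the same chart, and disagreement
  is open because the space is Hausdorff; a connected set admits only one of the two.\<close>

lemma development_unique:
  assumes S: "connected S" and j: "\<And>t. t \<in> S \<Longrightarrow> develops_at j t" and j': "\<And>t. t \<in> S \<Longrightarrow> develops_at j' t"
    and t0: "t0 \<in> S" "j t0 = j' t0" and t: "t \<in> S"
  shows "j t = j' t"
proof -
  \<comment> \<open>Interiors are taken since the openness is only established around points of
    \<open>S\<close>, and nothing is known of the maps elsewhere.\<close>
  let ?U = "interior {t. j t = j' t}" and ?V = "interior {t. j t \<noteq> j' t}"
  have U: "t \<in> ?U" if tS: "t \<in> S" "j t = j' t" for t
  proof -
    obtain e where "e > 0" "\<And>t'. t' \<in> ball t e \<Longrightarrow> j t' = j' t'"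
      using develops_at_unique[OF j[OF tS(1)] j'[OF tS(1)] tS(2)] by blast
    then show ?thesis unfolding mem_interior by (intro exI[of _ e]) auto
  qed
  have V: "t \<in> ?V" if tS: "t \<in> S" "j t \<noteq> j' t" for t
  proof -
    have "j t \<in> topspace Y" "j' t \<in> topspace Y" using j j' tS(1) by (auto simp: develops_at_def)
    then obtain N N' where N: "openin Y N" "openin Y N'" "j t \<in> N" "j' t \<in> N'" "disjnt N N'"
      using Hausdorff tS(2) unfolding Hausdorff_space_def by blast
    obtain e where e: "e > 0" "\<And>t'. t' \<in> ball t e \<Longrightarrow> j t' \<in> N"
      using develops_at_nhd[OF j[OF tS(1)] N(1,3)] by blast
    obtain e' where e': "e' > 0" "\<And>t'. t' \<in> ball t e' \<Longrightarrow> j' t' \<in> N'"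
      using develops_at_nhd[OF j'[OF tS(1)] N(2,4)] by blast
    have "ball t (min e e') \<subseteq> {t. j t \<noteq> j' t}"
      using e e' N(5) by (fastforce simp: disjnt_iff)
    then show ?thesis unfolding mem_interior using e(1) e'(1) by (intro exI[of _ "min e e'"]) auto
  qed
  have "?U \<inter> S = {} \<or> ?V \<inter> S = {}"
  proof (rule connectedD[OF S])
    show "?U \<inter> ?V \<inter> S = {}" using interior_subset by blast
    show "S \<subseteq> ?U \<union> ?V" using U V by blast
  qed auto
  then show ?thesis using U V t t0 by blast
qed

text \<open>A development is a local homeomorphism: a small ball around \<open>t\<close> covers the
  part of the chart domain whose coordinates lie in the corresponding ball.\<close>

lemma development_open_image:
  assumes "open S" "\<And>t. t \<in> S \<Longrightarrow> develops_at j t"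
  shows "openin Y (j ` S)"
proof (subst openin_subopen, intro ballI)
  fix p assume "p \<in> j ` S"
  then obtain t where t: "t \<in> S" "p = j t" by blast
  obtain c where c: "c \<in> T" "j t \<in> fst c" "is_chart Y c"
    by (rule chart_at[OF develops_at_topspace[OF assms(2)[OF t(1)]]])
  obtain e where e: "e > 0" "\<And>t'. t' \<in> ball t e \<Longrightarrow> j t' \<in> fst c"
    "\<And>t'. t' \<in> ball t e \<Longrightarrow> snd c (j t') = snd c (j t) + (t' - t)"
    using develops_atE[OF assms(2)[OF t(1)] c(1,2)] by blast
  obtain r where r: "r > 0" "ball t r \<subseteq> S" using assms(1) t(1) open_contains_ball by blast
  let ?W = "{q \<in> fst c. snd c q \<in> ball (snd c (j t)) (min e r)}"
  have "?W \<subseteq> j ` S"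
  proof
    fix q assume q: "q \<in> ?W"
    define t' where "t' = t + (snd c q - snd c (j t))"
    have t': "t' \<in> ball t (min e r)"
      using q by (simp add: t'_def dist_norm norm_minus_commute)
    then have "snd c (j t') = snd c q" "j t' \<in> fst c" using e(2,3)[of t'] by (auto simp: t'_def)
    then have "j t' = q" using q inj_onD[OF is_chart_inj[OF c(3)]] by blast
    then show "q \<in> j ` S" using t' r(2) by auto
  qed
  moreover have "openin Y ?W" by (rule is_chart_open_preimage[OF c(3) open_ball])
  moreover have "p \<in> ?W" using t(2) c(2) e(1) r(1) by simp
  ultimately show "\<exists>W. openin Y W \<and> p \<in> W \<and> W \<subseteq> j ` S" by blast
qed

text \<open>A Lebesgue number argument: if the chart image contains a ball of radius
  \<open>r\<close> around the coordinates of \<open>p\<close>, then all points within half that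
  distance still have room \<open>r / 2\<close>. Finitely many of these neighbourhoods cover the
  compact space.\<close>

lemma uniform_development:
  obtains \<epsilon> where "\<epsilon> > 0"
    "\<And>p. p \<in> topspace Y \<Longrightarrow> \<exists>j. j 0 = p \<and> (\<forall>t\<in>ball 0 \<epsilon>. develops_at j t)"
proof -
  have "\<exists>W r. openin Y W \<and> p \<in> W \<and> r > 0 \<and>
      (\<exists>c\<in>T. W \<subseteq> fst c \<and> (\<forall>q\<in>W. ball (snd c q) r \<subseteq> snd c ` fst c))"
    if p: "p \<in> topspace Y" for p
  proof -
    obtain c where c: "c \<in> T" "p \<in> fst c" "is_chart Y c" using chart_at[OF p] by blast
    then obtain r where r: "r > 0" "ball (snd c p) r \<subseteq> snd c ` fst c"
      unfolding is_chart_def using open_contains_ball by blast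
    let ?W = "{q \<in> fst c. snd c q \<in> ball (snd c p) (r / 2)}"
    have "ball (snd c q) (r / 2) \<subseteq> snd c ` fst c" if "q \<in> ?W" for q
    proof
      fix z assume "z \<in> ball (snd c q) (r / 2)"
      then have "z \<in> ball (snd c p) r"
        using that dist_triangle[of "snd c p" z "snd c q"] by simp
      then show "z \<in> snd c ` fst c" using r(2) by blast
    qed
    then show ?thesis
      using c r(1) is_chart_open_preimage[OF c(3) open_ball[of "snd c p" "r / 2"]]
      by (intro exI[of _ ?W] exI[of _ "r / 2"]) auto
  qed
  then obtain W r where W: "\<And>p. p \<in> topspace Y \<Longrightarrow> openin Y (W p) \<and> p \<in> W p \<and> r p > 0 \<and>
      (\<exists>c\<in>T. W p \<subseteq> fst c \<and> (\<forall>q\<in>W p. ball (snd c q) (r p) \<subseteq> snd c ` fst c))"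
    by metis
  have "\<exists>\<F>. finite \<F> \<and> \<F> \<subseteq> W ` topspace Y \<and> topspace Y \<subseteq> \<Union>\<F>"
    using compact W unfolding compact_space_alt by (elim allE[of _ "W ` topspace Y"]) auto
  then obtain K where K: "finite K" "K \<subseteq> topspace Y" "topspace Y \<subseteq> \<Union>(W ` K)"
    by (metis finite_subset_image)
  \<comment> \<open>The inserted 1 keeps the minimum meaningful when \<open>K\<close> is
    empty.\<close>
  define \<epsilon> where "\<epsilon> = Min (insert 1 (r ` K))"
  have \<epsilon>: "\<epsilon> > 0" "\<And>k. k \<in> K \<Longrightarrow> \<epsilon> \<le> r k"
    using K W by (auto simp: \<epsilon>_def)
  show thesis
  proof (rule that[OF \<epsilon>(1)])
    fix p assume "p \<in> topspace Y"
    then obtain k where k: "k \<in> K" "p \<in> W k" using K(3) by blast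
    then obtain c where c: "c \<in> T" "p \<in> fst c" "ball (snd c p) (r k) \<subseteq> snd c ` fst c"
      using W[of k] K(2) by blast
    have "chart_inv c (snd c p + 0) = p"
      using c is_chart_inj[OF charts[OF c(1)]] by simp
    moreover have "develops_at (\<lambda>t. chart_inv c (snd c p + t)) t" if "t \<in> ball 0 \<epsilon>" for t
      using c(3) that \<epsilon>(2)[OF k(1)] by (intro develops_at_chart_inv c(1)) (force simp: dist_norm)
    ultimately show "\<exists>j. j 0 = p \<and> (\<forall>t\<in>ball 0 \<epsilon>. develops_at j t)"
      by (intro exI[of _ "\<lambda>t. chart_inv c (snd c p + t)"]) auto
  qed
qed

text \<open>Developments on a ball obey the local group law \<open>J (J p t) s = J p (s + t)\<close>, so that
  \<open>t \<mapsto> J (J p (t / 2)) (t / 2)\<close> is a development on a ball of twice the radius.\<close>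

lemma development_double:
  assumes ex: "\<And>p. p \<in> topspace Y \<Longrightarrow> \<exists>j. j 0 = p \<and> (\<forall>t\<in>ball 0 r. develops_at j t)"
    and p: "p \<in> topspace Y" and r: "r > 0"
  shows "\<exists>j. j 0 = p \<and> (\<forall>t\<in>ball 0 (2 * r). develops_at j t)"
proof -
  from ex have "\<forall>p. \<exists>j. p \<in> topspace Y \<longrightarrow> j 0 = p \<and> (\<forall>t\<in>ball 0 r. develops_at j t)" by blast
  from choice[OF this] obtain J where
    J_all: "\<forall>p. p \<in> topspace Y \<longrightarrow> J p 0 = p \<and> (\<forall>t\<in>ball 0 r. develops_at (J p) t)" by blast
  have J: "J p 0 = p" "norm t < r \<Longrightarrow> develops_at (J p) t" if "p \<in> topspace Y" for p t
    using J_all that by auto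
  have JY: "J p t \<in> topspace Y" if "p \<in> topspace Y" "norm t < r" for p t
    using J(2)[OF that] by (simp add: develops_at_def)
  \<comment> \<open>Both sides are developments in \<open>s\<close> with the same value at 0. They
    are controlled on an intersection of two balls, which is convex and hence connected.\<close>
  have law: "J (J p t) s = J p (s + t)"
    if p: "p \<in> topspace Y" and "norm s < r" "norm t < r" "norm (s + t) < r" for p s t
  proof (rule development_unique[of "ball 0 r \<inter> ball (- t) r" "J (J p t)" "\<lambda>s. J p (s + t)" 0 s])
    show "connected (ball 0 r \<inter> ball (- t) r)"
      by (intro convex_connected convex_Int convex_ball)
    show "develops_at (J (J p t)) u" if "u \<in> ball 0 r \<inter> ball (- t) r" for u
      using that J(2)[OF JY[OF p \<open>norm t < r\<close>]] by simp
    show "develops_at (\<lambda>s. J p (s + t)) u" if "u \<in> ball 0 r \<inter> ball (- t) r" for u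
      using that J(2)[OF p, of "u + t"]
      by (intro develops_at_shift) (simp add: dist_norm norm_minus_commute algebra_simps)
    show "0 \<in> ball 0 r \<inter> ball (- t) r" "s \<in> ball 0 r \<inter> ball (- t) r"
      using that r by (simp_all add: dist_norm norm_minus_commute algebra_simps)
    show "J (J p t) 0 = J p (0 + t)" using J(1)[OF JY[OF p \<open>norm t < r\<close>]] by simp
  qed
  let ?h = "\<lambda>t::'e. (1 / 2) *\<^sub>R t"
  define j where "j t = J (J p (?h t)) (?h t)" for t
  have "develops_at j t0" if t0: "t0 \<in> ball 0 (2 * r)" for t0
  proof -
    define a where "a = ?h t0"
    have a: "norm a < r" using t0 by (simp add: a_def)
    define q where "q = J p a"
    have q: "q \<in> topspace Y" unfolding q_def by (rule JY[OF p a])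
    define q' where "q' = J q a"
    have q': "q' \<in> topspace Y" unfolding q'_def by (rule JY[OF q a])
    \<comment> \<open>With this radius all intermediate displacements \<open>a + ?h u\<close> and
      \<open>a + u\<close> have norm below \<open>r\<close>, so each application of
      \<open>law\<close> is legitimate.\<close>
    define e where "e = r - norm a"
    have e: "e > 0" "e \<le> r" using a by (auto simp: e_def)
    have "j t = J q' (t - t0)" if t: "t \<in> ball t0 e" for t
    proof -
      define u where "u = t - t0"
      have u: "norm u < e" using t by (simp add: u_def dist_norm norm_minus_commute)
      have hu: "norm (?h u) < e" using u by simp (smt (verit) norm_ge_zero)
      have sm: "norm (?h u) < r" "norm u < r" "norm (a + ?h u) < r" "norm (?h u + a) < r"
          "norm (u + a) < r" "norm (a + u) < r"
        using hu u e norm_triangle_ineq[of a "?h u"] norm_triangle_ineq[of a u]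
        unfolding e_def add.commute[of _ a] by linarith+
      have half: "?h t = ?h u + a" by (simp add: u_def a_def algebra_simps)
      have uu: "?h u + ?h u = u" by (simp add: scaleR_left_distrib[symmetric])
      define x where "x = J q (?h u)"
      have x: "x \<in> topspace Y" unfolding x_def by (rule JY[OF q sm(1)])
      have "J p (?h t) = x" using law[OF p sm(1) a sm(4)] by (simp add: half x_def q_def)
      \<comment> \<open>The displacement \<open>?h u + a\<close> is travelled twice. The local group
        law reorders the journey so that both copies of \<open>a\<close> come first, ending at
        \<open>q'\<close>, and both copies of \<open>?h u\<close> combine to \<open>u\<close>; near
        \<open>t0\<close>, \<open>j\<close> is therefore a translate of the development
        \<open>J q'\<close>.\<close>
      then have "j t = J x (a + ?h u)" unfolding j_def by (simp add: half add.commute)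
      also have "\<dots> = J (J x (?h u)) a" using law[OF x a sm(1) sm(3)] by simp
      also have "J x (?h u) = J q u" unfolding x_def using law[OF q sm(1) sm(1)] sm(2) by (simp add: uu)
      also have "J (J q u) a = J q (a + u)" using law[OF q a sm(2) sm(6)] .
      also have "\<dots> = J q' u" using law[OF q sm(2) a sm(5)] by (simp add: q'_def add.commute)
      finally show ?thesis by (simp add: u_def)
    qed
    moreover have "develops_at (\<lambda>t. J q' (t + (- t0))) t0"
      using J(2)[OF q', of 0] r by (intro develops_at_shift) simp
    ultimately show ?thesis using e(1) by (intro develops_at_cong[of _ t0 e j]) auto
  qed
  moreover have "j 0 = p" by (simp add: j_def J(1)[OF p])
  ultimately show ?thesis by blast
qed

text \<open>The developments on balls of radius \<open>\<epsilon> * 2 ^ k\<close> restrict to one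
  another by uniqueness and thus glue. Choosing the least admissible \<open>k\<close> merely makes
  \<open>E\<close> a function; any other admissible \<open>k\<close> gives the same value.\<close>

lemma global_development:
  assumes p: "p \<in> topspace Y"
  obtains E where "E 0 = p" "\<And>t. develops_at E t"
proof -
  obtain \<epsilon> where \<epsilon>: "\<epsilon> > 0"
    "\<And>p. p \<in> topspace Y \<Longrightarrow> \<exists>j. j 0 = p \<and> (\<forall>t\<in>ball 0 \<epsilon>. develops_at j t)"
    using uniform_development by blast
  have ex: "\<exists>j. j 0 = p \<and> (\<forall>t\<in>ball 0 (\<epsilon> * 2 ^ k). develops_at j t)" if "p \<in> topspace Y" for k p
    using that
  proof (induction k arbitrary: p)
    case 0
    then show ?case using \<epsilon> by simp
  next
    case (Suc k)
    show ?case using development_double[OF Suc.IH Suc.prems] \<epsilon>(1) by (simp add: mult_ac)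
  qed
  have "\<forall>k. \<exists>j. j 0 = p \<and> (\<forall>t\<in>ball 0 (\<epsilon> * 2 ^ k). develops_at j t)" using ex[OF p] by blast
  from choice[OF this] obtain J where J: "\<And>k. J k 0 = p"
    "\<And>k t. t \<in> ball 0 (\<epsilon> * 2 ^ k) \<Longrightarrow> develops_at (J k) t" by blast
  have mono: "J k t = J l t" if "k \<le> l" "t \<in> ball 0 (\<epsilon> * 2 ^ k)" for k l t
  proof (rule development_unique[of "ball 0 (\<epsilon> * 2 ^ k)" "J k" "J l" 0 t])
    have "\<epsilon> * 2 ^ k \<le> \<epsilon> * 2 ^ l" using \<epsilon>(1) that(1) by (simp add: power_increasing)
    then show "develops_at (J l) u" if "u \<in> ball 0 (\<epsilon> * 2 ^ k)" for u using that by (intro J(2)) auto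
  qed (use that J \<epsilon>(1) in auto)
  have big: "\<exists>k. t \<in> ball 0 (\<epsilon> * 2 ^ k)" for t :: 'e
  proof -
    obtain k :: nat where "norm t / \<epsilon> < 2 ^ k" using real_arch_pow[of 2 "norm t / \<epsilon>"] by auto
    then show ?thesis using \<epsilon>(1) by (auto simp: field_simps)
  qed
  define E where "E t = J (LEAST k. t \<in> ball 0 (\<epsilon> * 2 ^ k)) t" for t
  have E: "E t = J k t" if "t \<in> ball 0 (\<epsilon> * 2 ^ k)" for k t
    unfolding E_def
    by (rule mono) (rule Least_le[of "\<lambda>k. t \<in> ball 0 (\<epsilon> * 2 ^ k)", OF that], rule LeastI_ex[OF big])
  show thesis
  proof (rule that)
    show "E 0 = p" using J(1) by (simp add: E_def)
    fix t :: 'e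
    from big[of t] obtain k where k: "t \<in> ball 0 (\<epsilon> * 2 ^ k)" by blast
    then obtain e where e: "e > 0" "ball t e \<subseteq> ball 0 (\<epsilon> * 2 ^ k)"
      using open_contains_ball[of "ball 0 (\<epsilon> * 2 ^ k)"] by blast
    show "develops_at E t"
    proof (rule develops_at_cong[OF J(2)[OF k] e(1)])
      show "E t' = J k t'" if "t' \<in> ball t e" for t' using E[of t' k] that e(2) by blast
    qed
  qed
qed

text \<open>Translates of a global development are again global developments, so uniqueness applies
  on the whole space. Hence coincidences of values are invariant under a common shift of the
  parameters.\<close>

lemma development_shift_eq:
  assumes E: "\<And>t. develops_at E t" and E': "\<And>t. develops_at E' t" and "E s = E' t"
  shows "E (u + s) = E' (u + t)"
proof (rule development_unique[of UNIV "\<lambda>u. E (u + s)" "\<lambda>u. E' (u + t)" 0])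
  show "develops_at (\<lambda>u. E (u + s)) v" "develops_at (\<lambda>u. E' (u + t)) v" for v
    using E E' by (auto intro: develops_at_shift)
qed (use assms(3) in auto)

text \<open>Ranges of global developments are the orbits of a translation action: they are open, and
  a range that meets the range of \<open>E\<close> contains no point outside it. So the complement
  of the range of \<open>E\<close> is a union of open sets.\<close>

lemma development_surj:
  assumes E: "\<And>t. develops_at E t"
  shows "range E = topspace Y"
proof -
  have op: "openin Y (range E)" by (rule development_open_image[OF open_UNIV E])
  have "openin Y (topspace Y - range E)"
  proof (subst openin_subopen, intro ballI)
    fix q assume q: "q \<in> topspace Y - range E"
    then obtain E' where E': "E' 0 = q" "\<And>t. develops_at E' t" using global_development[of q] by blast
    have "range E' \<inter> range E = {}"
    proof (rule ccontr)
      assume "range E' \<inter> range E \<noteq> {}"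
      then obtain s t where st: "E' s = E t" by auto
      have "E' (- s + s) = E (- s + t)" by (rule development_shift_eq[OF E'(2) E st])
      then show False using E'(1) q by auto
    qed
    moreover have "openin Y (range E')" by (rule development_open_image[OF open_UNIV E'(2)])
    ultimately show "\<exists>W. openin Y W \<and> q \<in> W \<and> W \<subseteq> topspace Y - range E"
      using E'(1) openin_subset by (intro exI[of _ "range E'"]) fastforce
  qed
  then have "closedin Y (range E)" using openin_subset[OF op] by (simp add: closedin_def)
  then show ?thesis using op connected unfolding connected_space_clopen_in by blast
qed

end

text \<open>The periods of \<open>E\<close> form a subgroup by shift invariance. It is discrete
  because a chart at \<open>E 0\<close> tells small parameters apart, and cocompact because finitely
  many images of balls cover the compact space.\<close>

lemma translation_atlas_uniformization:
  fixes T :: "('m, real ^ 'n) chart set"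
  assumes "translation_atlas Y T" "topspace Y \<noteq> {}"
  obtains E :: "real ^ 'n \<Rightarrow> 'm" and P Q :: "real ^ 'n \<Rightarrow> real ^ 'n"
  where "linear P" "linear Q" "\<And>x. P (Q x) = x" "\<And>x. Q (P x) = x"
    "\<And>t. translation_atlas.develops_at Y T E t" "range E = topspace Y"
    "\<And>s t. E s = E t \<longleftrightarrow> (\<forall>i. P (s - t) $ i \<in> \<int>)"
proof -
  interpret translation_atlas Y T by fact
  obtain p where "p \<in> topspace Y" using assms(2) by blast
  then obtain E where E: "E 0 = p" "\<And>t. develops_at E t" using global_development by blast
  define G where "G = {t. E t = E 0}"
  have G: "E s = E t \<longleftrightarrow> s - t \<in> G" for s t
  proof
    assume "E s = E t"
    from development_shift_eq[OF E(2,2) this, of "- t"] show "s - t \<in> G" by (simp add: G_def)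
  next
    assume "s - t \<in> G"
    then have "E (s - t) = E 0" by (simp add: G_def)
    from development_shift_eq[OF E(2,2) this, of t] show "E s = E t" by simp
  qed
  have zero: "0 \<in> G" by (simp add: G_def)
  have diff: "x - y \<in> G" if "x \<in> G" "y \<in> G" for x y
  proof -
    have "E x = E y" using that by (simp add: G_def)
    then show ?thesis using G by blast
  qed
  obtain c where c: "c \<in> T" "E 0 \<in> fst c" "is_chart Y c"
    by (rule chart_at[OF develops_at_topspace[OF E(2)[of 0]]])
  obtain \<delta> where \<delta>: "\<delta> > 0" "\<And>t. t \<in> ball 0 \<delta> \<Longrightarrow> E t \<in> fst c"
    "\<And>t. t \<in> ball 0 \<delta> \<Longrightarrow> snd c (E t) = snd c (E 0) + (t - 0)"
    by (rule develops_atE[OF E(2)[of 0] c(1,2)], rule that)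
  have disc: "x = 0" if "x \<in> G" "norm x < \<delta>" for x
  proof -
    have "x \<in> ball 0 \<delta>" "E x = E 0" using that by (simp_all add: G_def)
    then show ?thesis using \<delta>(3)[of x] by simp
  qed
  let ?U = "\<lambda>k::nat. E ` ball 0 (real k)"
  obtain \<F> where \<F>: "finite \<F>" "\<F> \<subseteq> range ?U" "topspace Y \<subseteq> \<Union>\<F>"
  proof -
    have A: "\<forall>U\<in>range ?U. openin Y U" using development_open_image[OF open_ball E(2)] by auto
    have B: "topspace Y \<subseteq> \<Union>(range ?U)"
    proof
      fix q assume "q \<in> topspace Y"
      then obtain t where t: "q = E t" using development_surj[OF E(2)] by auto
      obtain k :: nat where "norm t < real k" using reals_Archimedean2 by blast
      then show "q \<in> \<Union>(range ?U)" using t by force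
    qed
    show ?thesis
      using mp[OF spec[OF compact[unfolded compact_space_alt], of "range ?U"] conjI[OF A B]] that by blast
  qed
  from finite_subset_image[OF \<F>(1,2)] obtain K :: "nat set" where K: "finite K" "topspace Y \<subseteq> \<Union>(?U ` K)"
    using \<F>(3) by blast
  \<comment> \<open>The inserted 0 gives the maximum a value even for empty
    \<open>K\<close>.\<close>
  define R where "R = real (Max (insert 0 K))"
  have cocompact: "\<exists>g\<in>G. norm (x - g) \<le> R" for x
  proof -
    have "E x \<in> topspace Y" using E(2) by (simp add: develops_at_def)
    then obtain k y where k: "k \<in> K" "norm y < real k" "E x = E y" using K(2) by auto
    have "real k \<le> R" using k(1) K(1) by (simp add: R_def)
    then have "norm y \<le> R" using k(2) by linarith
    \<comment> \<open>The parameters \<open>x\<close> and \<open>y\<close> have the same image, so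
      \<open>x - y\<close> is a period, and its distance from \<open>x\<close> is the norm of
      \<open>y\<close>.\<close>
    then show ?thesis using G[of x y] k(3) by (intro bexI[of _ "x - y"]) auto
  qed
  obtain P Q :: "real ^ 'n \<Rightarrow> real ^ 'n" where PQ: "linear P" "linear Q" "\<And>x. P (Q x) = x" "\<And>x. Q (P x) = x"
    "\<And>x. x \<in> G \<longleftrightarrow> (\<forall>i. P x $ i \<in> \<int>)"
    by (rule lattice_coordinates[OF zero diff \<delta>(1) disc cocompact], assumption+, rule that)
  show thesis
  proof (rule that[OF PQ(1-4) E(2) development_surj[OF E(2)]])
    show "E s = E t \<longleftrightarrow> (\<forall>i. P (s - t) $ i \<in> \<int>)" for s t
      using G[of s t] PQ(5)[of "s - t"] by blast
  qed
qed

section \<open>Constructing charts, and the maximal atlas\<close>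

lemma is_chartI:
  assumes U: "openin X U" and inj: "inj_on f U"
    and preimage: "\<And>W. open W \<Longrightarrow> openin X {p \<in> U. f p \<in> W}"
    and image: "\<And>W. openin X W \<Longrightarrow> W \<subseteq> U \<Longrightarrow> open (f ` W)"
  shows "is_chart X (U, f)"
proof -
  have UX: "U \<subseteq> topspace X" using U by (rule openin_subset)
  have op: "open (f ` U)" by (rule image[OF U subset_refl])
  have top: "topspace (subtopology X U) = U" using UX by auto
  have "homeomorphic_map (subtopology X U) (top_of_set (f ` U)) f"
  proof (rule bijective_open_imp_homeomorphic_map)
    show "continuous_map (subtopology X U) (top_of_set (f ` U)) f"
      unfolding continuous_map_def top
    proof (intro conjI allI impI)
      fix W assume "openin (top_of_set (f ` U)) W"
      then have "open W" using op by (rule openin_open_trans)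
      from preimage[OF this] show "openin (subtopology X U) {x \<in> U. f x \<in> W}"
        by (metis (no_types, lifting) U inf.absorb2 mem_Collect_eq openin_open_subtopology subsetI)
    qed auto
    show "open_map (subtopology X U) (top_of_set (f ` U)) f"
      unfolding open_map_def
    proof (intro allI impI)
      fix W assume W: "openin (subtopology X U) W"
      then have "W \<subseteq> U" "openin X W" using U by (auto simp: openin_open_subtopology)
      then have "open (f ` W)" by (intro image)
      then show "openin (top_of_set (f ` U)) (f ` W)" using \<open>W \<subseteq> U\<close> by (auto intro: open_subset)
    qed
  qed (use UX inj in \<open>auto simp: Int_absorb1\<close>)
  then show ?thesis using U op by (simp add: is_chart_def)
qed

lemma open_chart_image_Int:
  assumes "is_chart X c" "is_chart X d"
  shows "open (snd c ` (fst c \<inter> fst d))"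
  using assms by (intro is_chart_open_image[OF assms(1)]) (auto simp: is_chart_def)

lemma transition_apply:
  "is_chart X c \<Longrightarrow> p \<in> fst c \<Longrightarrow> transition c d (snd c p) = snd d p"
  by (simp add: transition_def inv_into_f_f[OF is_chart_inj])

context smooth_manifold
begin

lemma chart_at: "p \<in> topspace X \<Longrightarrow> \<exists>a\<in>A. p \<in> fst a"
  using covering by blast

lemma maximal_atlas_is_chart: "c \<in> maximal_atlas X A \<Longrightarrow> is_chart X c"
  by (simp add: maximal_atlas_def)

lemma atlas_subset_maximal_atlas: "A \<subseteq> maximal_atlas X A"
  using charts compatible by (auto simp: maximal_atlas_def)

text \<open>Compatibility is transitive for charts compatible with all of \<open>A\<close>, since
  near each point a transition factors through some chart of \<open>A\<close>.\<close>

lemma smooth_transition: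
  assumes c: "c \<in> maximal_atlas X A" and d: "d \<in> maximal_atlas X A"
  shows "smooth_on (snd c ` (fst c \<inter> fst d)) (transition c d)"
proof (rule smooth_on_local)
  fix x assume "x \<in> snd c ` (fst c \<inter> fst d)"
  then obtain p where p: "p \<in> fst c" "p \<in> fst d" "x = snd c p" by blast
  note cc = maximal_atlas_is_chart[OF c] and cd = maximal_atlas_is_chart[OF d]
  have "p \<in> topspace X" using p(1) is_chart_domain[OF cc] by blast
  then obtain a where a: "a \<in> A" "p \<in> fst a" using chart_at by blast
  note ca = charts[OF a(1)]
  let ?W = "fst c \<inter> fst d \<inter> fst a"
  have W: "openin X ?W" using cc cd ca by (intro openin_Int) (auto simp: is_chart_def)
  have op: "open (snd c ` ?W)" by (rule is_chart_open_image[OF cc W]) blast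
  have "smooth_on (snd c ` ?W) (\<lambda>y. transition a d (transition c a y))"
  proof (rule smooth_on_compose[where f="transition c a" and g="transition a d", OF op])
    show "open (snd a ` (fst a \<inter> fst d))" by (rule open_chart_image_Int[OF ca cd])
    show "transition c a ` snd c ` ?W \<subseteq> snd a ` (fst a \<inter> fst d)"
      by (auto simp: transition_apply[OF cc])
    have "smooth_on (snd c ` (fst c \<inter> fst a)) (transition c a)"
      using c a(1) by (simp add: maximal_atlas_def compatible_def)
    then show "smooth_on (snd c ` ?W) (transition c a)" by (rule smooth_on_subset) blast
    have "compatible d a" using d a(1) by (simp add: maximal_atlas_def)
    then show "smooth_on (snd a ` (fst a \<inter> fst d)) (transition a d)"
      by (simp add: compatible_def Int_commute)
  qed
  moreover have "transition a d (transition c a y) = transition c d y" if "y \<in> snd c ` ?W" for y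
    using that by (auto simp: transition_apply[OF cc] transition_apply[OF ca])
  ultimately have "smooth_on (snd c ` ?W) (transition c d)"
    by (rule smooth_on_congD[OF op])
  moreover have "snd c ` (fst c \<inter> fst d) \<inter> snd c ` ?W = snd c ` ?W" by blast
  ultimately show "\<exists>T. open T \<and> x \<in> T \<and> smooth_on (snd c ` (fst c \<inter> fst d) \<inter> T) (transition c d)"
    using op p a(2) by (intro exI[of _ "snd c ` ?W"]) auto
qed

text \<open>Straightened coordinates become genuine charts in this way. The change of coordinates is
  available only on a part \<open>V\<close> of the coordinate image, and the domain shrinks
  accordingly.\<close>

lemma maximal_atlas_diffeo:
  assumes c: "c \<in> maximal_atlas X A" and \<psi>: "diffeo_on V \<psi>" and V: "V \<subseteq> snd c ` fst c"
  shows "({p \<in> fst c. snd c p \<in> V}, \<psi> \<circ> snd c) \<in> maximal_atlas X A" (is "?d \<in> _")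
proof -
  note cc = maximal_atlas_is_chart[OF c]
  let ?U = "{p \<in> fst c. snd c p \<in> V}"
  have opV: "open V" and inj\<psi>: "inj_on \<psi> V" and sm\<psi>: "smooth_on V \<psi>" and op\<psi>: "open (\<psi> ` V)"
    and inv\<psi>: "smooth_on (\<psi> ` V) (inv_into V \<psi>)"
    using \<psi> by (auto simp: diffeo_on_def)
  have U: "openin X ?U" by (rule is_chart_open_preimage[OF cc opV])
  have cd: "is_chart X ?d"
  proof (rule is_chartI[OF U])
    show "inj_on (\<psi> \<circ> snd c) ?U"
    proof (rule comp_inj_on)
      show "inj_on (snd c) ?U" using is_chart_inj[OF cc] by (rule inj_on_subset) blast
      show "inj_on \<psi> (snd c ` ?U)" using inj\<psi> by (rule inj_on_subset) blast
    qed
    fix W :: "'e set" assume W: "open W"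
    have "open (V \<inter> \<psi> -` W)"
      using continuous_open_preimage[OF smooth_on_imp_continuous_on[OF sm\<psi>] opV W] .
    from is_chart_open_preimage[OF cc this]
    show "openin X {p \<in> ?U. (\<psi> \<circ> snd c) p \<in> W}" by (rule back_subst[of "openin X"]) auto
  next
    fix W assume W: "openin X W" "W \<subseteq> ?U"
    have "open (snd c ` W)" using W by (intro is_chart_open_image[OF cc]) auto
    then have "diffeo_on (snd c ` W) \<psi>" using W(2) by (intro diffeo_on_subset[OF \<psi>]) auto
    then show "open ((\<psi> \<circ> snd c) ` W)" by (simp add: diffeo_on_def image_comp)
  qed
  have "compatible ?d a" if a: "a \<in> A" for a
  proof -
    note ca = charts[OF a]
    have ac: "smooth_on (snd c ` (fst c \<inter> fst a)) (transition c a)"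
      "smooth_on (snd a ` (fst c \<inter> fst a)) (transition a c)"
      using c a by (auto simp: maximal_atlas_def compatible_def)
    let ?S = "snd ?d ` (fst ?d \<inter> fst a)" and ?S' = "snd a ` (fst ?d \<inter> fst a)"
    have op: "open ?S" by (rule open_chart_image_Int[OF cd ca])
    have op': "open ?S'" using open_chart_image_Int[OF ca cd] by (simp add: Int_commute)
    have inv: "inv_into V \<psi> (\<psi> (snd c p)) = snd c p" if "p \<in> ?U" for p
      using that inv_into_f_f[OF inj\<psi>] by blast
    have "smooth_on ?S (\<lambda>y. transition c a (inv_into V \<psi> y))"
    proof (rule smooth_on_compose[where f="inv_into V \<psi>" and g="transition c a", OF op open_chart_image_Int[OF cc ca]])
      show "inv_into V \<psi> ` ?S \<subseteq> snd c ` (fst c \<inter> fst a)" by (auto simp: inv)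
      show "smooth_on ?S (inv_into V \<psi>)" using inv\<psi> by (rule smooth_on_subset) auto
    qed (rule ac)
    moreover have "transition c a (inv_into V \<psi> y) = transition ?d a y" if y: "y \<in> ?S" for y
    proof -
      obtain p where p: "p \<in> ?U" "y = snd ?d p" using y by auto
      have "transition ?d a y = snd a p" using transition_apply[OF cd, of p a] p by simp
      moreover have "transition c a (snd c p) = snd a p" using transition_apply[OF cc] p(1) by blast
      ultimately show ?thesis using p inv[OF p(1)] by simp
    qed
    ultimately have 1: "smooth_on ?S (transition ?d a)" by (rule smooth_on_congD[OF op])
    have "smooth_on ?S' (\<lambda>y. \<psi> (transition a c y))"
    proof (rule smooth_on_compose[where f="transition a c" and g=\<psi>, OF op' opV _ _ sm\<psi>])
      show "transition a c ` ?S' \<subseteq> V" by (auto simp: transition_apply[OF ca])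
      show "smooth_on ?S' (transition a c)" using ac(2) by (rule smooth_on_subset) auto
    qed
    moreover have "\<psi> (transition a c y) = transition a ?d y" if y: "y \<in> ?S'" for y
      using y by (auto simp: transition_apply[OF ca])
    ultimately have 2: "smooth_on ?S' (transition a ?d)" by (rule smooth_on_congD[OF op'])
    from 1 2 show ?thesis by (simp add: compatible_def)
  qed
  then show ?thesis using cd by (simp add: maximal_atlas_def)
qed

end

section \<open>Slices\<close>

text \<open>The ambient chart is retained, because smoothness of the transitions between
  restrictions comes from the ambient transitions.\<close>

definition slice_chart :: "'m topology \<Rightarrow> ('m, 'e::euclidean_space \<times> 'f::euclidean_space) chart set \<Rightarrow> 'm set \<Rightarrow>
    ('m, 'e \<times> 'f) chart \<Rightarrow> bool" where
  "slice_chart X A L c \<longleftrightarrow> c \<in> maximal_atlas X A \<and>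
     snd c ` (fst c \<inter> L) = (snd c ` fst c) \<inter> (UNIV \<times> {0})"

abbreviation restrict_chart :: "'m set \<Rightarrow> ('m, 'e \<times> 'f) chart \<Rightarrow> ('m, 'e) chart" where
  "restrict_chart L c \<equiv> (fst c \<inter> L, fst \<circ> snd c)"

lemma slice_charts_eq: "slice_charts X A L = {restrict_chart L c |c. slice_chart X A L c}"
  by (simp add: slice_charts_def slice_chart_def)

lemma slice_chart_snd: "slice_chart X A L c \<Longrightarrow> p \<in> fst c \<Longrightarrow> p \<in> L \<Longrightarrow> snd c p = (fst (snd c p), 0)"
  unfolding slice_chart_def by (cases "snd c p") force

locale covered_by_slices = smooth_manifold X A
  for X :: "'m topology" and A :: "('m, 'e::euclidean_space \<times> 'f::euclidean_space) chart set" +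
  fixes L :: "'m set"
  assumes L: "L \<subseteq> topspace X"
    and slice_cover: "p \<in> L \<Longrightarrow> \<exists>c. slice_chart X A L c \<and> p \<in> fst c"
begin

lemma slice_chart_is_chart: "slice_chart X A L c \<Longrightarrow> is_chart X c"
  using maximal_atlas_is_chart by (simp add: slice_chart_def)

lemma restrict_chart_is_chart:
  assumes c: "slice_chart X A L c"
  shows "is_chart (subtopology X L) (restrict_chart L c)"
proof (rule is_chartI)
  note cc = slice_chart_is_chart[OF c]
  have opc: "openin X (fst c)" using cc by (simp add: is_chart_def)
  show "openin (subtopology X L) (fst c \<inter> L)"
    unfolding openin_subtopology using opc by blast
  show "inj_on (fst \<circ> snd c) (fst c \<inter> L)"
  proof (rule inj_onI)
    fix p q assume "p \<in> fst c \<inter> L" "q \<in> fst c \<inter> L" "(fst \<circ> snd c) p = (fst \<circ> snd c) q"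
    moreover from this have "snd c p = snd c q"
      using slice_chart_snd[OF c, of p] slice_chart_snd[OF c, of q] by (simp add: prod_eq_iff)
    ultimately show "p = q" using inj_onD[OF is_chart_inj[OF cc]] by blast
  qed
  fix W :: "'e set" assume "open W"
  then have "open (W \<times> (UNIV :: 'f set))" by (intro open_Times) auto
  from is_chart_open_preimage[OF cc this]
  show "openin (subtopology X L) {p \<in> fst c \<inter> L. (fst \<circ> snd c) p \<in> W}"
    unfolding openin_subtopology
    by (intro exI[of _ "{p \<in> fst c. snd c p \<in> W \<times> UNIV}"]) (auto simp: mem_Times_iff)
next
  note cc = slice_chart_is_chart[OF c]
  have opc: "openin X (fst c)" using cc by (simp add: is_chart_def)
  fix W assume W: "openin (subtopology X L) W" "W \<subseteq> fst c \<inter> L"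
  then obtain W' where W': "openin X W'" "W = W' \<inter> L" by (auto simp: openin_subtopology)
  have "open (snd c ` (W' \<inter> fst c))"
    using W'(1) opc by (intro is_chart_open_image[OF cc]) auto
  then have "open ((\<lambda>x. (x, 0)) -` (snd c ` (W' \<inter> fst c)))"
    by (intro open_vimage continuous_intros)
  \<comment> \<open>The slice condition gives the harder inclusion: a point of \<open>W'\<close>
    with coordinates \<open>(x, 0)\<close> has the same coordinates as some point of
    \<open>L\<close>, and injectivity of the chart identifies the two.\<close>
  moreover have "(fst \<circ> snd c) ` W = (\<lambda>x. (x, 0)) -` (snd c ` (W' \<inter> fst c))"
  proof (intro equalityI subsetI)
    fix x assume "x \<in> (fst \<circ> snd c) ` W"
    then obtain p where p: "p \<in> W" "x = fst (snd c p)" by auto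
    then have "p \<in> fst c" "p \<in> L" "p \<in> W'" using W(2) W'(2) by auto
    then have "(x, 0) = snd c p" using slice_chart_snd[OF c, of p] p(2) by simp
    then show "x \<in> (\<lambda>x. (x, 0)) -` (snd c ` (W' \<inter> fst c))" using \<open>p \<in> W'\<close> \<open>p \<in> fst c\<close> by simp
  next
    fix x assume "x \<in> (\<lambda>x. (x, 0)) -` (snd c ` (W' \<inter> fst c))"
    then obtain p where p: "p \<in> W'" "p \<in> fst c" "snd c p = (x, 0)" by auto
    then have "(x, 0) \<in> snd c ` (fst c \<inter> L)" using c by (auto simp: slice_chart_def image_iff intro!: bexI[of _ p])
    then obtain q where q: "q \<in> fst c" "q \<in> L" "snd c q = (x, 0)" by auto
    then have "p = q" using p inj_onD[OF is_chart_inj[OF cc], of p q] by simp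
    then show "x \<in> (fst \<circ> snd c) ` W" using p q W'(2) by (force simp: image_iff)
  qed
  ultimately show "open ((fst \<circ> snd c) ` W)" by simp
qed

lemma restrict_chart_inv:
  assumes "slice_chart X A L c" "p \<in> fst c" "p \<in> L"
  shows "chart_inv (restrict_chart L c) (fst (snd c p)) = p"
  using inv_into_f_f[OF is_chart_inj[OF restrict_chart_is_chart[OF assms(1)]], of p] assms(2,3) by simp

text \<open>The restricted transition is the ambient one between the linear maps
  \<open>x \<mapsto> (x, 0)\<close> and \<open>fst\<close>.\<close>

lemma smooth_restrict_transition:
  assumes c: "slice_chart X A L c" and d: "slice_chart X A L d"
  shows "smooth_on ((fst \<circ> snd c) ` (fst c \<inter> fst d \<inter> L)) (transition (restrict_chart L c) (restrict_chart L d))"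
proof -
  note cc = slice_chart_is_chart[OF c] and cd = slice_chart_is_chart[OF d]
  let ?S = "(fst \<circ> snd c) ` (fst c \<inter> fst d \<inter> L)"
  have "openin (subtopology X L) (fst c \<inter> fst d \<inter> L)"
    using cc cd unfolding openin_subtopology is_chart_def by (intro exI[of _ "fst c \<inter> fst d"]) auto
  then have op: "open ?S" using is_chart_open_image[OF restrict_chart_is_chart[OF c], of "fst c \<inter> fst d \<inter> L"] by auto
  have "smooth_on ?S (\<lambda>x. fst (transition c d (x, 0)))"
  proof (rule smooth_on_bounded_linear[where h=fst and f="\<lambda>x. transition c d (x, 0)", OF bounded_linear_fst op])
    show "smooth_on ?S (\<lambda>x. transition c d (x, 0))"
    proof (rule smooth_on_compose[where f="\<lambda>x. (x, 0)" and g="transition c d", OF op open_chart_image_Int[OF cc cd]])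
      show "(\<lambda>x. (x, 0)) ` ?S \<subseteq> snd c ` (fst c \<inter> fst d)"
      proof clarify
        fix p assume p: "p \<in> fst c" "p \<in> fst d" "p \<in> L"
        have "((fst \<circ> snd c) p, 0) = snd c p" using slice_chart_snd[OF c p(1,3)] by simp
        then show "((fst \<circ> snd c) p, 0) \<in> snd c ` (fst c \<inter> fst d)" using p by simp
      qed
      show "smooth_on ?S (\<lambda>x. (x, 0))"
        by (rule smooth_on_linear) (intro bounded_linear_Pair bounded_linear_ident bounded_linear_zero)
      show "smooth_on (snd c ` (fst c \<inter> fst d)) (transition c d)"
        using c d by (intro smooth_transition) (auto simp: slice_chart_def)
    qed
  qed
  moreover have "fst (transition c d (x, 0)) = transition (restrict_chart L c) (restrict_chart L d) x"
    if xS: "x \<in> ?S" for x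
  proof -
    obtain p where p: "p \<in> fst c" "p \<in> L" "x = fst (snd c p)" using xS by auto
    then have "(x, 0) = snd c p" using slice_chart_snd[OF c p(1,2)] by simp
    then have "fst (transition c d (x, 0)) = fst (snd d p)" using transition_apply[OF cc p(1)] by simp
    moreover have "transition (restrict_chart L c) (restrict_chart L d) x = fst (snd d p)"
      using restrict_chart_inv[OF c p(1,2)] p(3) by (simp add: transition_def)
    ultimately show ?thesis by simp
  qed
  ultimately show ?thesis by (rule smooth_on_congD[OF op])
qed

lemma slice_charts_smooth_manifold: "smooth_manifold (subtopology X L) (slice_charts X A L)"
proof
  show "Hausdorff_space (subtopology X L)" by (rule Hausdorff_space_subtopology[OF Hausdorff])
  show "second_countable (subtopology X L)" by (rule second_countable_subtopology[OF second_countable])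
  show "is_chart (subtopology X L) c" if "c \<in> slice_charts X A L" for c
    using that restrict_chart_is_chart by (auto simp: slice_charts_eq)
  show "(\<Union>c\<in>slice_charts X A L. fst c) = topspace (subtopology X L)"
  proof -
    have "(\<Union>c\<in>slice_charts X A L. fst c) = L"
    proof (intro equalityI subsetI)
      fix p assume "p \<in> L"
      then obtain c where c: "slice_chart X A L c" "p \<in> fst c" using slice_cover by blast
      then have "restrict_chart L c \<in> slice_charts X A L" unfolding slice_charts_eq by blast
      moreover have "p \<in> fst (restrict_chart L c)" using c(2) \<open>p \<in> L\<close> by simp
      ultimately show "p \<in> (\<Union>c\<in>slice_charts X A L. fst c)" by blast
    qed (auto simp: slice_charts_eq)
    then show ?thesis using L by auto
  qed
  show "compatible c d" if cd: "c \<in> slice_charts X A L" "d \<in> slice_charts X A L" for c d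
  proof -
    obtain c' d' where c': "c = restrict_chart L c'" "slice_chart X A L c'"
      and d': "d = restrict_chart L d'" "slice_chart X A L d'" using cd by (auto simp: slice_charts_eq)
    have "fst c \<inter> fst d = fst c' \<inter> fst d' \<inter> L" "fst c \<inter> fst d = fst d' \<inter> fst c' \<inter> L"
      using c' d' by auto
    then show ?thesis
      using smooth_restrict_transition[OF c'(2) d'(2)] smooth_restrict_transition[OF d'(2) c'(2)]
      by (simp add: compatible_def c'(1) d'(1))
  qed
qed

end

section \<open>The torus as a manifold\<close>

definition cis_vec :: "real ^ 'n \<Rightarrow> complex ^ 'n" where
  "cis_vec y = (\<chi> i. cis (y $ i))"

definition arg_box :: "('n \<Rightarrow> real) \<Rightarrow> (real ^ 'n) set" where
  "arg_box a = {y. \<forall>i. y $ i \<in> {a i<..<a i + 2 * pi}}"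

definition arg_vec :: "('n \<Rightarrow> real) \<Rightarrow> complex ^ 'n \<Rightarrow> real ^ 'n" where
  "arg_vec a z = (\<chi> i. inv_into {a i<..<a i + 2 * pi} cis (z $ i))"

lemma cis_eq_iff: "cis x = cis y \<longleftrightarrow> (x - y) / (2 * pi) \<in> \<int>"
proof -
  have "cis x = cis y \<longleftrightarrow> cis (x - y) = 1"
    by (simp add: cis_divide[symmetric])
  also have "\<dots> \<longleftrightarrow> (\<exists>k::int. x - y = 2 * pi * of_int k)"
  proof -
    have "cis t = 1 \<longleftrightarrow> cos t = 1" for t
      using cos_one_sin_zero[of t] by (auto simp: complex_eq_iff)
    then show ?thesis by (simp add: cos_one_2pi_int mult_ac)
  qed
  also have "\<dots> \<longleftrightarrow> (x - y) / (2 * pi) \<in> \<int>"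
    by (auto simp: Ints_def field_simps)
  finally show ?thesis .
qed

lemma inj_on_cis: "inj_on cis {a<..<a + 2 * pi}"
proof (rule inj_onI)
  fix x y assume xy: "x \<in> {a<..<a + 2 * pi}" "y \<in> {a<..<a + 2 * pi}" "cis x = cis y"
  then obtain k :: int where k: "(x - y) / (2 * pi) = of_int k" by (auto simp: cis_eq_iff elim: Ints_cases)
  have "\<bar>(x - y) / (2 * pi)\<bar> < 1" using xy(1,2) by (auto simp: abs_less_iff field_simps)
  then have "k = 0" using k by linarith
  then show "x = y" using k by simp
qed

lemma arg_vec_cis_vec: "y \<in> arg_box a \<Longrightarrow> arg_vec a (cis_vec y) = y"
  using inj_on_cis by (simp add: arg_vec_def cis_vec_def arg_box_def vec_eq_iff)

text \<open>Choosing a base angle for each factor turns a product of circle charts into a single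
  branch of the inverse of \<open>cis_vec\<close> on a box.\<close>

lemma torus_charts_eq:
  "(torus_charts :: (complex ^ 'n, real ^ 'n) chart set) = {(cis_vec ` arg_box a, arg_vec a) |a. True}"
proof -
  have img: "{z. \<forall>i. z $ i \<in> cis ` {a i<..<a i + 2 * pi}} = cis_vec ` arg_box a" for a :: "'n \<Rightarrow> real"
  proof (intro equalityI subsetI)
    fix z :: "complex ^ 'n" assume z: "z \<in> {z. \<forall>i. z $ i \<in> cis ` {a i<..<a i + 2 * pi}}"
    have "\<forall>i. \<exists>y. y \<in> {a i<..<a i + 2 * pi} \<and> z $ i = cis y" using z by blast
    from choice[OF this] obtain y where "\<forall>i. y i \<in> {a i<..<a i + 2 * pi} \<and> z $ i = cis (y i)" by blast
    then show "z \<in> cis_vec ` arg_box a"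
      by (intro image_eqI[of _ _ "\<chi> i. y i"]) (auto simp: cis_vec_def arg_box_def vec_eq_iff)
  qed (auto simp: cis_vec_def arg_box_def)
  have mk: "\<exists>a. c = (\<lambda>i. (cis ` {a i<..<a i + 2 * pi}, inv_into {a i<..<a i + 2 * pi} cis))"
    if "\<forall>i. c i \<in> circle_charts" for c :: "'n \<Rightarrow> _"
  proof -
    have "\<forall>i. \<exists>a. c i = (cis ` {a<..<a + 2 * pi}, inv_into {a<..<a + 2 * pi} cis)"
      using that by (auto simp: circle_charts_def)
    from choice[OF this] show ?thesis by (auto simp: fun_eq_iff)
  qed
  show ?thesis
  proof (intro equalityI subsetI)
    fix D :: "(complex ^ 'n, real ^ 'n) chart" assume "D \<in> torus_charts"
    then obtain c where c: "\<forall>i. c i \<in> circle_charts"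
      "D = ({z. \<forall>i. z $ i \<in> fst (c i)}, \<lambda>z. \<chi> i. snd (c i) (z $ i))"
      by (auto simp: torus_charts_def)
    from mk[OF c(1)] obtain a where "c = (\<lambda>i. (cis ` {a i<..<a i + 2 * pi}, inv_into {a i<..<a i + 2 * pi} cis))" ..
    then show "D \<in> {(cis_vec ` arg_box a, arg_vec a) |a. True}"
      using c(2) img[of a] by (auto simp: arg_vec_def[abs_def])
  next
    fix D :: "(complex ^ 'n, real ^ 'n) chart" assume "D \<in> {(cis_vec ` arg_box a, arg_vec a) |a. True}"
    then obtain a where a: "D = (cis_vec ` arg_box a, arg_vec a)" by blast
    let ?c = "\<lambda>i. (cis ` {a i<..<a i + 2 * pi}, inv_into {a i<..<a i + 2 * pi} cis)"
    have "\<forall>i. ?c i \<in> circle_charts" by (auto simp: circle_charts_def)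
    moreover have "D = ({z. \<forall>i. z $ i \<in> fst (?c i)}, \<lambda>z. \<chi> i. snd (?c i) (z $ i))"
      using img[of a] by (simp add: a arg_vec_def[abs_def])
    ultimately show "D \<in> torus_charts" unfolding torus_charts_def by (intro CollectI exI[of _ ?c] conjI)
  qed
qed

lemma open_arg_box: "open (arg_box a)"
proof -
  have "arg_box a = (\<Inter>i\<in>UNIV. {y. a i < y $ i} \<inter> {y. y $ i < a i + 2 * pi})"
    by (auto simp: arg_box_def)
  then show ?thesis
    by (simp only:) (intro open_INT finite ballI open_Int open_Collect_less continuous_intros)
qed

lemma continuous_on_cis_vec: "continuous_on S cis_vec"
  unfolding cis_vec_def[abs_def] by (intro continuous_intros)

lemma cis_vec_torus: "cis_vec y \<in> torus"
  by (simp add: cis_vec_def torus_def)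

lemma torus_cis_vec:
  assumes "z \<in> torus"
  obtains y where "z = cis_vec y"
proof -
  have "z = cis_vec (\<chi> i. Arg (z $ i))"
  proof -
    have "z $ i = cis (Arg (z $ i))" for i
    proof -
      have "norm (z $ i) = 1" using assms by (simp add: torus_def)
      moreover from this have "z $ i \<noteq> 0" by auto
      ultimately show ?thesis using cis_Arg[of "z $ i"] by (simp add: sgn_div_norm)
    qed
    then show ?thesis by (simp add: cis_vec_def vec_eq_iff)
  qed
  then show thesis by (rule that)
qed

text \<open>Division by \<open>cis a\<close> rotates the cut of \<open>Arg2pi\<close> to the angle
  \<open>a\<close>. The excluded value \<open>cis a\<close> is where the argument would be 0, so the
  open interval suffices.\<close>

lemma cis_image_eq:
  assumes "norm z = 1" "z \<noteq> cis a"
  shows "a + Arg2pi (z / cis a) \<in> {a<..<a + 2 * pi}" "cis (a + Arg2pi (z / cis a)) = z"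
proof -
  have n: "norm (z / cis a) = 1" using assms(1) by (simp add: norm_divide)
  have e: "z / cis a = cis (Arg2pi (z / cis a))"
    using Arg2pi_eq[of "z / cis a"] unfolding n cis_conv_exp[symmetric] of_real_1 mult_1 .
  have "Arg2pi (z / cis a) \<noteq> 0"
  proof
    assume "Arg2pi (z / cis a) = 0"
    then have "z / cis a = 1" using e unfolding \<open>Arg2pi (z / cis a) = 0\<close> cis_zero by blast
    then show False using assms(2) by simp
  qed
  then show "a + Arg2pi (z / cis a) \<in> {a<..<a + 2 * pi}"
    using Arg2pi_ge_0[of "z / cis a"] Arg2pi_lt_2pi[of "z / cis a"] by simp
  show "cis (a + Arg2pi (z / cis a)) = z"
    by (simp add: cis_mult[symmetric] e[symmetric])
qed

text \<open>A description of the chart domains by inequations, from which their openness in the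
  torus can be read off.\<close>

lemma cis_vec_arg_box_eq: "cis_vec ` arg_box a = torus \<inter> {z. \<forall>i. z $ i \<noteq> cis (a i)}"
proof (intro equalityI subsetI)
  fix z assume "z \<in> cis_vec ` arg_box a"
  then obtain y where y: "y \<in> arg_box a" "z = cis_vec y" by blast
  have "cis (y $ i) \<noteq> cis (a i)" for i
  proof
    assume "cis (y $ i) = cis (a i)"
    then obtain k :: int where k: "(y $ i - a i) / (2 * pi) = of_int k" by (auto simp: cis_eq_iff elim: Ints_cases)
    have "a i < y $ i" "y $ i < a i + 2 * pi" using y(1) by (auto simp: arg_box_def)
    then have "0 < (y $ i - a i) / (2 * pi)" "(y $ i - a i) / (2 * pi) < 1" by (auto simp: field_simps)
    then have "0 < real_of_int k" "real_of_int k < 1" unfolding k .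
    then show False by simp
  qed
  then show "z \<in> torus \<inter> {z. \<forall>i. z $ i \<noteq> cis (a i)}"
    using y(2) cis_vec_torus by (auto simp: cis_vec_def)
next
  fix z assume z: "z \<in> torus \<inter> {z. \<forall>i. z $ i \<noteq> cis (a i)}"
  have "norm (z $ i) = 1" "z $ i \<noteq> cis (a i)" for i using z by (auto simp: torus_def)
  then show "z \<in> cis_vec ` arg_box a"
    using cis_image_eq
    by (intro image_eqI[of _ _ "\<chi> i. a i + Arg2pi (z $ i / cis (a i))"])
      (auto simp: cis_vec_def arg_box_def vec_eq_iff)
qed

lemma arg_vec_Arg2pi:
  assumes "z \<in> cis_vec ` arg_box a"
  shows "arg_vec a z = (\<chi> i. a i + Arg2pi (z $ i / cis (a i)))"
proof -
  have z: "norm (z $ i) = 1" "z $ i \<noteq> cis (a i)" for i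
    using assms unfolding cis_vec_arg_box_eq by (auto simp: torus_def)
  have "(\<chi> i. a i + Arg2pi (z $ i / cis (a i))) \<in> arg_box a"
    using cis_image_eq(1)[OF z] by (simp add: arg_box_def)
  moreover have "cis_vec (\<chi> i. a i + Arg2pi (z $ i / cis (a i))) = z"
    using cis_image_eq(2)[OF z] by (simp add: cis_vec_def vec_eq_iff)
  ultimately show ?thesis using arg_vec_cis_vec by fastforce
qed

text \<open>The branch is rewritten through \<open>Arg2pi\<close>, which is continuous off the
  nonnegative reals. A quotient of modulus 1 lies on that ray only if it equals 1, which the chart
  domain excludes.\<close>

lemma continuous_on_arg_vec: "continuous_on (cis_vec ` arg_box a) (arg_vec a)"
proof -
  have "continuous_on (cis_vec ` arg_box a) (\<lambda>z. \<chi> i. a i + Arg2pi (z $ i / cis (a i)))"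
  proof (intro continuous_on_vec_lambda continuous_on_add continuous_on_const)
    fix i
    show "continuous_on (cis_vec ` arg_box a) (\<lambda>z. Arg2pi (z $ i / cis (a i)))"
    proof (rule continuous_on_compose2[of "{z. z \<notin> \<real>\<^sub>\<ge>\<^sub>0}" Arg2pi])
      show "continuous_on {z. z \<notin> \<real>\<^sub>\<ge>\<^sub>0} Arg2pi"
        by (intro continuous_at_imp_continuous_on ballI continuous_at_Arg2pi) auto
      show "continuous_on (cis_vec ` arg_box a) (\<lambda>z. z $ i / cis (a i))"
        by (intro continuous_intros) auto
      show "(\<lambda>z. z $ i / cis (a i)) ` cis_vec ` arg_box a \<subseteq> {z. z \<notin> \<real>\<^sub>\<ge>\<^sub>0}"
      proof (clarsimp simp del: not_all)
        fix y assume y: "y \<in> arg_box a" and nn: "cis_vec y $ i / cis (a i) \<in> \<real>\<^sub>\<ge>\<^sub>0"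
        have "cis_vec y \<in> cis_vec ` arg_box a" using y by blast
        then have ne: "cis_vec y $ i \<noteq> cis (a i)" unfolding cis_vec_arg_box_eq by blast
        obtain r where r: "r \<ge> 0" "cis_vec y $ i / cis (a i) = of_real r" using nn by (auto elim: nonneg_Reals_cases)
        have "norm (cis_vec y $ i / cis (a i)) = 1" by (simp add: cis_vec_def norm_divide)
        then have "r = 1" using r by simp
        then show False using r(2) ne by simp
      qed
    qed
  qed
  then show ?thesis by (rule continuous_on_eq) (rule arg_vec_Arg2pi[symmetric])
qed

lemma torus_chart_is_chart:
  fixes a :: "'n::finite \<Rightarrow> real"
  shows "is_chart (top_of_set torus) (cis_vec ` arg_box a, arg_vec a)"
proof (rule is_chartI)
  have "(UNIV :: (complex ^ 'n) set) \<inter> {z. \<forall>i. z $ i \<noteq> cis (a i)} = (\<Inter>i\<in>UNIV. {z. z $ i \<noteq> cis (a i)})" by auto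
  then have "open {z :: complex ^ 'n. \<forall>i. z $ i \<noteq> cis (a i)}"
    by (simp only: Int_UNIV_left) (intro open_INT finite ballI open_Collect_neq continuous_intros)
  then show op: "openin (top_of_set torus) (cis_vec ` arg_box a)"
    unfolding cis_vec_arg_box_eq by (rule openin_open_Int)
  show "inj_on (arg_vec a) (cis_vec ` arg_box a)"
    by (rule inj_on_inverseI[of _ cis_vec]) (auto simp: arg_vec_cis_vec)
  fix W :: "(real ^ 'n) set" assume "open W"
  from continuous_openin_preimage_gen[OF continuous_on_arg_vec this]
  have "openin (top_of_set (cis_vec ` arg_box a)) {z \<in> cis_vec ` arg_box a. arg_vec a z \<in> W}"
    by (rule back_subst[of "openin _"]) auto
  then show "openin (top_of_set torus) {z \<in> cis_vec ` arg_box a. arg_vec a z \<in> W}"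
    using op by (rule openin_trans)
next
  fix W :: "(complex ^ 'n) set" assume W: "openin (top_of_set torus) W" "W \<subseteq> cis_vec ` arg_box a"
  then obtain W' where W': "open W'" "W = torus \<inter> W'" by (auto simp: openin_open)
  have "arg_vec a ` W = arg_box a \<inter> cis_vec -` W'"
  proof (intro equalityI subsetI)
    fix y assume "y \<in> arg_vec a ` W"
    then obtain z where z: "z \<in> W" "y = arg_vec a z" by blast
    then obtain x where x: "x \<in> arg_box a" "z = cis_vec x" using W(2) by blast
    then have "y = x" using z arg_vec_cis_vec by blast
    then show "y \<in> arg_box a \<inter> cis_vec -` W'" using x z(1) W'(2) by auto
  next
    fix y assume "y \<in> arg_box a \<inter> cis_vec -` W'"
    then show "y \<in> arg_vec a ` W"
      using arg_vec_cis_vec[of y a] cis_vec_torus[of y] W'(2) by (intro image_eqI[of _ _ "cis_vec y"]) auto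
  qed
  then show "open (arg_vec a ` W)"
    using continuous_open_preimage[OF continuous_on_cis_vec open_arg_box W'(1)] by simp
qed

text \<open>In every coordinate \<open>k\<close> is the multiple of \<open>2 * pi\<close> that moves
  \<open>y\<close> into the box, and it keeps a neighbourhood of \<open>y\<close> there. So each
  branch is locally a translation, which settles both the smoothness of the torus transitions and
  that of the final diffeomorphism.\<close>

lemma arg_vec_lift:
  assumes "cis_vec y \<in> cis_vec ` arg_box a"
  obtains k N where "open N" "y \<in> N" "\<And>x. x \<in> N \<Longrightarrow> cis_vec x \<in> cis_vec ` arg_box a \<and> arg_vec a (cis_vec x) = x + k"
proof -
  obtain y' where y': "y' \<in> arg_box a" "cis_vec y = cis_vec y'" using assms by blast
  define k where "k = y' - y"
  have per: "cis_vec (x + k) = cis_vec x" for x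
  proof -
    have "cis (x $ i + k $ i) = cis (x $ i)" for i
    proof -
      have "cis (y $ i) = cis (y' $ i)" using y'(2) by (simp add: cis_vec_def vec_eq_iff)
      then have "(y' $ i - y $ i) / (2 * pi) \<in> \<int>" using cis_eq_iff[of "y' $ i" "y $ i"] by simp
      then show ?thesis using cis_eq_iff[of "x $ i + k $ i" "x $ i"] by (simp add: k_def)
    qed
    then show ?thesis by (simp add: cis_vec_def vec_eq_iff)
  qed
  show thesis
  proof (rule that[of "(\<lambda>x. x + k) -` arg_box a" k])
    show "open ((\<lambda>x. x + k) -` arg_box a)" by (intro open_vimage open_arg_box continuous_intros)
    show "y \<in> (\<lambda>x. x + k) -` arg_box a" using y'(1) by (simp add: k_def)
    fix x assume x: "x \<in> (\<lambda>x. x + k) -` arg_box a"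
    then have "cis_vec (x + k) \<in> cis_vec ` arg_box a" by blast
    moreover have "arg_vec a (cis_vec (x + k)) = x + k" using x by (intro arg_vec_cis_vec) auto
    ultimately show "cis_vec x \<in> cis_vec ` arg_box a \<and> arg_vec a (cis_vec x) = x + k"
      by (simp only: per)
  qed
qed

lemma second_countable_euclidean: "second_countable (euclidean :: 'a::second_countable_topology topology)"
proof -
  obtain B :: "'a set set" where B: "countable B" "topological_basis B" using ex_countable_basis by blast
  have "\<exists>V\<in>B. x \<in> V \<and> V \<subseteq> U" if "openin euclidean U \<and> x \<in> U" for U x
    by (rule topological_basisE[OF B(2), of U x]) (use that in auto)
  moreover have "\<forall>V\<in>B. openin euclidean V" using topological_basis_open[OF B(2)] by simp
  ultimately show ?thesis unfolding second_countable_def using B(1) by blast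
qed

lemma torus_smooth_manifold: "smooth_manifold (top_of_set torus) (torus_charts :: (complex ^ 'n, real ^ 'n) chart set)"
proof
  show "Hausdorff_space (top_of_set (torus :: (complex ^ 'n) set))"
    by (intro Hausdorff_space_subtopology Hausdorff_space_euclidean)
  show "second_countable (top_of_set (torus :: (complex ^ 'n) set))"
    by (intro second_countable_subtopology second_countable_euclidean)
  show "is_chart (top_of_set torus) c" if "c \<in> torus_charts" for c :: "(complex ^ 'n, real ^ 'n) chart"
    using that torus_chart_is_chart by (auto simp: torus_charts_eq)
  show "(\<Union>c\<in>(torus_charts :: (complex ^ 'n, real ^ 'n) chart set). fst c) = topspace (top_of_set torus)"
  proof (intro equalityI subsetI)
    fix z :: "complex ^ 'n" assume "z \<in> topspace (top_of_set torus)"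
    then obtain y where y: "z = cis_vec y" using torus_cis_vec by auto
    have "y \<in> arg_box (\<lambda>i. y $ i - pi)" by (simp add: arg_box_def)
    then have "z \<in> fst (cis_vec ` arg_box (\<lambda>i. y $ i - pi), arg_vec (\<lambda>i. y $ i - pi))" using y by simp
    moreover have "(cis_vec ` arg_box (\<lambda>i. y $ i - pi), arg_vec (\<lambda>i. y $ i - pi)) \<in> torus_charts"
      unfolding torus_charts_eq by blast
    ultimately show "z \<in> (\<Union>c\<in>torus_charts. fst c)" by blast
  qed (use cis_vec_torus in \<open>auto simp: torus_charts_eq\<close>)
  have sm: "smooth_on (arg_vec a ` (cis_vec ` arg_box a \<inter> cis_vec ` arg_box b))
      (transition (cis_vec ` arg_box a, arg_vec a) (cis_vec ` arg_box b, arg_vec b))" (is "smooth_on ?S ?t") for a b :: "'n \<Rightarrow> real"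
  proof (rule smooth_on_local)
    fix y assume "y \<in> ?S"
    then obtain x where x: "x \<in> arg_box a" "cis_vec x \<in> cis_vec ` arg_box b" "y = arg_vec a (cis_vec x)" by auto
    then have y: "y \<in> arg_box a" "cis_vec y \<in> cis_vec ` arg_box b" using arg_vec_cis_vec[OF x(1)] by auto
    obtain k N where N: "open N" "y \<in> N" "\<And>x. x \<in> N \<Longrightarrow> cis_vec x \<in> cis_vec ` arg_box b \<and> arg_vec b (cis_vec x) = x + k"
      by (rule arg_vec_lift[OF y(2)], rule that)
    have op: "open (arg_box a \<inter> N)" using N(1) open_arg_box by blast
    have "?t x = x + k" if "x \<in> arg_box a \<inter> N" for x
    proof -
      have "snd (cis_vec ` arg_box a, arg_vec a) (cis_vec x) = x" using that arg_vec_cis_vec by auto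
      then have "?t x = arg_vec b (cis_vec x)"
        using transition_apply[OF torus_chart_is_chart, of "cis_vec x" a "(cis_vec ` arg_box b, arg_vec b)"] that by auto
      then show ?thesis using N(3) that by auto
    qed
    moreover have "smooth_on (arg_box a \<inter> N) (\<lambda>x. x + k)"
      by (intro smooth_on_add op smooth_on_const smooth_on_linear bounded_linear_ident)
    ultimately have "smooth_on (arg_box a \<inter> N) ?t" using smooth_on_cong[OF op, of ?t "\<lambda>x. x + k"] by simp
    then show "\<exists>T. open T \<and> y \<in> T \<and> smooth_on (?S \<inter> T) ?t"
      using op y(1) N(2) by (intro exI[of _ "arg_box a \<inter> N"]) (auto intro: smooth_on_subset)
  qed
  show "compatible c d" if cd: "c \<in> torus_charts" "d \<in> torus_charts" for c d :: "(complex ^ 'n, real ^ 'n) chart"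
  proof -
    obtain a b where c: "c = (cis_vec ` arg_box a, arg_vec a)" and d: "d = (cis_vec ` arg_box b, arg_vec b)"
      using cd by (auto simp: torus_charts_eq)
    show ?thesis using sm[of a b] sm[of b a] by (simp add: compatible_def c d Int_commute)
  qed
qed

lemma diffeo_on_derivative_inverse:
  assumes f: "diffeo_on U f" and x: "x \<in> U"
  shows "frechet_derivative (inv_into U f) (at (f x)) (frechet_derivative f (at x) v) = v"
    and "frechet_derivative f (at x) (frechet_derivative (inv_into U f) (at (f x)) v) = v"
proof -
  let ?g = "inv_into U f"
  have U: "open U" and V: "open (f ` U)" and inj: "inj_on f U" using f by (auto simp: diffeo_on_def)
  have gf: "?g (f x) = x" using inj x by simp
  have Df: "(f has_derivative frechet_derivative f (at x)) (at x)"
    using f x by (intro smooth_on_has_derivative[of U]) (auto simp: diffeo_on_def)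
  have Dg: "(?g has_derivative frechet_derivative ?g (at (f x))) (at (f x))"
    using f x by (intro smooth_on_has_derivative[of "f ` U"]) (auto simp: diffeo_on_def)
  have "((\<lambda>y. ?g (f y)) has_derivative (\<lambda>v. frechet_derivative ?g (at (f x)) (frechet_derivative f (at x) v))) (at x)"
    by (rule has_derivative_compose[OF Df Dg])
  then have "((\<lambda>y. y) has_derivative (\<lambda>v. frechet_derivative ?g (at (f x)) (frechet_derivative f (at x) v))) (at x)"
    by (rule has_derivative_transform_within_open[OF _ U x]) (simp add: inj)
  from fun_cong[OF has_derivative_unique[OF this has_derivative_ident]]
  show "frechet_derivative ?g (at (f x)) (frechet_derivative f (at x) v) = v" .
  have Df': "(f has_derivative frechet_derivative f (at x)) (at (?g (f x)))" using Df gf by simp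
  have "((\<lambda>y. f (?g y)) has_derivative (\<lambda>v. frechet_derivative f (at x) (frechet_derivative ?g (at (f x)) v))) (at (f x))"
    by (rule has_derivative_compose[OF Dg Df'])
  then have "((\<lambda>y. y) has_derivative (\<lambda>v. frechet_derivative f (at x) (frechet_derivative ?g (at (f x)) v))) (at (f x))"
    by (rule has_derivative_transform_within_open[OF _ V]) (use x in \<open>auto intro: f_inv_into_f\<close>)
  from fun_cong[OF has_derivative_unique[OF this has_derivative_ident]]
  show "frechet_derivative f (at x) (frechet_derivative ?g (at (f x)) v) = v" .
qed

section \<open>Lagrangian fibrations in coordinates\<close>

lemma smooth_on_bilinear_family:
  fixes \<Omega> :: "'w::euclidean_space \<Rightarrow> 'a::euclidean_space \<Rightarrow> 'a \<Rightarrow> real"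
  assumes W: "open W" and bil: "\<And>w. w \<in> W \<Longrightarrow> bilinear (\<Omega> w)"
    and sm: "\<And>u v. smooth_on W (\<lambda>w. \<Omega> w u v)"
    and f: "smooth_on W f" and g: "smooth_on W g"
  shows "smooth_on W (\<lambda>w. \<Omega> w (f w) (g w))"
proof (rule smooth_on_congD[OF W])
  show "smooth_on W (\<lambda>w. \<Sum>b\<in>Basis. (f w \<bullet> b) *\<^sub>R (\<Sum>b'\<in>Basis. (g w \<bullet> b') *\<^sub>R \<Omega> w b b'))"
    by (rule smooth_on_sum[OF W] smooth_on_scaleR[OF W] smooth_on_inner[OF W] f g sm)+
  fix w assume "w \<in> W"
  then have lin: "linear (\<lambda>u. \<Omega> w u v)" "linear (\<Omega> w u)" for u v using bil by (auto simp: bilinear_def)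
  show "(\<Sum>b\<in>Basis. (f w \<bullet> b) *\<^sub>R (\<Sum>b'\<in>Basis. (g w \<bullet> b') *\<^sub>R \<Omega> w b b')) = \<Omega> w (f w) (g w)"
    using linear_eq_sum_Basis[OF lin(1)[of "g w"], of "f w"] linear_eq_sum_Basis[OF lin(2), where v="g w"]
    by simp
qed

text \<open>Two nested uses of \<open>has_derivative_linear_family\<close>: in the outer one the
  base point together with the first vector serves as the parameter, and the second vector is the
  linear argument.\<close>

lemma has_derivative_bilinear_family:
  fixes \<Omega> :: "'w::euclidean_space \<Rightarrow> 'a::euclidean_space \<Rightarrow> 'a \<Rightarrow> real"
  assumes V: "open V" "f x \<in> V" and bil: "\<And>z. z \<in> V \<Longrightarrow> bilinear (\<Omega> z)"
    and sm: "\<And>u v. smooth_on V (\<lambda>z. \<Omega> z u v)"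
    and f: "(f has_derivative f') (at x)" and g: "(g has_derivative g') (at x)" and h: "(h has_derivative h') (at x)"
  shows "((\<lambda>w. \<Omega> (f w) (g w) (h w)) has_derivative
    (\<lambda>d. frechet_derivative (\<lambda>z. \<Omega> z (g x) (h x)) (at (f x)) (f' d) + \<Omega> (f x) (g' d) (h x) + \<Omega> (f x) (g x) (h' d))) (at x)"
proof -
  have lin: "linear (\<lambda>u. \<Omega> z u v)" "linear (\<Omega> z u)" if "z \<in> V" for z u v
    using bil[OF that] by (auto simp: bilinear_def)
  have D1: "((\<lambda>p. \<Omega> (fst p) (snd p) v) has_derivative
      (\<lambda>p. frechet_derivative (\<lambda>z. \<Omega> z u v) (at (f x)) (fst p) + \<Omega> (f x) (snd p) v)) (at (f x, u))" for u v
    by (rule has_derivative_linear_family[OF V lin(1) smooth_on_has_derivative[OF sm V(2)]])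
  have V': "open (V \<times> (UNIV :: 'a set))" "(f x, g x) \<in> V \<times> (UNIV :: 'a set)"
    using V by (auto intro: open_Times)
  have "((\<lambda>q. \<Omega> (fst (fst q)) (snd (fst q)) (snd q)) has_derivative
      (\<lambda>q. (frechet_derivative (\<lambda>z. \<Omega> z (g x) (h x)) (at (f x)) (fst (fst q)) + \<Omega> (f x) (snd (fst q)) (h x)) +
        \<Omega> (fst (f x, g x)) (snd (f x, g x)) (snd q))) (at ((f x, g x), h x))"
    by (rule has_derivative_linear_family[where A="\<lambda>p v. \<Omega> (fst p) (snd p) v" and
        A'="\<lambda>v p. frechet_derivative (\<lambda>z. \<Omega> z (g x) v) (at (f x)) (fst p) + \<Omega> (f x) (snd p) v", OF V'])
      (use lin(2) D1 in auto)
  from has_derivative_compose[OF has_derivative_Pair[OF has_derivative_Pair[OF f g] h] this]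
  show ?thesis by simp
qed

lemma alternating_antisym:
  assumes "bilinear \<Omega>" "\<And>u. \<Omega> u u = (0::real)"
  shows "\<Omega> u v = - \<Omega> v u"
proof -
  have "\<Omega> (u + v) (u + v) = \<Omega> u u + \<Omega> u v + (\<Omega> v u + \<Omega> v v)"
    by (simp add: bilinear_ladd[OF assms(1)] bilinear_radd[OF assms(1)])
  then show ?thesis using assms(2) by simp
qed

text \<open>The exterior derivative commutes with pullback. Differentiating \<open>\<Omega>'\<close>
  in the three directions produces six terms with second derivatives of \<open>\<phi>\<close>; they
  cancel in pairs, since these derivatives are symmetric and \<open>\<Omega>\<close> is
  antisymmetric.\<close>

lemma pullback_closed:
  fixes \<phi> :: "'w::euclidean_space \<Rightarrow> 'a::euclidean_space" and \<Omega> :: "'a \<Rightarrow> 'a \<Rightarrow> 'a \<Rightarrow> real"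
  assumes W: "open W" "w \<in> W" and \<phi>: "smooth_on W \<phi>" and V: "open V" "\<phi> w \<in> V"
    and bil: "\<And>z. z \<in> V \<Longrightarrow> bilinear (\<Omega> z)" and alt: "\<And>z u. z \<in> V \<Longrightarrow> \<Omega> z u u = 0"
    and sm: "\<And>u v. smooth_on V (\<lambda>z. \<Omega> z u v)"
    and closed: "\<And>z a b c. z \<in> V \<Longrightarrow> frechet_derivative (\<lambda>z. \<Omega> z b c) (at z) a
      - frechet_derivative (\<lambda>z. \<Omega> z a c) (at z) b + frechet_derivative (\<lambda>z. \<Omega> z a b) (at z) c = 0"
  defines "D \<equiv> \<lambda>w. frechet_derivative \<phi> (at w)"
  defines "\<Omega>' \<equiv> \<lambda>w u v. \<Omega> (\<phi> w) (D w u) (D w v)"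
  shows "frechet_derivative (\<lambda>w. \<Omega>' w b c) (at w) a
      - frechet_derivative (\<lambda>w. \<Omega>' w a c) (at w) b + frechet_derivative (\<lambda>w. \<Omega>' w a b) (at w) c = 0"
proof -
  define H where "H u v = frechet_derivative (\<lambda>w. D w u) (at w) v" for u v
  have Dd: "((\<lambda>w. D w u) has_derivative H u) (at w)" for u
    unfolding H_def D_def by (rule smooth_on_has_derivative[OF smooth_on_derivative[OF \<phi>] W(2)])
  have D\<phi>: "(\<phi> has_derivative D w) (at w)"
    unfolding D_def by (rule smooth_on_has_derivative[OF \<phi> W(2)])
  have sym: "H u v = H v u" for u v
    unfolding H_def D_def by (rule second_derivative_symmetric[OF W \<phi>])
  have eq: "frechet_derivative (\<lambda>w. \<Omega>' w u v) (at w) d =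
      frechet_derivative (\<lambda>z. \<Omega> z (D w u) (D w v)) (at (\<phi> w)) (D w d)
      + \<Omega> (\<phi> w) (H u d) (D w v) + \<Omega> (\<phi> w) (D w u) (H v d)" for u v d
    unfolding \<Omega>'_def
    using fun_cong[OF frechet_derivative_at[OF has_derivative_bilinear_family[OF V bil sm D\<phi> Dd Dd]]]
    by simp
  have anti: "\<Omega> (\<phi> w) u v = - \<Omega> (\<phi> w) v u" for u v
    by (rule alternating_antisym[OF bil[OF V(2)] alt[OF V(2)]])
  show ?thesis
    unfolding eq
    using closed[OF V(2), of "D w b" "D w c" "D w a"]
      anti[of "D w b" "H c a"] anti[of "D w a" "H c b"] sym[of a b] sym[of a c] sym[of b c]
    by simp
qed

text \<open>The bilinear form induces an isomorphism with the dual space, so each \<open>D v $ i\<close> is represented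
  by a vector \<open>H i\<close>. The vectors \<open>H i\<close> together with a right inverse of \<open>D\<close> span the whole space,
  which shows without counting dimensions that the kernel of \<open>D\<close> is spanned by the \<open>H i\<close>.\<close>

lemma lagrangian_splitting:
  fixes \<Omega> :: "(real ^ 'n) \<times> (real ^ 'n) \<Rightarrow> (real ^ 'n) \<times> (real ^ 'n) \<Rightarrow> real"
    and D :: "(real ^ 'n) \<times> (real ^ 'n) \<Rightarrow> real ^ 'n"
  assumes bil: "bilinear \<Omega>" and D: "linear D" "surj D"
    and H: "\<And>i v. \<Omega> (H i) v = - (D v $ i)" and comm: "\<And>i j. \<Omega> (H i) (H j) = 0"
  obtains h :: "(real ^ 'n) \<times> (real ^ 'n) \<Rightarrow> real ^ 'n" where "linear h" "\<And>u. h u = 0 \<Longrightarrow> D u = 0 \<Longrightarrow> u = 0"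
    "\<And>u u'. D u = 0 \<Longrightarrow> D u' = 0 \<Longrightarrow> \<Omega> u u' = 0"
proof -
  have linl: "linear (\<lambda>u. \<Omega> u v)" and linr: "linear (\<Omega> u)" for u v using bil unfolding bilinear_def by blast+
  obtain S where S: "linear S" "D \<circ> S = id" using linear_surjective_right_inverse[OF D] by blast
  have DS: "D (S y) = y" for y using S(2) by (simp add: fun_eq_iff)
  define X where "X c = (\<Sum>i\<in>UNIV. c $ i *\<^sub>R H i)" for c :: "real ^ 'n"
  have X: "linear X"
    unfolding X_def by (intro linearI) (simp_all add: scaleR_add_left sum.distrib scaleR_sum_right)
  have \<Omega>X: "\<Omega> (X c) v = - (c \<bullet> D v)" for c v
    unfolding X_def
    by (simp add: linear_sum[OF linl] linear_scale[OF linl] H inner_vec_def sum_negf)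
  have DX: "D (X c) = 0" for c
  proof -
    have "D (H j) $ i = 0" for i j using H[of i "H j"] comm[of i j] by simp
    then have "D (H j) = 0" for j by (simp add: vec_eq_iff)
    then show ?thesis unfolding X_def by (simp add: linear_sum[OF D(1)] linear_scale[OF D(1)])
  qed
  have XX: "\<Omega> (X c) (X c') = 0" for c c' using \<Omega>X[of c "X c'"] DX by simp
  define M where "M p = X (fst p) + S (snd p)" for p
  have M: "linear M"
    unfolding M_def by (intro linearI) (simp_all add: linear_add[OF X] linear_add[OF S(1)]
        linear_scale[OF X] linear_scale[OF S(1)] scaleR_add_right)
  have DM: "D (M p) = snd p" for p by (simp add: M_def linear_add[OF D(1)] DX DS)
  have "inj M"
    unfolding linear_injective_0[OF M]
  proof (intro allI impI)
    fix p assume p: "M p = 0"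
    then have s: "snd p = 0" using DM[of p] linear_0[OF D(1)] by simp
    then have "X (fst p) = 0" using p by (simp add: M_def linear_0[OF S(1)])
    then have "fst p \<bullet> D v = 0" for v using \<Omega>X[of "fst p" v] linear_0[OF linl] by simp
    from this[of "S (fst p)"] have "fst p = 0" by (simp add: DS)
    with s show "p = 0" by (simp add: prod_eq_iff)
  qed
  then obtain N where N: "linear N" "\<And>p. N (M p) = p" "\<And>u. M (N u) = u"
    using linear_injective_isomorphism[OF M] by blast
  have snd_N: "snd (N u) = D u" for u using DM[of "N u"] N(3) by simp
  have ker: "u = X (fst (N u))" if "D u = 0" for u
    using N(3)[of u] snd_N[of u] that by (simp add: M_def linear_0[OF S(1)])
  show thesis
  \<comment> \<open>The form \<open>h\<close> is read off from the inverse of \<open>M\<close>: it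
    gives the coefficients along the \<open>H i\<close>, and \<open>D\<close> gives the remaining
    component, so together they determine a vector.\<close>
  proof (rule that[of "\<lambda>u. fst (N u)"])
    show "linear (\<lambda>u. fst (N u))" using linear_compose[OF N(1) linear_fst] by (simp add: o_def)
    show "u = 0" if "fst (N u) = 0" "D u = 0" for u
      using ker[OF that(2)] that(1) linear_0[OF X] by simp
    show "\<Omega> u u' = 0" if "D u = 0" "D u' = 0" for u u'
      using XX[of "fst (N u)" "fst (N u')"] ker[OF that(1), symmetric] ker[OF that(2), symmetric] by simp
  qed
qed

lemma ball_times_subset:
  fixes x :: "'a::metric_space" and y :: "'b::metric_space"
  assumes "open W" "(x, y) \<in> W"
  obtains r where "r > 0" "ball x r \<times> ball y r \<subseteq> W"
proof -
  obtain A B where AB: "open A" "open B" "x \<in> A" "y \<in> B" "A \<times> B \<subseteq> W"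
    using open_prod_elim[OF assms] by (metis mem_Sigma_iff)
  obtain r s where r: "r > 0" "ball x r \<subseteq> A" and s: "s > 0" "ball y s \<subseteq> B"
    using AB open_contains_ball by metis
  have "ball x (min r s) \<times> ball y (min r s) \<subseteq> A \<times> B"
    using r s by (intro Sigma_mono) auto
  then show thesis using that[of "min r s"] r s AB by auto
qed


text \<open>With \<open>(x, y)\<close> the coordinates \<open>\<psi> = (h, G)\<close> and \<open>\<Omega>'\<close> the form in these coordinates, the forms
  \<open>\<alpha>\<^sub>i = \<Omega>' (\<partial>y\<^sub>i, \<cdot>)\<close> on the fibre \<open>y = 0\<close> are closed because \<open>\<Omega>'\<close> is closed and vanishes on all
  fibres, and they form a coframe because \<open>\<Omega>'\<close> is nondegenerate. Their primitives \<open>\<theta>\<close> replace \<open>x\<close>.\<close>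

lemma local_action_coordinates:
  fixes \<Omega> :: "(real ^ 'n) \<times> (real ^ 'n) \<Rightarrow> (real ^ 'n) \<times> (real ^ 'n) \<Rightarrow> (real ^ 'n) \<times> (real ^ 'n) \<Rightarrow> real"
    and G :: "(real ^ 'n) \<times> (real ^ 'n) \<Rightarrow> real ^ 'n"
  assumes V: "open V" "z0 \<in> V" and G: "smooth_on V G" "G z0 = 0" "surj (frechet_derivative G (at z0))"
    and bil: "\<And>z. z \<in> V \<Longrightarrow> bilinear (\<Omega> z)" and alt: "\<And>z u. z \<in> V \<Longrightarrow> \<Omega> z u u = 0"
    and nondeg: "\<And>z u. z \<in> V \<Longrightarrow> (\<And>v. \<Omega> z u v = 0) \<Longrightarrow> u = 0"
    and sm: "\<And>u v. smooth_on V (\<lambda>z. \<Omega> z u v)"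
    and closed: "\<And>z a b c. z \<in> V \<Longrightarrow> frechet_derivative (\<lambda>z. \<Omega> z b c) (at z) a
      - frechet_derivative (\<lambda>z. \<Omega> z a c) (at z) b + frechet_derivative (\<lambda>z. \<Omega> z a b) (at z) c = 0"
    and H: "\<And>z i v. z \<in> V \<Longrightarrow> \<Omega> z (H z i) v = - (frechet_derivative G (at z) v $ i)"
    and comm: "\<And>z i j. z \<in> V \<Longrightarrow> \<Omega> z (H z i) (H z j) = 0"
  obtains U \<kappa> x r where "diffeo_on U \<kappa>" "U \<subseteq> V" "z0 \<in> U" "r > 0" "\<kappa> ` U = ball x r \<times> ball 0 r"
    "\<And>z. z \<in> U \<Longrightarrow> snd (\<kappa> z) = G z"
    "\<And>z u v. z \<in> U \<Longrightarrow> G z = 0 \<Longrightarrow> \<Omega> z (frechet_derivative (inv_into U \<kappa>) (at (\<kappa> z)) (0, v))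
       (frechet_derivative (inv_into U \<kappa>) (at (\<kappa> z)) (u, 0)) = v \<bullet> u"
    "\<And>z u u'. z \<in> U \<Longrightarrow> G z = 0 \<Longrightarrow> \<Omega> z (frechet_derivative (inv_into U \<kappa>) (at (\<kappa> z)) (u, 0))
       (frechet_derivative (inv_into U \<kappa>) (at (\<kappa> z)) (u', 0)) = 0"
proof -
  define DG where "DG z = frechet_derivative G (at z)" for z
  have dG: "(G has_derivative DG z) (at z)" if "z \<in> V" for z
    unfolding DG_def by (rule smooth_on_has_derivative[OF G(1) that])
  have linDG: "linear (DG z)" if "z \<in> V" for z by (rule has_derivative_linear[OF dG[OF that]])
  have lagr: "\<Omega> z u u' = 0" if z: "z \<in> V" "surj (DG z)" and u: "DG z u = 0" "DG z u' = 0" for z u u'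
  proof (rule lagrangian_splitting[OF bil[OF z(1)] linDG[OF z(1)] z(2), of "H z"])
    show "\<Omega> z (H z i) v = - (DG z v $ i)" for i v unfolding DG_def by (rule H[OF z(1)])
    show "\<Omega> z (H z i) (H z j) = 0" for i j by (rule comm[OF z(1)])
  qed (use u in blast)
  obtain h :: "(real ^ 'n) \<times> (real ^ 'n) \<Rightarrow> real ^ 'n" where h: "linear h" "\<And>u. h u = 0 \<Longrightarrow> DG z0 u = 0 \<Longrightarrow> u = 0"
  proof (rule lagrangian_splitting[OF bil[OF V(2)] linDG[OF V(2)] G(3)[folded DG_def], of "H z0"])
    show "\<Omega> z0 (H z0 i) v = - (DG z0 v $ i)" for i v unfolding DG_def by (rule H[OF V(2)])
    show "\<Omega> z0 (H z0 i) (H z0 j) = 0" for i j by (rule comm[OF V(2)])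
    fix h :: "(real ^ 'n) \<times> (real ^ 'n) \<Rightarrow> real ^ 'n"
    assume h: "linear h" "\<And>u. h u = 0 \<Longrightarrow> DG z0 u = 0 \<Longrightarrow> u = 0"
    show thesis by (rule that[of h], rule h(1), rule h(2))
  qed
  have blh: "bounded_linear h" using h(1) by (simp add: linear_conv_bounded_linear)
  define \<psi> where "\<psi> z = (h z, G z)" for z
  have sm\<psi>: "smooth_on V \<psi>"
    unfolding \<psi>_def by (rule smooth_on_Pair[OF V(1) smooth_on_linear[OF blh] G(1)])
  have d\<psi>: "frechet_derivative \<psi> (at z) = (\<lambda>u. (h u, DG z u))" if "z \<in> V" for z
    unfolding \<psi>_def
    using frechet_derivative_at[OF has_derivative_Pair[OF bounded_linear_imp_has_derivative[OF blh] dG[OF that]]]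
    by (rule sym)
  have "inj (frechet_derivative \<psi> (at z0))"
  proof (rule injI)
    fix u v assume "frechet_derivative \<psi> (at z0) u = frechet_derivative \<psi> (at z0) v"
    then have "h (u - v) = 0" "DG z0 (u - v) = 0"
      by (simp_all add: d\<psi>[OF V(2)] linear_diff[OF h(1)] linear_diff[OF linDG[OF V(2)]])
    then show "u = v" using h(2)[of "u - v"] by simp
  qed
  then obtain U1 where U1: "diffeo_on U1 \<psi>" "z0 \<in> U1" "U1 \<subseteq> V"
    using inverse_function_smooth[OF V(1) sm\<psi> V(2)] by blast
  define \<phi> where "\<phi> = inv_into U1 \<psi>"
  define W where "W = \<psi> ` U1"
  have W: "open W" and sm\<phi>: "smooth_on W \<phi>" and inj\<psi>: "inj_on \<psi> U1" and opU1: "open U1"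
    using U1(1) by (auto simp: diffeo_on_def \<phi>_def W_def)
  have \<phi>\<psi>: "\<phi> (\<psi> z) = z" if "z \<in> U1" for z using inj\<psi> that by (simp add: \<phi>_def)
  have \<phi>: "\<phi> w \<in> U1" "\<psi> (\<phi> w) = w" if "w \<in> W" for w
    using that by (auto simp: W_def \<phi>_def inv_into_into f_inv_into_f)
  have \<phi>V: "\<phi> w \<in> V" if "w \<in> W" for w using \<phi>(1)[OF that] U1(3) by blast
  define D where "D w = frechet_derivative \<phi> (at w)" for w
  have d\<phi>: "(\<phi> has_derivative D w) (at w)" if "w \<in> W" for w
    unfolding D_def by (rule smooth_on_has_derivative[OF sm\<phi> that])
  have linD: "linear (D w)" if "w \<in> W" for w by (rule has_derivative_linear[OF d\<phi>[OF that]])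
  have \<psi>D: "(h (D w u), DG (\<phi> w) (D w u)) = u" and D\<psi>: "D w (h v, DG (\<phi> w) v) = v" if w: "w \<in> W" for w u v
  proof -
    note * = diffeo_on_derivative_inverse[OF U1(1) \<phi>(1)[OF w], folded \<phi>_def]
    show "(h (D w u), DG (\<phi> w) (D w u)) = u"
      using *(2)[of u] unfolding \<phi>(2)[OF w] d\<psi>[OF \<phi>V[OF w]] D_def .
    show "D w (h v, DG (\<phi> w) v) = v"
      using *(1)[of v] unfolding \<phi>(2)[OF w] d\<psi>[OF \<phi>V[OF w]] D_def .
  qed
  have DGD: "DG (\<phi> w) (D w u) = snd u" if "w \<in> W" for w u
    using arg_cong[OF \<psi>D[OF that, of u], of snd] by simp
  \<comment> \<open>Surjectivity is assumed at \<open>z0\<close> only, but spreads over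
    \<open>U1\<close> because \<open>G\<close> is a component of the diffeomorphism
    \<open>\<psi>\<close>. Hence all fibres in this neighbourhood are Lagrangian.\<close>
  have surjDG: "surj (DG (\<phi> w))" if "w \<in> W" for w
    by (rule surjI[of _ "\<lambda>y. D w (0, y)"]) (simp add: DGD[OF that])
  define \<Omega>' where "\<Omega>' w u v = \<Omega> (\<phi> w) (D w u) (D w v)" for w u v
  have lagr': "\<Omega>' w (u, 0) (u', 0) = 0" if "w \<in> W" for w u u'
    unfolding \<Omega>'_def by (rule lagr[OF \<phi>V[OF that] surjDG[OF that]]) (simp_all add: DGD[OF that])
  have sm\<Omega>': "smooth_on W (\<lambda>w. \<Omega>' w u v)" for u v
  proof -
    have *: "smooth_on W (\<lambda>w. \<Omega> (\<phi> w) u v)" for u v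
      by (rule smooth_on_compose[where f=\<phi> and g="\<lambda>z. \<Omega> z u v", OF W V(1) _ sm\<phi> sm]) (use \<phi>V in blast)
    show ?thesis
      unfolding \<Omega>'_def D_def
      by (rule smooth_on_bilinear_family[where \<Omega>="\<lambda>w. \<Omega> (\<phi> w)", OF W _ * smooth_on_derivative[OF sm\<phi>] smooth_on_derivative[OF sm\<phi>]])
        (rule bil[OF \<phi>V])
  qed
  have closed': "frechet_derivative (\<lambda>w. \<Omega>' w b c) (at w) a - frechet_derivative (\<lambda>w. \<Omega>' w a c) (at w) b
      + frechet_derivative (\<lambda>w. \<Omega>' w a b) (at w) c = 0" if "w \<in> W" for w a b c
    unfolding \<Omega>'_def D_def by (rule pullback_closed[OF W that sm\<phi> V(1) \<phi>V[OF that] bil alt sm closed])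
  have lin\<Omega>'l: "linear (\<lambda>u. \<Omega>' w u v)" and lin\<Omega>'r: "linear (\<lambda>v. \<Omega>' w u v)" if w: "w \<in> W" for w u v
  proof -
    have lin: "linear (\<lambda>u. \<Omega> (\<phi> w) u v)" "linear (\<lambda>v. \<Omega> (\<phi> w) u v)" for u v
      using bil[OF \<phi>V[OF w]] unfolding bilinear_def by blast+
    show "linear (\<lambda>u. \<Omega>' w u v)" "linear (\<lambda>v. \<Omega>' w u v)"
      unfolding \<Omega>'_def using linear_compose[OF linD[OF w] lin(1)] linear_compose[OF linD[OF w] lin(2)]
      unfolding o_def .
  qed
  define x1 where "x1 = h z0"
  have w0: "\<psi> z0 = (x1, 0)" by (simp add: \<psi>_def x1_def G(2))
  have "(x1, 0) \<in> W" using imageI[OF U1(2), of \<psi>] unfolding w0 W_def .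
  then obtain r1 where r1: "r1 > 0" "ball x1 r1 \<times> ball 0 r1 \<subseteq> W" using ball_times_subset[OF W] by blast
  have in_W: "(x, 0) \<in> W" if "x \<in> ball x1 r1" for x using r1 that by auto
  define \<alpha> where "\<alpha> x u = (\<chi> i. \<Omega>' (x, 0) (0, axis i 1) (u, 0))" for x u
  have lin\<alpha>: "linear (\<alpha> x)" if "x \<in> ball x1 r1" for x
  proof (rule linearI)
    show "\<alpha> x (u + v) = \<alpha> x u + \<alpha> x v" for u v
      using linear_add[OF lin\<Omega>'r[OF in_W[OF that]], of _ "(u, 0)" "(v, 0)"] by (simp add: \<alpha>_def vec_eq_iff)
    show "\<alpha> x (r *\<^sub>R u) = r *\<^sub>R \<alpha> x u" for r u
      using linear_scale[OF lin\<Omega>'r[OF in_W[OF that]], of _ r "(u, 0)"] by (simp add: \<alpha>_def vec_eq_iff)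
  qed
  have \<alpha>_inner: "v \<bullet> \<alpha> x u = \<Omega>' (x, 0) (0, v) (u, 0)" if "x \<in> ball x1 r1" for x u v
  proof -
    have lin: "linear (\<lambda>v. \<Omega>' (x, 0) (0, v) (u, 0))"
    proof (rule linearI)
      show "\<Omega>' (x, 0) (0, v + w) (u, 0) = \<Omega>' (x, 0) (0, v) (u, 0) + \<Omega>' (x, 0) (0, w) (u, 0)" for v w
        using linear_add[OF lin\<Omega>'l[OF in_W[OF that]], of "(0, v)" "(0, w)" "(u, 0)"] by simp
      show "\<Omega>' (x, 0) (0, r *\<^sub>R v) (u, 0) = r *\<^sub>R \<Omega>' (x, 0) (0, v) (u, 0)" for r v
        using linear_scale[OF lin\<Omega>'l[OF in_W[OF that]], of r "(0, v)" "(u, 0)"] by simp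
    qed
    have "v = (\<Sum>i\<in>UNIV. v $ i *\<^sub>R axis i 1)"
      using basis_expansion[of v] by (simp add: scalar_mult_eq_scaleR)
    then have "\<Omega>' (x, 0) (0, v) (u, 0) = (\<Sum>i\<in>UNIV. v $ i *\<^sub>R \<Omega>' (x, 0) (0, axis i 1) (u, 0))"
      using linear_sum[OF lin, of "\<lambda>i. v $ i *\<^sub>R axis i 1" UNIV] by (simp add: linear_scale[OF lin])
    then show ?thesis by (simp add: \<alpha>_def inner_vec_def)
  qed
  \<comment> \<open>If \<open>\<alpha> x u\<close> vanishes, then \<open>(u, 0)\<close> pairs to
    zero with transverse vectors by \<open>\<alpha>_inner\<close> and with fibre vectors by
    \<open>lagr'\<close>, hence with everything.\<close>
  have \<alpha>_inj: "u = 0" if x: "x \<in> ball x1 r1" and "\<alpha> x u = 0" for x u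
  proof -
    note w = in_W[OF x]
    have 0: "\<Omega>' (x, 0) p (u, 0) = 0" for p
    proof -
      have "\<Omega>' (x, 0) (fst p, 0) (u, 0) + \<Omega>' (x, 0) (0, snd p) (u, 0) = 0"
        using lagr'[OF w] \<alpha>_inner[OF x, of "snd p" u] that(2) by simp
      then show ?thesis
        using linear_add[OF lin\<Omega>'l[OF w], of "(fst p, 0)" "(0, snd p)" "(u, 0)"] by simp
    qed
    have "\<Omega> (\<phi> (x, 0)) (D (x, 0) (u, 0)) v = 0" for v
    proof -
      have "\<Omega> (\<phi> (x, 0)) v (D (x, 0) (u, 0)) = 0"
        using 0[of "(h v, DG (\<phi> (x, 0)) v)"] unfolding \<Omega>'_def D\<psi>[OF w] .
      then show ?thesis
        using alternating_antisym[OF bil[OF \<phi>V[OF w]] alt[OF \<phi>V[OF w]], of "D (x, 0) (u, 0)" v] by simp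
    qed
    then have "D (x, 0) (u, 0) = 0" by (rule nondeg[OF \<phi>V[OF w]])
    then show "u = 0"
      using \<psi>D[OF w, of "(u, 0)"] linear_0[OF h(1)] by simp
  qed
  have sm_slice: "smooth_on (ball x1 r1) (\<lambda>x. \<Omega>' (x, 0) p q)" for p q
    by (rule smooth_on_compose[where f="\<lambda>x. (x, 0)" and g="\<lambda>w. \<Omega>' w p q" and T=W])
      (use W sm\<Omega>' in_W in \<open>auto intro!: smooth_on_linear bounded_linear_Pair bounded_linear_ident bounded_linear_zero\<close>)
  have sm\<alpha>: "smooth_on (ball x1 r1) (\<lambda>x. \<alpha> x u)" for u
    by (rule smooth_on_vec) (simp_all add: \<alpha>_def sm_slice)
  have slice_derivative: "frechet_derivative (\<lambda>x. \<alpha> x u) (at x) v $ i =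
      frechet_derivative (\<lambda>w. \<Omega>' w (0, axis i 1) (u, 0)) (at (x, 0)) (v, 0)" if x: "x \<in> ball x1 r1" for x u v i
  proof -
    have "((\<lambda>x. (x, 0 :: real ^ 'n)) has_derivative (\<lambda>v. (v, 0))) (at x)"
      by (intro has_derivative_Pair has_derivative_ident has_derivative_const)
    from has_derivative_compose[OF this smooth_on_has_derivative[OF sm\<Omega>' in_W[OF x]]]
    have 1: "((\<lambda>x. \<Omega>' (x, 0) (0, axis i 1) (u, 0)) has_derivative
      (\<lambda>v. frechet_derivative (\<lambda>w. \<Omega>' w (0, axis i 1) (u, 0)) (at (x, 0)) (v, 0))) (at x)" .
    have 2: "((\<lambda>x. \<alpha> x u $ i) has_derivative (\<lambda>v. frechet_derivative (\<lambda>x. \<alpha> x u) (at x) v $ i)) (at x)"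
      by (rule bounded_linear.has_derivative[OF bounded_linear_vec_nth smooth_on_has_derivative[OF sm\<alpha> x]])
    have "(\<lambda>x. \<alpha> x u $ i) = (\<lambda>x. \<Omega>' (x, 0) (0, axis i 1) (u, 0))" by (simp add: \<alpha>_def)
    with 2 have "((\<lambda>x. \<Omega>' (x, 0) (0, axis i 1) (u, 0)) has_derivative
        (\<lambda>v. frechet_derivative (\<lambda>x. \<alpha> x u) (at x) v $ i)) (at x)" by simp
    from fun_cong[OF has_derivative_unique[OF this 1]] show ?thesis .
  qed
  \<comment> \<open>The Lagrangian condition holds on an open set, so it may be differentiated
    across the fibres too. This removes one of the three terms of the exterior derivative on
    \<open>(u, 0)\<close>, \<open>(v, 0)\<close>, \<open>(0, axis i 1)\<close>; the other two
    express the symmetry of the derivative of \<open>\<alpha>\<close>.\<close>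
  have fibre_derivative: "frechet_derivative (\<lambda>w. \<Omega>' w (u, 0) (v, 0)) (at w) d = 0" if "w \<in> W" for w u v d
    using frechet_derivative_cong_open[OF W that, of "\<lambda>w. \<Omega>' w (u, 0) (v, 0)" "\<lambda>w. 0"] lagr' by simp
  have \<alpha>_closed: "frechet_derivative (\<lambda>x. \<alpha> x u) (at x) v = frechet_derivative (\<lambda>x. \<alpha> x v) (at x) u"
    if x: "x \<in> ball x1 r1" for x u v
    unfolding vec_eq_iff slice_derivative[OF x]
    using closed'[OF in_W[OF x], of "(u, 0)" "(v, 0)"] fibre_derivative[OF in_W[OF x], of u v] by simp
  obtain \<theta> where \<theta>: "\<And>x. x \<in> ball x1 r1 \<Longrightarrow> (\<theta> has_derivative \<alpha> x) (at x)"
    by (rule closed_form_exact[OF open_ball convex_ball lin\<alpha> sm\<alpha> \<alpha>_closed], assumption+, rule that)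
  have sm\<theta>: "smooth_on (ball x1 r1) \<theta>" by (rule smooth_onI[OF open_ball \<theta> sm\<alpha>])
  let ?B = "ball x1 r1 \<times> ball (0 :: real ^ 'n) r1"
  have opB: "open ?B" by (intro open_Times open_ball)
  define \<Theta> where "\<Theta> w = (\<theta> (fst w), snd w)" for w :: "(real ^ 'n) \<times> (real ^ 'n)"
  have sm\<Theta>: "smooth_on ?B \<Theta>"
    unfolding \<Theta>_def
  proof (rule smooth_on_Pair[OF opB])
    show "smooth_on ?B (\<lambda>w. \<theta> (fst w))"
      by (rule smooth_on_compose[where f=fst and g=\<theta>, OF opB open_ball _ smooth_on_linear[OF bounded_linear_fst] sm\<theta>]) auto
  qed (rule smooth_on_linear[OF bounded_linear_snd])
  have d\<Theta>: "frechet_derivative \<Theta> (at w) = (\<lambda>p. (\<alpha> (fst w) (fst p), snd p))" if "w \<in> ?B" for w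
  proof -
    have "fst w \<in> ball x1 r1" using that by auto
    have "((\<lambda>w. \<theta> (fst w)) has_derivative (\<lambda>p. \<alpha> (fst w) (fst p))) (at w)"
      by (rule has_derivative_compose[OF bounded_linear_imp_has_derivative[OF bounded_linear_fst] \<theta>[OF \<open>fst w \<in> ball x1 r1\<close>]])
    then have "(\<Theta> has_derivative (\<lambda>p. (\<alpha> (fst w) (fst p), snd p))) (at w)"
      unfolding \<Theta>_def by (intro has_derivative_Pair has_derivative_snd has_derivative_ident) 
    from frechet_derivative_at[OF this] show ?thesis by (rule sym)
  qed
  have w0B: "(x1, 0) \<in> ?B" using r1(1) by simp
  have "inj (frechet_derivative \<Theta> (at (x1, 0)))"
  proof (rule injI)
    fix p q assume "frechet_derivative \<Theta> (at (x1, 0)) p = frechet_derivative \<Theta> (at (x1, 0)) q"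
    then have "\<alpha> x1 (fst p) = \<alpha> x1 (fst q)" "snd p = snd q" by (simp_all add: d\<Theta>[OF w0B])
    moreover have "fst p - fst q = 0"
    proof (rule \<alpha>_inj)
      show x1: "x1 \<in> ball x1 r1" using r1(1) by simp
      show "\<alpha> x1 (fst p - fst q) = 0"
        using \<open>\<alpha> x1 (fst p) = \<alpha> x1 (fst q)\<close> linear_diff[OF lin\<alpha>[OF x1], of "fst p" "fst q"] by simp
    qed
    ultimately show "p = q" by (simp add: prod_eq_iff)
  qed
  then obtain U2 where U2: "diffeo_on U2 \<Theta>" "(x1, 0) \<in> U2" "U2 \<subseteq> ?B"
    using inverse_function_smooth[OF opB sm\<Theta> w0B] by blast
  have "open (\<Theta> ` U2)" using U2(1) by (simp add: diffeo_on_def)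
  moreover have "(\<theta> x1, 0) \<in> \<Theta> ` U2" using imageI[OF U2(2), of \<Theta>] by (simp add: \<Theta>_def)
  ultimately obtain r where r: "r > 0" "ball (\<theta> x1) r \<times> ball 0 r \<subseteq> \<Theta> ` U2"
    using ball_times_subset by blast
  \<comment> \<open>Shrinking makes the coordinate image a product of balls, so that its slice at
    height 0 is connected; the identification of \<open>L\<close> inside a chart depends on
    this.\<close>
  define U3 where "U3 = U2 \<inter> \<Theta> -` (ball (\<theta> x1) r \<times> ball 0 r)"
  have opU3: "open U3"
    unfolding U3_def using U2(1)
    by (intro continuous_open_preimage open_Times open_ball smooth_on_imp_continuous_on) (auto simp: diffeo_on_def)
  have U3: "diffeo_on U3 \<Theta>" by (rule diffeo_on_subset[OF U2(1) opU3]) (simp add: U3_def)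
  have \<Theta>U3: "\<Theta> ` U3 = ball (\<theta> x1) r \<times> ball 0 r"
  proof -
    have "\<Theta> ` U3 = \<Theta> ` U2 \<inter> (ball (\<theta> x1) r \<times> ball 0 r)" unfolding U3_def by blast
    then show ?thesis using r(2) by blast
  qed
  have U3B: "U3 \<subseteq> ?B" "U3 \<subseteq> W" using U2(3) r1(2) by (auto simp: U3_def)
  define U where "U = U1 \<inter> \<psi> -` U3"
  have opU: "open U"
    unfolding U_def using U1(1)
    by (intro continuous_open_preimage opU3 smooth_on_imp_continuous_on) (auto simp: diffeo_on_def)
  have diffU: "diffeo_on U \<psi>" by (rule diffeo_on_subset[OF U1(1) opU]) (simp add: U_def)
  have \<psi>U: "\<psi> ` U = U3"
  proof -
    have "\<psi> ` U = \<psi> ` U1 \<inter> U3" unfolding U_def by blast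
    then show ?thesis using U3B(2) unfolding W_def by blast
  qed
  define \<kappa> where "\<kappa> z = \<Theta> (\<psi> z)" for z
  have \<kappa>: "diffeo_on U \<kappa>" unfolding \<kappa>_def using \<psi>U by (intro diffeo_on_compose[OF diffU U3]) simp
  define P where "P z = frechet_derivative (inv_into U \<kappa>) (at (\<kappa> z))" for z
  \<comment> \<open>The inverse derivative of \<open>\<kappa>\<close> is expressed through that of
    \<open>\<psi>\<close>: the transverse component is kept, and the fibre component
    \<open>u'\<close> solves \<open>\<alpha> (fst (\<psi> z)) u' = u\<close>. This is the
    normalisation that makes \<open>\<Omega>\<close> pair as the inner product.\<close>
  have P: "\<exists>u'. P z (u, v) = D (\<psi> z) (u', v) \<and> \<alpha> (fst (\<psi> z)) u' = u" if z: "z \<in> U" for z u v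
  proof -
    have zV: "z \<in> V" and zU1: "z \<in> U1" using z U1(3) by (auto simp: U_def)
    have w: "\<psi> z \<in> U3" using z by (simp add: U_def)
    then have wB: "\<psi> z \<in> ?B" and wW: "\<psi> z \<in> W" using U3B by auto
    have 1: "(\<psi> has_derivative (\<lambda>u. (h u, DG z u))) (at z)"
      using smooth_on_has_derivative[OF sm\<psi> zV] unfolding d\<psi>[OF zV] .
    have 2: "(\<Theta> has_derivative (\<lambda>p. (\<alpha> (fst (\<psi> z)) (fst p), snd p))) (at (\<psi> z))"
      using smooth_on_has_derivative[OF sm\<Theta> wB] unfolding d\<Theta>[OF wB] .
    have "frechet_derivative \<kappa> (at z) = (\<lambda>u. (\<alpha> (fst (\<psi> z)) (h u), DG z u))"
      using frechet_derivative_at[OF has_derivative_compose[OF 1 2]] unfolding \<kappa>_def by simp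
    then have "(\<alpha> (fst (\<psi> z)) (h (P z (u, v))), DG z (P z (u, v))) = (u, v)"
      using diffeo_on_derivative_inverse(2)[OF \<kappa> z, of "(u, v)"] by (simp add: P_def)
    moreover have "D (\<psi> z) (h (P z (u, v)), DG z (P z (u, v))) = P z (u, v)"
      using D\<psi>[OF wW, of "P z (u, v)"] by (simp add: \<phi>\<psi>[OF zU1])
    ultimately show ?thesis by (intro exI[of _ "h (P z (u, v))"]) simp
  qed
  have slice: "\<psi> z = (fst (\<psi> z), 0)" "fst (\<psi> z) \<in> ball x1 r1" "\<phi> (fst (\<psi> z), 0) = z" if "z \<in> U" "G z = 0" for z
  proof -
    show *: "\<psi> z = (fst (\<psi> z), 0)" using that(2) by (simp add: \<psi>_def)
    show "fst (\<psi> z) \<in> ball x1 r1" using that(1) U3B(1) by (auto simp: U_def)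
    show "\<phi> (fst (\<psi> z), 0) = z" using that(1) \<phi>\<psi>[of z] unfolding *[symmetric] by (simp add: U_def)
  qed
  show thesis
  proof (rule that[OF \<kappa> _ _ r(1)])
    show "U \<subseteq> V" using U1(3) by (auto simp: U_def)
    show "z0 \<in> U" using U1(2) U2(2) r(1) by (simp add: U_def U3_def w0 \<Theta>_def)
    show "\<kappa> ` U = ball (\<theta> x1) r \<times> ball 0 r" 
      using \<Theta>U3 unfolding \<psi>U[symmetric] image_image \<kappa>_def .
    show "snd (\<kappa> z) = G z" for z by (simp add: \<kappa>_def \<Theta>_def \<psi>_def)
    show "\<Omega> z (frechet_derivative (inv_into U \<kappa>) (at (\<kappa> z)) (0, v))
       (frechet_derivative (inv_into U \<kappa>) (at (\<kappa> z)) (u, 0)) = v \<bullet> u" if z: "z \<in> U" "G z = 0" for z u v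
    proof -
      let ?x = "fst (\<psi> z)"
      obtain u1 where u1: "P z (u, 0) = D (\<psi> z) (u1, 0)" "\<alpha> ?x u1 = u" using P[OF z(1)] by blast
      obtain u2 where u2: "P z (0, v) = D (\<psi> z) (u2, v)" "\<alpha> ?x u2 = 0" using P[OF z(1)] by blast
      \<comment> \<open>The lift of a transverse vector could carry a fibre component; injectivity
        of \<open>\<alpha>\<close> excludes it.\<close>
      have "u2 = 0" by (rule \<alpha>_inj[OF slice(2)[OF z] u2(2)])
      then have "\<Omega> z (P z (0, v)) (P z (u, 0)) = \<Omega>' (?x, 0) (0, v) (u1, 0)"
        using slice(1)[OF z] slice(3)[OF z] by (simp add: u1 u2 \<Omega>'_def)
      also have "\<dots> = v \<bullet> u" using \<alpha>_inner[OF slice(2)[OF z], of v u1] u1(2) by simp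
      finally show ?thesis by (simp add: P_def)
    qed
    show "\<Omega> z (frechet_derivative (inv_into U \<kappa>) (at (\<kappa> z)) (u, 0))
       (frechet_derivative (inv_into U \<kappa>) (at (\<kappa> z)) (u', 0)) = 0" if z: "z \<in> U" "G z = 0" for z u u'
    proof -
      let ?x = "fst (\<psi> z)"
      obtain u1 where u1: "P z (u, 0) = D (\<psi> z) (u1, 0)" using P[OF z(1)] by blast
      obtain u2 where u2: "P z (u', 0) = D (\<psi> z) (u2, 0)" using P[OF z(1)] by blast
      have "\<Omega> z (P z (u, 0)) (P z (u', 0)) = \<Omega>' (?x, 0) (u1, 0) (u2, 0)"
        using slice(1)[OF z] slice(3)[OF z] by (simp add: u1 u2 \<Omega>'_def)
      also have "\<dots> = 0" by (rule lagr'[OF in_W[OF slice(2)[OF z]]])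
      finally show ?thesis by (simp add: P_def)
    qed
  qed
qed

section \<open>The quotient by the period lattice\<close>

lemma continuous_map_chart_inv:
  assumes c: "is_chart X c"
  shows "continuous_map (top_of_set (snd c ` fst c)) X (chart_inv c)"
  unfolding continuous_map_def
proof (intro conjI allI impI)
  have dom: "fst c \<subseteq> topspace X" by (rule is_chart_domain[OF c])
  show "chart_inv c \<in> topspace (top_of_set (snd c ` fst c)) \<rightarrow> topspace X"
    using dom inv_into_f_f[OF is_chart_inj[OF c]] by auto
  fix W assume W: "openin X W"
  have "{y \<in> topspace (top_of_set (snd c ` fst c)). chart_inv c y \<in> W} = snd c ` (W \<inter> fst c)"
    using inv_into_f_f[OF is_chart_inj[OF c]] by auto
  moreover have "open (snd c ` (W \<inter> fst c))"
    using W c by (intro is_chart_open_image[OF c]) (auto simp: is_chart_def)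
  ultimately show "openin (top_of_set (snd c ` fst c)) {y \<in> topspace (top_of_set (snd c ` fst c)). chart_inv c y \<in> W}"
    by (auto intro: open_subset)
qed

lemma smooth_on_affine:
  fixes f :: "'a::euclidean_space \<Rightarrow> 'b::euclidean_space" and A :: "'b \<Rightarrow> 'c::euclidean_space"
  assumes "open S" "smooth_on S f" "linear A"
  shows "smooth_on S (\<lambda>x. A (f x) + k)"
  by (rule smooth_on_add[OF assms(1) smooth_on_bounded_linear[OF _ assms(1,2)] smooth_on_const])
    (use assms(3) in \<open>simp add: linear_conv_bounded_linear\<close>)

lemma continuous_on_linear_compose:
  fixes f :: "'a::euclidean_space \<Rightarrow> 'b::euclidean_space" and A :: "'b \<Rightarrow> 'c::euclidean_space"
  assumes "linear A" "continuous_on S f"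
  shows "continuous_on S (\<lambda>x. A (f x))"
  by (rule bounded_linear.continuous_on[OF _ assms(2)]) (use assms(1) in \<open>simp add: linear_conv_bounded_linear\<close>)

text \<open>The maps \<open>E\<close> and \<open>h\<close> present \<open>Y\<close> and the torus as
  quotients of \<open>real ^ 'n\<close> and have the same fibres, so the choices of lifts in
  \<open>f\<close> and \<open>g\<close> are harmless. Smoothness is local, and near any parameter
  \<open>E\<close> is a translation in a chart of \<open>T\<close> while \<open>h\<close> is affine
  in a torus chart.\<close>

theorem translation_atlas_diffeomorphic_torus:
  fixes B T :: "('m, real ^ 'n) chart set"
  assumes man: "smooth_manifold Y B" and T: "translation_atlas Y T" "T \<subseteq> B" and ne: "topspace Y \<noteq> {}"
  shows "diffeomorphic Y B (top_of_set torus) (torus_charts :: (complex ^ 'n, real ^ 'n) chart set)"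
proof -
  interpret M: smooth_manifold Y B by fact
  interpret translation_atlas Y T by fact
  obtain E :: "real ^ 'n \<Rightarrow> 'm" and P Q :: "real ^ 'n \<Rightarrow> real ^ 'n"
    where P: "linear P" and Q: "linear Q" and PQ: "\<And>x. P (Q x) = x" and QP: "\<And>x. Q (P x) = x"
      and E: "\<And>t. develops_at E t" and range_E: "range E = topspace Y"
      and E_eq: "\<And>s t. E s = E t \<longleftrightarrow> (\<forall>i. P (s - t) $ i \<in> \<int>)"
    by (rule translation_atlas_uniformization[OF T(1) ne], rule that)
  define h where "h t = cis_vec ((2 * pi) *\<^sub>R P t)" for t
  \<comment> \<open>A linear lift of \<open>cis_vec\<close> through \<open>h\<close>; it carries
    angles to parameters of \<open>E\<close>.\<close>
  define l where "l y = Q ((1 / (2 * pi)) *\<^sub>R y)" for y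
  have h_l: "h (l y) = cis_vec y" for y by (simp add: h_def l_def PQ)
  have h_eq: "h s = h t \<longleftrightarrow> E s = E t" for s t
  proof -
    have eq: "((2 * pi) * P s $ i - (2 * pi) * P t $ i) / (2 * pi) = P (s - t) $ i" for i
      by (simp add: linear_diff[OF P] diff_divide_distrib)
    have "h s = h t \<longleftrightarrow> (\<forall>i. ((2 * pi) * P s $ i - (2 * pi) * P t $ i) / (2 * pi) \<in> \<int>)"
      by (simp add: h_def cis_vec_def vec_eq_iff cis_eq_iff)
    then show ?thesis unfolding eq E_eq .
  qed
  define f where "f p = h (SOME t. E t = p)" for p
  define g where "g z = E (SOME t. h t = z)" for z
  have f: "f (E t) = h t" for t
    unfolding f_def h_eq by (rule someI[of "\<lambda>t'. E t' = E t"]) (rule refl)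
  have g: "g (h t) = E t" for t
    unfolding g_def h_eq[symmetric] by (rule someI[of "\<lambda>t'. h t' = h t"]) (rule refl)
  have lift: "\<exists>t. p = E t" if "p \<in> topspace Y" for p using that range_E by (metis imageE)
  have lift_torus: "\<exists>t. z = h t" if "z \<in> torus" for z
  proof -
    obtain y where "z = cis_vec y" by (rule torus_cis_vec[OF \<open>z \<in> torus\<close>])
    then show ?thesis using h_l by metis
  qed
  have fg: "f (g z) = z" if "z \<in> torus" for z using lift_torus[OF that] f g by metis
  have gf: "g (f p) = p" if "p \<in> topspace Y" for p using lift[OF that] f g by metis
  have E_top: "E t \<in> topspace Y" for t by (rule develops_at_topspace[OF E])
  have h_torus: "h t \<in> torus" for t unfolding h_def by (rule cis_vec_torus)
  have f_torus: "f p \<in> torus" if p: "p \<in> topspace Y" for p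
  proof -
    obtain t where "p = E t" using lift[OF p] by blast
    then show ?thesis using f h_torus by simp
  qed
  have g_top: "g z \<in> topspace Y" if z: "z \<in> torus" for z
  proof -
    obtain t where "z = h t" using lift_torus[OF z] by blast
    then show ?thesis using g E_top by simp
  qed
  have lin_2piP: "linear (\<lambda>t. (2 * pi) *\<^sub>R P t)"
    using linear_compose_scale_right[OF P] .
  have lin_l: "linear l"
    unfolding l_def using linear_compose[OF linear_scale_self Q, of "1 / (2 * pi)"] by (simp add: o_def)
  have cont_h: "continuous_on UNIV h"
    unfolding h_def
    by (rule continuous_on_compose2[OF continuous_on_cis_vec[of UNIV] continuous_on_linear_compose[OF lin_2piP continuous_on_id]]) auto
  have cont_f: "continuous_map Y (top_of_set torus) f"
    unfolding continuous_map_def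
  proof (intro conjI allI impI)
    show "f \<in> topspace Y \<rightarrow> topspace (top_of_set torus)"
      using f_torus by auto
    fix O' :: "(complex ^ 'n) set" assume "openin (top_of_set torus) O'"
    then obtain N where N: "open N" "O' = torus \<inter> N" by (auto simp: openin_open)
    have "{p \<in> topspace Y. f p \<in> O'} = E ` (h -` N)"
    proof (intro equalityI subsetI)
      fix p assume p: "p \<in> {p \<in> topspace Y. f p \<in> O'}"
      then obtain t where "p = E t" using lift by blast
      then show "p \<in> E ` (h -` N)" using p f N(2) by auto
    next
      fix p assume "p \<in> E ` (h -` N)"
      then show "p \<in> {p \<in> topspace Y. f p \<in> O'}" using f N(2) E_top h_torus by auto
    qed
    moreover have "openin Y (E ` (h -` N))"
      by (rule development_open_image[OF _ E]) (rule open_vimage[OF N(1) cont_h])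
    ultimately show "openin Y {p \<in> topspace Y. f p \<in> O'}" by simp
  qed
  have im_f: "f ` topspace Y = torus"
  proof (intro equalityI subsetI)
    show "z \<in> torus" if "z \<in> f ` topspace Y" for z using that f_torus by auto
    show "z \<in> f ` topspace Y" if "z \<in> torus" for z
      using lift_torus[OF that] f E_top by (metis image_eqI)
  qed
  \<comment> \<open>A continuous bijection from a compact space to a Hausdorff space is open; the
    continuity of \<open>g\<close> is deduced from this.\<close>
  have "homeomorphic_map Y (top_of_set torus) f"
  proof (rule continuous_imp_homeomorphic_map[OF cont_f])
    show "compact_space Y" by (rule compact)
    show "Hausdorff_space (top_of_set torus)" by (intro Hausdorff_space_subtopology Hausdorff_space_euclidean)
    show "f ` topspace Y = topspace (top_of_set torus)" using im_f by simp
    show "inj_on f (topspace Y)" using gf by (metis inj_onI)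
  qed
  then have open_f: "open_map Y (top_of_set torus) f" by (rule homeomorphic_imp_open_map)
  have cont_g: "continuous_map (top_of_set torus) Y g"
    unfolding continuous_map_def
  proof (intro conjI allI impI)
    show "g \<in> topspace (top_of_set torus) \<rightarrow> topspace Y" using g_top by auto
    fix W assume W: "openin Y W"
    have "{z \<in> topspace (top_of_set torus). g z \<in> W} = f ` W"
    proof (intro equalityI subsetI)
      fix z assume "z \<in> {z \<in> topspace (top_of_set torus). g z \<in> W}"
      then show "z \<in> f ` W" using fg[of z] by (intro image_eqI[of _ _ "g z"]) auto
    next
      fix z assume "z \<in> f ` W"
      then obtain p where p: "p \<in> W" "z = f p" by blast
      then have "p \<in> topspace Y" using openin_subset[OF W] by blast
      then show "z \<in> {z \<in> topspace (top_of_set torus). g z \<in> W}" using p gf im_f by auto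
    qed
    then show "openin (top_of_set torus) {z \<in> topspace (top_of_set torus). g z \<in> W}"
      using open_f W unfolding open_map_def by simp
  qed
  have charts_B: "is_chart Y c" if "c \<in> B" for c by (rule M.charts[OF that])
  have smooth_trans: "smooth_on (snd c ` (fst c \<inter> fst d)) (transition c d)" if "c \<in> B" "d \<in> B" for c d
    using M.compatible[OF that] by (simp add: compatible_def)
  have smooth_f: "smooth_on (snd c ` {p \<in> fst c. f p \<in> fst D}) (snd D \<circ> f \<circ> chart_inv c)" (is "smooth_on ?S ?F")
    if c: "c \<in> B" and D: "D \<in> torus_charts" for c and D :: "(complex ^ 'n, real ^ 'n) chart"
  proof (rule smooth_on_local)
    obtain a where a: "D = (cis_vec ` arg_box a, arg_vec a)" using D unfolding torus_charts_eq by blast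
    note cc = charts_B[OF c]
    fix x assume "x \<in> ?S"
    then obtain p where p: "p \<in> fst c" "f p \<in> fst D" "x = snd c p" by blast
    have pY: "p \<in> topspace Y" using is_chart_domain[OF cc] p(1) by blast
    obtain d where d: "d \<in> T" "p \<in> fst d" "is_chart Y d" by (rule chart_at[OF pY])
    have dB: "d \<in> B" using d(1) T(2) by blast
    obtain t0 where t0: "p = E t0" using lift[OF pY] by blast
    obtain e where e: "e > 0" "\<And>t. t \<in> ball t0 e \<Longrightarrow> E t \<in> fst d"
      "\<And>t. t \<in> ball t0 e \<Longrightarrow> snd d (E t) = snd d (E t0) + (t - t0)"
      by (rule develops_atE[OF E d(1) d(2)[unfolded t0]], rule that)
    have lift0: "cis_vec ((2 * pi) *\<^sub>R P t0) \<in> cis_vec ` arg_box a"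
      using p(2) f[of t0] t0 by (simp add: a h_def)
    obtain k N where N: "open N" "(2 * pi) *\<^sub>R P t0 \<in> N"
      "\<And>y. y \<in> N \<Longrightarrow> cis_vec y \<in> cis_vec ` arg_box a \<and> arg_vec a (cis_vec y) = y + k"
      by (rule arg_vec_lift[OF lift0], rule that)
    \<comment> \<open>The local lift through \<open>E\<close>, written in the coordinates of
      \<open>c\<close>: \<open>d\<close> belongs to \<open>T\<close>, so its coordinates differ from
      the parameter of \<open>E\<close> by a constant near \<open>t0\<close>.\<close>
    define \<tau> where "\<tau> y = t0 + (transition c d y - snd d p)" for y
    let ?O = "snd c ` (fst c \<inter> fst d)"
    have opO: "open ?O" by (rule open_chart_image_Int[OF cc d(3)])
    have sm\<tau>: "smooth_on ?O \<tau>"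
      using smooth_on_affine[OF opO smooth_trans[OF c dB] linear_id, of "t0 - snd d p"]
      by (simp add: \<tau>_def[abs_def] algebra_simps)
    let ?N = "ball t0 e \<inter> (\<lambda>t. (2 * pi) *\<^sub>R P t) -` N"
    have opN: "open ?N"
      by (intro open_Int open_ball open_vimage[OF N(1)] continuous_on_linear_compose[OF lin_2piP continuous_on_id])
    let ?W = "?O \<inter> \<tau> -` ?N"
    have opW: "open ?W" by (rule continuous_open_preimage[OF smooth_on_imp_continuous_on[OF sm\<tau>] opO opN])
    have \<tau>x: "\<tau> x = t0" by (simp add: \<tau>_def p(3) transition_apply[OF cc p(1)])
    have xW: "x \<in> ?W" using p d(2) \<tau>x e(1) N(2) by auto
    have eq: "(2 * pi) *\<^sub>R P (\<tau> y) + k = ?F y" if yW: "y \<in> ?W" for y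
    proof -
      obtain q where q: "q \<in> fst c" "q \<in> fst d" "y = snd c q" using yW by blast
      have ty: "\<tau> y \<in> ball t0 e" using yW by blast
      have "snd d (E (\<tau> y)) = snd d q"
        using e(3)[OF ty] by (simp add: \<tau>_def q(3) transition_apply[OF cc q(1)] t0)
      then have "E (\<tau> y) = q" using inj_onD[OF is_chart_inj[OF d(3)]] e(2)[OF ty] q(2) by blast
      then have "f q = h (\<tau> y)" using f by blast
      moreover have "chart_inv c y = q" using inv_into_f_f[OF is_chart_inj[OF cc] q(1)] q(3) by simp
      ultimately have "?F y = arg_vec a (cis_vec ((2 * pi) *\<^sub>R P (\<tau> y)))" by (simp add: a h_def)
      then show ?thesis using N(3) yW by simp
    qed
    have "smooth_on ?W (\<lambda>y. (2 * pi) *\<^sub>R P (\<tau> y) + k)"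
      by (rule smooth_on_affine[OF opW smooth_on_subset[OF sm\<tau>] lin_2piP]) blast
    then have "smooth_on ?W ?F" by (rule smooth_on_congD[OF opW _ eq])
    then have "smooth_on (?S \<inter> ?W) ?F" by (rule smooth_on_subset) blast
    then show "\<exists>T. open T \<and> x \<in> T \<and> smooth_on (?S \<inter> T) ?F" using opW xW by blast
  qed
  have smooth_g: "smooth_on (snd D ` {z \<in> fst D. g z \<in> fst c}) (snd c \<circ> g \<circ> chart_inv D)" (is "smooth_on ?S ?F")
    if c: "c \<in> B" and D: "D \<in> torus_charts" for c and D :: "(complex ^ 'n, real ^ 'n) chart"
  proof (rule smooth_on_local)
    obtain a where a: "D = (cis_vec ` arg_box a, arg_vec a)" using D unfolding torus_charts_eq by blast
    note cc = charts_B[OF c]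
    have invD: "chart_inv D y = cis_vec y" if y: "y \<in> arg_box a" for y
      using inv_into_f_f[OF is_chart_inj[OF torus_chart_is_chart[of a]], of "cis_vec y"] arg_vec_cis_vec[OF y] y
      by (simp add: a)
    have g_cis: "g (cis_vec y) = E (l y)" for y using g[of "l y"] h_l by simp
    fix y0 assume "y0 \<in> ?S"
    then obtain y1 where "y1 \<in> arg_box a" "g (cis_vec y1) \<in> fst c" "y0 = arg_vec a (cis_vec y1)" by (auto simp: a)
    then have y0: "y0 \<in> arg_box a" "E (l y0) \<in> fst c" using arg_vec_cis_vec[of y1 a] g_cis by auto
    define t0 where "t0 = l y0"
    obtain d where d: "d \<in> T" "E t0 \<in> fst d" "is_chart Y d" by (rule chart_at[OF E_top])
    have dB: "d \<in> B" using d(1) T(2) by blast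
    obtain e where e: "e > 0" "\<And>t. t \<in> ball t0 e \<Longrightarrow> E t \<in> fst d"
      "\<And>t. t \<in> ball t0 e \<Longrightarrow> snd d (E t) = snd d (E t0) + (t - t0)"
      by (rule develops_atE[OF E d(1,2)], rule that)
    \<comment> \<open>The coordinates in \<open>d\<close> of \<open>E (l y)\<close>, valid while
      \<open>l y\<close> stays near \<open>t0\<close>.\<close>
    define \<sigma> where "\<sigma> y = l y + (snd d (E t0) - t0)" for y
    let ?O = "snd d ` (fst d \<inter> fst c)"
    have opO: "open ?O" by (rule open_chart_image_Int[OF d(3) cc])
    have sml: "smooth_on S l" for S using lin_l by (intro smooth_on_linear) (simp add: linear_conv_bounded_linear)
    have cont_l: "continuous_on UNIV l" by (rule smooth_on_imp_continuous_on[OF sml])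
    let ?W = "arg_box a \<inter> (l -` ball t0 e \<inter> \<sigma> -` ?O)"
    have opW: "open ?W"
      unfolding \<sigma>_def by (intro open_Int open_arg_box open_vimage open_ball opO cont_l continuous_intros)
    have "\<sigma> y0 = snd d (E t0)" by (simp add: \<sigma>_def t0_def)
    then have y0W: "y0 \<in> ?W" using y0 d(2) e(1) by (auto simp: t0_def)
    have eq: "transition d c (\<sigma> y) = ?F y" if yW: "y \<in> ?W" for y
    proof -
      have ly: "l y \<in> ball t0 e" using yW by blast
      have \<sigma>: "\<sigma> y = snd d (E (l y))" using e(3)[OF ly] by (simp add: \<sigma>_def)
      have "transition d c (\<sigma> y) = snd c (E (l y))"
        unfolding \<sigma> by (rule transition_apply[OF d(3) e(2)[OF ly]])
      then show ?thesis using yW by (simp add: invD g_cis)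
    qed
    have "smooth_on UNIV \<sigma>"
      unfolding \<sigma>_def by (rule smooth_on_add[OF open_UNIV sml smooth_on_const])
    then have sm\<sigma>: "smooth_on ?W \<sigma>" by (rule smooth_on_subset) blast
    have "smooth_on ?W (\<lambda>y. transition d c (\<sigma> y))"
      by (rule smooth_on_compose[where f=\<sigma> and g="transition d c", OF opW opO _ sm\<sigma> smooth_trans[OF dB c]]) blast
    then have "smooth_on ?W ?F" by (rule smooth_on_congD[OF opW _ eq])
    then have "smooth_on (?S \<inter> ?W) ?F" by (rule smooth_on_subset) blast
    then show "\<exists>T. open T \<and> y0 \<in> T \<and> smooth_on (?S \<inter> T) ?F" using opW y0W by blast
  qed
  have "smooth_map Y B (top_of_set torus) torus_charts f" "smooth_map (top_of_set torus) torus_charts Y B g"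
    unfolding smooth_map_def using cont_f cont_g smooth_f smooth_g by blast+
  then show ?thesis
    unfolding diffeomorphic_def using man torus_smooth_manifold gf fg by auto
qed

section \<open>Action charts\<close>

text \<open>The form \<open>\<omega>\<close> is given in the charts of \<open>A\<close>, whereas
  action charts belong only to the maximal atlas. The chain rule makes the transport of tangent
  vectors independent of the intermediate chart.\<close>

lemma (in smooth_manifold) coord_differential_chain:
  assumes c: "c \<in> maximal_atlas X A" and d: "d \<in> maximal_atlas X A" and e: "e \<in> maximal_atlas X A"
    and p: "p \<in> fst c" "p \<in> fst d" "p \<in> fst e"
  shows "coord_differential d (snd e) p (coord_differential c (snd d) p u) = coord_differential c (snd e) p u"
proof -
  note cc = maximal_atlas_is_chart[OF c] and cd = maximal_atlas_is_chart[OF d] and ce = maximal_atlas_is_chart[OF e]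
  have tr: "coord_differential c (snd d) p = frechet_derivative (transition c d) (at (snd c p))"
    "coord_differential d (snd e) p = frechet_derivative (transition d e) (at (snd d p))"
    "coord_differential c (snd e) p = frechet_derivative (transition c e) (at (snd c p))"
    by (simp_all add: coord_differential_def transition_def)
  have 1: "(transition c d has_derivative coord_differential c (snd d) p) (at (snd c p))"
    unfolding tr by (rule smooth_on_has_derivative[OF smooth_transition[OF c d]]) (use p in blast)
  have 2: "(transition d e has_derivative coord_differential d (snd e) p) (at (transition c d (snd c p)))"
    unfolding tr transition_apply[OF cc p(1)]
    by (rule smooth_on_has_derivative[OF smooth_transition[OF d e]]) (use p in blast)
  let ?W = "fst c \<inter> fst d \<inter> fst e"
  have "openin X ?W" using cc cd ce by (intro openin_Int) (auto simp: is_chart_def)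
  then have op: "open (snd c ` ?W)" by (rule is_chart_open_image[OF cc]) blast
  have "((\<lambda>x. transition d e (transition c d x)) has_derivative
      (\<lambda>u. coord_differential d (snd e) p (coord_differential c (snd d) p u))) (at (snd c p))"
    by (rule has_derivative_compose[OF 1 2])
  then have "(transition c e has_derivative
      (\<lambda>u. coord_differential d (snd e) p (coord_differential c (snd d) p u))) (at (snd c p))"
  proof (rule has_derivative_transform_within_open[OF _ op])
    show "snd c p \<in> snd c ` ?W" using p by blast
    show "transition d e (transition c d x) = transition c e x" if "x \<in> snd c ` ?W" for x
      using that by (auto simp: transition_apply[OF cc] transition_apply[OF cd])
  qed
  from fun_cong[OF frechet_derivative_at[OF this], of u] show ?thesis unfolding tr(3) .
qed

text \<open>Nondegeneracy says that \<open>J\<close>, which represents \<open>\<Omega> u\<close> by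
  an inner product, is injective; in finite dimension it is then onto. This gives the definite
  description in \<open>hamiltonian_field\<close> its meaning.\<close>

lemma nondegenerate_representation:
  fixes \<Omega> :: "'a::euclidean_space \<Rightarrow> 'a \<Rightarrow> real"
  assumes bil: "bilinear \<Omega>" and nondeg: "\<And>u. (\<And>v. \<Omega> u v = 0) \<Longrightarrow> u = 0" and l: "linear l"
  shows "\<exists>!u. \<forall>v. \<Omega> u v = l v"
proof -
  have lin: "linear (\<lambda>u. \<Omega> u v)" "linear (\<lambda>v. \<Omega> u v)" for u v using bil unfolding bilinear_def by blast+
  define J where "J u = (\<Sum>b\<in>Basis. \<Omega> u b *\<^sub>R b)" for u
  have J: "linear J"
    unfolding J_def by (intro linearI)
      (simp_all add: linear_add[OF lin(1)] linear_scale[OF lin(1)] scaleR_add_left sum.distrib scaleR_sum_right)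
  have expand: "k v = (\<Sum>b\<in>Basis. k b *\<^sub>R b) \<bullet> v" if "linear k" for k :: "'a \<Rightarrow> real" and v
    using linear_eq_sum_Basis[OF that, of v] by (simp add: inner_sum_left inner_commute[of v] mult.commute)
  have \<Omega>J: "\<Omega> u v = J u \<bullet> v" for u v unfolding J_def by (rule expand[OF lin(2)])
  have "inj J"
    unfolding linear_injective_0[OF J] using nondeg \<Omega>J by auto
  then have "surj J" by (rule linear_injective_imp_surjective[OF J]) simp
  from surjD[OF this, of "\<Sum>b\<in>Basis. l b *\<^sub>R b"]
  obtain u where u: "J u = (\<Sum>b\<in>Basis. l b *\<^sub>R b)" by auto
  show ?thesis
  proof (rule ex1I[of _ u])
    show "\<forall>v. \<Omega> u v = l v" unfolding \<Omega>J u by (intro allI expand[OF l, symmetric])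
    fix u' assume u': "\<forall>v. \<Omega> u' v = l v"
    have "u' - u = 0"
      by (rule nondeg) (use u' \<open>\<forall>v. \<Omega> u v = l v\<close> in \<open>simp add: linear_diff[OF lin(1)]\<close>)
    then show "u' = u" by simp
  qed
qed

text \<open>A chart \<open>(\<theta>, F - c)\<close> in which \<open>\<omega>\<close> takes the Darboux values on the fibre over \<open>c\<close>, apart from
  the values on pairs of vectors transverse to the fibre.\<close>

definition action_chart :: "'m topology \<Rightarrow> ('m, (real ^ 'n) \<times> (real ^ 'n)) chart set \<Rightarrow>
    ('m, (real ^ 'n) \<times> (real ^ 'n)) local_form2 \<Rightarrow> ('m \<Rightarrow> real ^ 'n) \<Rightarrow> real ^ 'n \<Rightarrow>
    ('m, (real ^ 'n) \<times> (real ^ 'n)) chart \<Rightarrow> bool" where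
  "action_chart X A \<omega> F c d \<longleftrightarrow> d \<in> maximal_atlas X A \<and>
     (\<exists>x r. r > 0 \<and> snd d ` fst d = ball x r \<times> ball 0 r) \<and>
     (\<forall>q\<in>fst d. snd (snd d q) = F q - c) \<and>
     (\<forall>q\<in>fst d. F q = c \<longrightarrow> (\<exists>a\<in>A. q \<in> fst a \<and>
        (\<forall>u v. \<omega> a q (coord_differential d (snd a) q (0, v)) (coord_differential d (snd a) q (u, 0)) = v \<bullet> u) \<and>
        (\<forall>u u'. \<omega> a q (coord_differential d (snd a) q (u, 0)) (coord_differential d (snd a) q (u', 0)) = 0)))"

context integrable_system
begin

lemma F_smooth:
  assumes "a \<in> A"
  shows "smooth_on (snd a ` fst a) (\<lambda>z. F (chart_inv a z))"
proof (rule smooth_on_vec)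
  show "open (snd a ` fst a)" using charts[OF assms] by (simp add: is_chart_def)
  show "smooth_on (snd a ` fst a) (\<lambda>z. F (chart_inv a z) $ i)" for i
    using smooth_functions[of i] assms by (simp add: smooth_map_def euclidean_charts_def o_def)
qed

lemma coord_differential_component:
  assumes a: "a \<in> A" "p \<in> fst a"
  shows "coord_differential a (\<lambda>q. F q $ i) p v =
    frechet_derivative (\<lambda>z. F (chart_inv a z)) (at (snd a p)) v $ i"
proof -
  have "snd a p \<in> snd a ` fst a" using a(2) by blast
  then have "(\<lambda>v. frechet_derivative (\<lambda>z. F (chart_inv a z)) (at (snd a p)) v $ i) =
      frechet_derivative (\<lambda>z. F (chart_inv a z) $ i) (at (snd a p))"
    by (intro frechet_derivative_at bounded_linear.has_derivative[OF bounded_linear_vec_nth]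
        smooth_on_has_derivative[OF F_smooth[OF a(1)]])
  from fun_cong[OF this, of v] show ?thesis by (simp add: coord_differential_def o_def)
qed

lemma hamiltonian_field_property:
  assumes a: "a \<in> A" "p \<in> fst a"
  shows "\<omega> a p (hamiltonian_field \<omega> (\<lambda>q. F q $ i) a p) v =
    - (frechet_derivative (\<lambda>z. F (chart_inv a z)) (at (snd a p)) v $ i)"
proof -
  let ?D = "frechet_derivative (\<lambda>z. F (chart_inv a z)) (at (snd a p))"
  have "snd a p \<in> snd a ` fst a" using a(2) by blast
  then have D: "linear ?D" by (rule has_derivative_linear[OF smooth_on_has_derivative[OF F_smooth[OF a(1)]]])
  have "linear (\<lambda>v. - (?D v $ i))"
    by (rule linearI) (simp_all add: linear_add[OF D] linear_scale[OF D])
  from nondegenerate_representation[OF bilinear[OF a] nondegenerate[OF a] this]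
  have "\<exists>!u. \<forall>v. \<omega> a p u v = - (?D v $ i)" by blast
  from theI'[OF this] show ?thesis
    unfolding hamiltonian_field_def coord_differential_component[OF a] by blast
qed

text \<open>A nonzero determinant makes the matrix of the differentials on the vectors
  \<open>v j\<close> invertible, so every value is attained already on a combination of these
  vectors.\<close>

lemma regular_point_surj:
  assumes "regular_point A F p"
  obtains a where "a \<in> A" "p \<in> fst a" "surj (frechet_derivative (\<lambda>z. F (chart_inv a z)) (at (snd a p)))"
proof -
  obtain a v where a: "a \<in> A" "p \<in> fst a" and v: "wedge_differentials F a p v \<noteq> 0"
    using assms by (auto simp: regular_point_def)
  let ?D = "frechet_derivative (\<lambda>z. F (chart_inv a z)) (at (snd a p))"
  have "snd a p \<in> snd a ` fst a" using a(2) by blast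
  then have D: "linear ?D" by (rule has_derivative_linear[OF smooth_on_has_derivative[OF F_smooth[OF a(1)]]])
  let ?M = "(\<chi> i j. ?D (v j) $ i) :: real ^ 'n ^ 'n"
  have "det ?M \<noteq> 0" using v by (simp add: wedge_differentials_def coord_differential_component[OF a])
  then obtain M' where M': "?M ** M' = mat 1" unfolding invertible_det_nz[symmetric] invertible_def by blast
  have "\<exists>u. y = ?D u" for y
  proof -
    define x where "x = M' *v y"
    have "?M *v x = y" by (simp add: x_def matrix_vector_mul_assoc M')
    moreover have "?M *v x = ?D (\<Sum>j\<in>UNIV. x $ j *\<^sub>R v j)"
      by (simp add: vec_eq_iff matrix_vector_mult_def linear_sum[OF D] linear_scale[OF D] mult.commute)
    ultimately have "y = ?D (\<Sum>j\<in>UNIV. x $ j *\<^sub>R v j)" by simp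
    then show ?thesis by blast
  qed
  then have "surj ?D" unfolding surj_def by blast
  then show thesis using that a by blast
qed

text \<open>The system is read in a chart \<open>a\<close> of \<open>A\<close> around
  \<open>p\<close>, where \<open>local_action_coordinates\<close> applies to the level 0 of
  \<open>G\<close>; composing with \<open>\<kappa>\<close> stays within the maximal atlas.\<close>

lemma action_chart_exists:
  assumes "F p = c" "regular_point A F p"
  obtains d where "action_chart X A \<omega> F c d" "p \<in> fst d"
proof -
  obtain a where a: "a \<in> A" "p \<in> fst a" and surj: "surj (frechet_derivative (\<lambda>z. F (chart_inv a z)) (at (snd a p)))"
    by (rule regular_point_surj[OF assms(2)], rule that)
  note ca = charts[OF a(1)]
  have amax: "a \<in> maximal_atlas X A" using atlas_subset_maximal_atlas a(1) by blast
  define V where "V = snd a ` fst a"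
  have V: "open V" "snd a p \<in> V" using ca a(2) by (auto simp: is_chart_def V_def)
  have inv: "chart_inv a z \<in> fst a" "snd a (chart_inv a z) = z" if "z \<in> V" for z
    using that by (auto simp: V_def inv_into_into f_inv_into_f)
  have inv': "chart_inv a (snd a q) = q" if "q \<in> fst a" for q
    by (rule inv_into_f_f[OF is_chart_inj[OF ca] that])
  define G where "G z = F (chart_inv a z) + (- c)" for z
  define \<Omega> where "\<Omega> z = \<omega> a (chart_inv a z)" for z
  have smG: "smooth_on V G"
    unfolding G_def V_def
    by (rule smooth_on_add[OF V(1)[unfolded V_def] F_smooth[OF a(1)] smooth_on_const])
  have DG: "frechet_derivative G (at z) = frechet_derivative (\<lambda>z. F (chart_inv a z)) (at z)" if "z \<in> V" for z
  proof -
    have "(G has_derivative (\<lambda>v. frechet_derivative (\<lambda>z. F (chart_inv a z)) (at z) v + 0)) (at z)"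
      unfolding G_def
      by (rule has_derivative_add[OF smooth_on_has_derivative[OF F_smooth[OF a(1)] that[unfolded V_def]] has_derivative_const])
    from frechet_derivative_at[OF this] show ?thesis by simp
  qed
  obtain U \<kappa> x r where U: "diffeo_on U \<kappa>" "U \<subseteq> V" "snd a p \<in> U" "r > 0" "\<kappa> ` U = ball x r \<times> ball 0 r"
    and sndk: "\<And>z. z \<in> U \<Longrightarrow> snd (\<kappa> z) = G z"
    and \<Omega>1: "\<And>z u v. z \<in> U \<Longrightarrow> G z = 0 \<Longrightarrow> \<Omega> z (frechet_derivative (inv_into U \<kappa>) (at (\<kappa> z)) (0, v))
       (frechet_derivative (inv_into U \<kappa>) (at (\<kappa> z)) (u, 0)) = v \<bullet> u"
    and \<Omega>2: "\<And>z u u'. z \<in> U \<Longrightarrow> G z = 0 \<Longrightarrow> \<Omega> z (frechet_derivative (inv_into U \<kappa>) (at (\<kappa> z)) (u, 0))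
       (frechet_derivative (inv_into U \<kappa>) (at (\<kappa> z)) (u', 0)) = 0"
  proof (rule local_action_coordinates[of V "snd a p" G \<Omega> "\<lambda>z i. hamiltonian_field \<omega> (\<lambda>q. F q $ i) a (chart_inv a z)"])
    show "open V" "snd a p \<in> V" "smooth_on V G" by fact+
    show "G (snd a p) = 0" using assms(1) by (simp add: G_def inv'[OF a(2)])
    show "surj (frechet_derivative G (at (snd a p)))" using surj by (simp add: DG[OF V(2)])
    show "bilinear (\<Omega> z)" if "z \<in> V" for z unfolding \<Omega>_def by (rule bilinear[OF a(1) inv(1)[OF that]])
    show "\<Omega> z u u = 0" if "z \<in> V" for z u unfolding \<Omega>_def by (rule alternating[OF a(1) inv(1)[OF that]])
    show "u = 0" if "z \<in> V" "\<And>v. \<Omega> z u v = 0" for z u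
      by (rule nondegenerate[OF a(1) inv(1)[OF that(1)]]) (rule that(2)[unfolded \<Omega>_def])
    show "smooth_on V (\<lambda>z. \<Omega> z u v)" for u v unfolding \<Omega>_def V_def by (rule smooth[OF a(1)])
    show "frechet_derivative (\<lambda>z. \<Omega> z b c) (at z) a' - frechet_derivative (\<lambda>z. \<Omega> z a' c) (at z) b
        + frechet_derivative (\<lambda>z. \<Omega> z a' b) (at z) c = 0" if "z \<in> V" for z a' b c
      using closed[OF a(1) inv(1)[OF that], of a' b c]
      unfolding exterior_derivative2_def coord_differential_def inv(2)[OF that] o_def \<Omega>_def .
    show "\<Omega> z (hamiltonian_field \<omega> (\<lambda>q. F q $ i) a (chart_inv a z)) v = - (frechet_derivative G (at z) v $ i)"
      if "z \<in> V" for z i v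
      using hamiltonian_field_property[OF a(1) inv(1)[OF that], of i v]
      unfolding inv(2)[OF that] DG[OF that] \<Omega>_def .
    show "\<Omega> z (hamiltonian_field \<omega> (\<lambda>q. F q $ i) a (chart_inv a z)) (hamiltonian_field \<omega> (\<lambda>q. F q $ j) a (chart_inv a z)) = 0"
      if "z \<in> V" for z i j
      using commuting[OF a(1) inv(1)[OF that], of i j] unfolding poisson_bracket_def \<Omega>_def .
  qed (rule that)
  define d where "d = ({q \<in> fst a. snd a q \<in> U}, \<kappa> \<circ> snd a)"
  have dmax: "d \<in> maximal_atlas X A"
    unfolding d_def by (rule maximal_atlas_diffeo[OF amax U(1)]) (use U(2) V_def in simp)
  note cd = maximal_atlas_is_chart[OF dmax]
  have d_a: "q \<in> fst a" "snd a q \<in> U" "snd d q = \<kappa> (snd a q)" if "q \<in> fst d" for q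
    using that by (auto simp: d_def)
  have "snd a ` fst d = U"
    using U(2) by (auto simp: d_def V_def)
  moreover have "snd d ` fst d = \<kappa> ` snd a ` fst d" by (simp add: d_def image_comp)
  ultimately have img: "snd d ` fst d = \<kappa> ` U" by simp
  have op: "open (\<kappa> ` U)" and inj: "inj_on \<kappa> U" using U(1) by (auto simp: diffeo_on_def)
  \<comment> \<open>On an open set the change of coordinates from \<open>d\<close> to
    \<open>a\<close> is the inverse of \<open>\<kappa>\<close>, so the normalisation proved for
    \<open>\<kappa>\<close> is the one demanded of \<open>d\<close>.\<close>
  have P: "coord_differential d (snd a) q = frechet_derivative (inv_into U \<kappa>) (at (\<kappa> (snd a q)))" if q: "q \<in> fst d" for q
    unfolding coord_differential_def d_a(3)[OF q]
  proof (rule frechet_derivative_cong_open[OF op])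
    show "\<kappa> (snd a q) \<in> \<kappa> ` U" using d_a(2)[OF q] by blast
    fix y assume "y \<in> \<kappa> ` U"
    then obtain q' where q': "q' \<in> fst d" "y = snd d q'" using img by blast
    have "chart_inv d y = q'" unfolding q'(2) by (rule inv_into_f_f[OF is_chart_inj[OF cd] q'(1)])
    moreover have "inv_into U \<kappa> y = snd a q'"
      unfolding q'(2) d_a(3)[OF q'(1)] by (rule inv_into_f_f[OF inj d_a(2)[OF q'(1)]])
    ultimately show "(snd a \<circ> chart_inv d) y = inv_into U \<kappa> y" by simp
  qed
  have G_F: "G (snd a q) = F q - c" if "q \<in> fst a" for q by (simp add: G_def inv'[OF that])
  have "action_chart X A \<omega> F c d"
    unfolding action_chart_def
  proof (intro conjI ballI impI)
    show "d \<in> maximal_atlas X A" by (rule dmax)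
    show "\<exists>x r. r > 0 \<and> snd d ` fst d = ball x r \<times> ball 0 r" using U(4,5) img by metis
    show "snd (snd d q) = F q - c" if "q \<in> fst d" for q
      using sndk[OF d_a(2)[OF that]] d_a(3)[OF that] G_F[OF d_a(1)[OF that]] by simp
    fix q assume q: "q \<in> fst d" "F q = c"
    have G0: "G (snd a q) = 0" using G_F[OF d_a(1)[OF q(1)]] q(2) by simp
    have \<Omega>q: "\<Omega> (snd a q) = \<omega> a q" by (simp add: \<Omega>_def inv'[OF d_a(1)[OF q(1)]])
    show "\<exists>a\<in>A. q \<in> fst a \<and>
        (\<forall>u v. \<omega> a q (coord_differential d (snd a) q (0, v)) (coord_differential d (snd a) q (u, 0)) = v \<bullet> u) \<and>
        (\<forall>u u'. \<omega> a q (coord_differential d (snd a) q (u, 0)) (coord_differential d (snd a) q (u', 0)) = 0)"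
      using \<Omega>1[OF d_a(2)[OF q(1)] G0] \<Omega>2[OF d_a(2)[OF q(1)] G0] d_a(1)[OF q(1)]
      unfolding \<Omega>q P[OF q(1), symmetric] by (intro bexI[OF _ a(1)] conjI allI)
  qed
  moreover have "p \<in> fst d" using a(2) U(3) by (simp add: d_def)
  ultimately show thesis by (rule that)
qed

text \<open>Both charts have \<open>F - c\<close> as second component, so the transition sends
  \<open>(u, 0)\<close> to some \<open>(m, 0)\<close> and \<open>(0, v)\<close> to some
  \<open>(n, v)\<close>. Evaluating \<open>\<omega>\<close> in both charts gives
  \<open>v \<bullet> u = v \<bullet> m\<close>, because the contribution of \<open>n\<close> is a
  pairing of two fibre vectors and vanishes.\<close>

lemma action_chart_transition_derivative:
  assumes d: "action_chart X A \<omega> F c d" and d': "action_chart X A \<omega> F c d'"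
    and q: "q \<in> fst d" "q \<in> fst d'" "F q = c"
  shows "fst (coord_differential d (snd d') q (u, 0)) = u"
proof -
  have dmax: "d \<in> maximal_atlas X A" and d'max: "d' \<in> maximal_atlas X A"
    using d d' by (auto simp: action_chart_def)
  note cd = maximal_atlas_is_chart[OF dmax] and cd' = maximal_atlas_is_chart[OF d'max]
  let ?T = "coord_differential d (snd d') q"
  obtain a where a: "a \<in> A" "q \<in> fst a"
    and da: "\<And>u v. \<omega> a q (coord_differential d (snd a) q (0, v)) (coord_differential d (snd a) q (u, 0)) = v \<bullet> u"
    using d q unfolding action_chart_def by blast
  obtain b where b: "b \<in> A" "q \<in> fst b"
    and db: "\<And>u v. \<omega> b q (coord_differential d' (snd b) q (0, v)) (coord_differential d' (snd b) q (u, 0)) = v \<bullet> u"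
      "\<And>u u'. \<omega> b q (coord_differential d' (snd b) q (u, 0)) (coord_differential d' (snd b) q (u', 0)) = 0"
    using d' q unfolding action_chart_def by blast
  have amax: "a \<in> maximal_atlas X A" and bmax: "b \<in> maximal_atlas X A"
    using a b atlas_subset_maximal_atlas by auto
  let ?P = "coord_differential d' (snd b) q"
  have pull: "\<omega> a q (coord_differential d (snd a) q u) (coord_differential d (snd a) q v) = \<omega> b q (?P (?T u)) (?P (?T v))" for u v
    using change_of_chart[OF a(1) b(1), of q] a(2) b(2)
      coord_differential_chain[OF dmax amax bmax q(1) a(2) b(2)]
      coord_differential_chain[OF dmax d'max bmax q(1,2) b(2)] by simp
  have op: "open (snd d ` (fst d \<inter> fst d'))" by (rule open_chart_image_Int[OF cd cd'])
  have xq: "snd d q \<in> snd d ` (fst d \<inter> fst d')" using q by blast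
  have dT: "(transition d d' has_derivative ?T) (at (snd d q))"
    using smooth_on_has_derivative[OF smooth_transition[OF dmax d'max] xq]
    by (simp add: coord_differential_def transition_def)
  have sndT: "snd (?T w) = snd w" for w
  proof -
    have 1: "((\<lambda>x. snd (transition d d' x)) has_derivative (\<lambda>w. snd (?T w))) (at (snd d q))"
      by (rule has_derivative_snd[OF dT])
    have "((\<lambda>x. snd x) has_derivative (\<lambda>w. snd (?T w))) (at (snd d q))"
    proof (rule has_derivative_transform_within_open[OF 1 op xq])
      fix x assume "x \<in> snd d ` (fst d \<inter> fst d')"
      then obtain q' where q': "q' \<in> fst d" "q' \<in> fst d'" "x = snd d q'" by blast
      have "snd (snd d' q') = F q' - c" "snd (snd d q') = F q' - c"
        using d d' q' unfolding action_chart_def by blast+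
      then show "snd (transition d d' x) = snd x" using transition_apply[OF cd q'(1)] q'(3) by simp
    qed
    from fun_cong[OF has_derivative_unique[OF this has_derivative_snd[OF has_derivative_ident]]]
    show ?thesis .
  qed
  have linP: "linear ?P"
  proof -
    have "snd d' q \<in> snd d' ` (fst d' \<inter> fst b)" using q(2) b(2) by blast
    from has_derivative_linear[OF smooth_on_has_derivative[OF smooth_transition[OF d'max bmax] this]]
    show ?thesis by (simp add: coord_differential_def transition_def)
  qed
  have linb: "linear (\<lambda>w. \<omega> b q w w')" for w' using bilinear[OF b] unfolding bilinear_def by blast
  define m where "m = fst (?T (u, 0))"
  have Tu: "?T (u, 0) = (m, 0)" using sndT[of "(u, 0)"] by (simp add: m_def prod_eq_iff)
  have "v \<bullet> u = v \<bullet> m" for v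
  proof -
    define n where "n = fst (?T (0, v))"
    have Tv: "?T (0, v) = (n, 0) + (0, v)" using sndT[of "(0, v)"] by (simp add: n_def prod_eq_iff)
    have "v \<bullet> u = \<omega> b q (?P ((n, 0) + (0, v))) (?P (m, 0))"
      using da[of v u] unfolding pull Tu Tv by simp
    also have "\<dots> = \<omega> b q (?P (n, 0)) (?P (m, 0)) + \<omega> b q (?P (0, v)) (?P (m, 0))"
      by (simp only: linear_add[OF linP] linear_add[OF linb])
    also have "\<dots> = v \<bullet> m" unfolding db by simp
    finally show ?thesis .
  qed
  then have "m = u" by (metis vector_eq_ldot)
  then show ?thesis by (simp add: m_def)
qed

end

text \<open>The part of the fibre in the chart is the image of \<open>ball x r \<times> {0}\<close>,
  hence connected; as it meets \<open>L\<close> in \<open>p\<close>, it lies inside this component.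
  So within the chart domain, \<open>L\<close> coincides with the fibre.\<close>

lemma action_chart_slice:
  fixes A :: "('m, (real ^ 'n) \<times> (real ^ 'n)) chart set"
  assumes man: "smooth_manifold X A" and d: "action_chart X A \<omega> F c d"
    and L: "L \<in> connected_components_of (subtopology X {p \<in> topspace X. F p = c})"
    and p: "p \<in> fst d" "p \<in> L"
  shows "slice_chart X A L d"
proof -
  interpret smooth_manifold X A by fact
  have dmax: "d \<in> maximal_atlas X A" using d by (simp add: action_chart_def)
  note cd = maximal_atlas_is_chart[OF dmax]
  have sndd: "snd (snd d q) = F q - c" if "q \<in> fst d" for q using d that unfolding action_chart_def by blast
  obtain x r where r: "r > 0" "snd d ` fst d = ball x r \<times> ball 0 r" using d unfolding action_chart_def by blast
  have LF: "L \<subseteq> {p \<in> topspace X. F p = c}" using connected_components_of_subset[OF L] by simp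
  let ?Q = "chart_inv d ` (ball x r \<times> {0})"
  have Q: "?Q = {q \<in> fst d. F q = c}"
  proof (intro equalityI subsetI)
    fix q assume "q \<in> ?Q"
    then obtain y where y: "y \<in> ball x r" "q = chart_inv d (y, 0)" by auto
    have "(y, 0) \<in> snd d ` fst d" using y(1) r by simp
    then have "q \<in> fst d" "snd d q = (y, 0)" unfolding y(2) by (auto intro: inv_into_into f_inv_into_f)
    then show "q \<in> {q \<in> fst d. F q = c}" using sndd[of q] by simp
  next
    fix q assume q: "q \<in> {q \<in> fst d. F q = c}"
    then have "snd (snd d q) = 0" using sndd by simp
    moreover have "snd d q \<in> ball x r \<times> ball 0 r" using q r(2) by blast
    ultimately have "snd d q \<in> ball x r \<times> {0}" by (simp add: mem_Times_iff)
    moreover have "chart_inv d (snd d q) = q" using q inv_into_f_f[OF is_chart_inj[OF cd]] by blast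
    ultimately show "q \<in> ?Q" by (metis image_eqI)
  qed
  have "connected (ball x r \<times> {0 :: real ^ 'n})" by (intro connected_Times connected_ball connected_sing)
  then have "connectedin (top_of_set (snd d ` fst d)) (ball x r \<times> {0})"
    using r by (auto simp: connectedin_subtopology)
  then have "connectedin X ?Q" by (rule connectedin_continuous_map_image[OF continuous_map_chart_inv[OF cd]])
  then have "connectedin (subtopology X {p \<in> topspace X. F p = c}) ?Q"
    unfolding connectedin_subtopology using is_chart_domain[OF cd] Q by auto
  moreover have "\<not> disjnt L ?Q" using p LF Q by (auto simp: disjnt_iff)
  ultimately have "?Q \<subseteq> L" by (rule connected_components_of_maximal[OF L])
  then have QL: "q \<in> L \<longleftrightarrow> snd (snd d q) = 0" if "q \<in> fst d" for q
    using that LF sndd[OF that] Q by auto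
  have "snd d ` (fst d \<inter> L) = snd d ` fst d \<inter> UNIV \<times> {0}"
  proof (intro equalityI subsetI)
    show "y \<in> snd d ` fst d \<inter> UNIV \<times> {0}" if "y \<in> snd d ` (fst d \<inter> L)" for y
      using that QL by (auto simp: mem_Times_iff)
    show "y \<in> snd d ` (fst d \<inter> L)" if "y \<in> snd d ` fst d \<inter> UNIV \<times> {0}" for y
      using that QL by (auto simp: mem_Times_iff)
  qed
  then show ?thesis using dmax by (simp add: slice_chart_def)
qed

text \<open>Along the fibre the transition has the identity as derivative, so the difference
  \<open>\<tau>\<close> of the fibre coordinates has derivative zero. It is constant on a ball, and
  the points of \<open>L\<close> over this ball form the required neighbourhood.\<close>

lemma (in integrable_system) action_chart_translation:
  assumes d: "action_chart X A \<omega> F c d" and d': "action_chart X A \<omega> F c d'"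
    and L: "L \<subseteq> {p \<in> topspace X. F p = c}"
    and p: "p \<in> fst d" "p \<in> fst d'" "p \<in> L"
  shows "\<exists>W. openin (subtopology X L) W \<and> p \<in> W \<and> W \<subseteq> (fst d \<inter> L) \<inter> (fst d' \<inter> L) \<and>
    (\<forall>q\<in>W. fst (snd d' q) - fst (snd d q) = fst (snd d' p) - fst (snd d p))"
proof -
  have dmax: "d \<in> maximal_atlas X A" and d'max: "d' \<in> maximal_atlas X A"
    using d d' by (auto simp: action_chart_def)
  note cd = maximal_atlas_is_chart[OF dmax] and cd' = maximal_atlas_is_chart[OF d'max]
  have sndd: "snd (snd d q) = F q - c" if "q \<in> fst d" for q using d that unfolding action_chart_def by blast
  let ?O = "snd d ` (fst d \<inter> fst d')"
  have opO: "open ?O" by (rule open_chart_image_Int[OF cd cd'])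
  let ?S = "(\<lambda>x. (x, 0)) -` ?O"
  have opS: "open ?S" by (intro open_vimage opO continuous_intros)
  define x0 where "x0 = fst (snd d p)"
  have on_L: "snd d q = (fst (snd d q), 0)" if "q \<in> fst d" "q \<in> L" for q
  proof -
    have "F q = c" using that(2) L by blast
    then show ?thesis using sndd[OF that(1)] by (simp add: prod_eq_iff)
  qed
  have "(x0, 0) \<in> ?O" using p on_L[OF p(1,3)] unfolding x0_def by auto
  then obtain e where e: "e > 0" "ball x0 e \<subseteq> ?S" using opS open_contains_ball by (metis vimageI)
  define \<tau> where "\<tau> x = fst (transition d d' (x, 0)) - x" for x
  have d\<tau>: "(\<tau> has_derivative (\<lambda>u. 0)) (at x)" if "x \<in> ball x0 e" for x
  proof -
    have "(x, 0) \<in> ?O" using that e(2) by blast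
    then obtain q where q: "q \<in> fst d" "q \<in> fst d'" "(x, 0) = snd d q" by blast
    have "snd (snd d q) = 0" unfolding q(3)[symmetric] by simp
    then have "F q = c" using sndd[OF q(1)] by simp
    note T = action_chart_transition_derivative[OF d d' q(1,2) this]
    have "((\<lambda>x. (x, 0 :: real ^ 'n)) has_derivative (\<lambda>u. (u, 0))) (at x)"
      by (intro has_derivative_Pair has_derivative_ident has_derivative_const)
    from has_derivative_compose[OF this smooth_on_has_derivative[OF smooth_transition[OF dmax d'max] \<open>(x, 0) \<in> ?O\<close>]]
    have "((\<lambda>x. transition d d' (x, 0)) has_derivative (\<lambda>u. coord_differential d (snd d') q (u, 0))) (at x)"
      by (simp add: coord_differential_def transition_def q(3))
    from has_derivative_diff[OF has_derivative_fst[OF this] has_derivative_ident]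
    show ?thesis unfolding \<tau>_def T by simp
  qed
  have "\<exists>k. \<forall>x\<in>ball x0 e. \<tau> x = k"
    by (rule has_derivative_zero_constant[OF convex_ball has_derivative_at_withinI[OF d\<tau>]])
  then obtain k where k: "\<And>x. x \<in> ball x0 e \<Longrightarrow> \<tau> x = k" by blast
  let ?W = "{q \<in> fst d. snd d q \<in> ball x0 e \<times> UNIV} \<inter> fst d'"
  have const: "fst (snd d' q) - fst (snd d q) = k" if "q \<in> ?W \<inter> L" for q
  proof -
    have q: "q \<in> fst d" "q \<in> L" "fst (snd d q) \<in> ball x0 e" using that by (auto simp: mem_Times_iff)
    have "transition d d' (fst (snd d q), 0) = snd d' q"
      using on_L[OF q(1,2)] transition_apply[OF cd q(1), of d'] by simp
    then show ?thesis using k[OF q(3)] by (simp add: \<tau>_def)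
  qed
  have "openin X {q \<in> fst d. snd d q \<in> ball x0 e \<times> UNIV}"
    by (intro is_chart_open_preimage[OF cd] open_Times open_ball open_UNIV)
  then have "openin X ?W" using cd' by (intro openin_Int) (auto simp: is_chart_def)
  then have "openin (subtopology X L) (?W \<inter> L)" unfolding openin_subtopology by blast
  moreover have pW: "p \<in> ?W \<inter> L" using p e(1) by (simp add: x0_def mem_Times_iff)
  ultimately show ?thesis using const const[OF pW] by (intro exI[of _ "?W \<inter> L"]) auto
qed

section \<open>The translation atlas on a compact regular component of a fibre\<close>

theorem theorem3p5:
  fixes X :: "'m topology"
    and A :: "('m, (real ^ 'n) \<times> (real ^ 'n)) chart set"
    and \<omega> :: "('m, (real ^ 'n) \<times> (real ^ 'n)) local_form2"
    and F :: "'m \<Rightarrow> real ^ 'n"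
    and c :: "real ^ 'n"
    and L :: "'m set"
  assumes "symplectic_manifold X A \<omega>"
    and "integrable_system X A \<omega> F"
    and "L \<in> connected_components_of (subtopology X {p \<in> topspace X. F p = c})"
    and "compactin X L"
    and "\<And>p. p \<in> L \<Longrightarrow> regular_point A F p"
  shows "diffeomorphic (subtopology X L) (slice_charts X A L)
           (top_of_set torus) (torus_charts :: (complex ^ 'n, real ^ 'n) chart set)"
proof -
  interpret integrable_system X A \<omega> F by fact
  have man: "smooth_manifold X A" by unfold_locales
  have LF: "L \<subseteq> {p \<in> topspace X. F p = c}" using connected_components_of_subset[OF assms(3)] by simp
  then have LX: "L \<subseteq> topspace X" by blast
  have top: "topspace (subtopology X L) = L" using LX by auto
  have cover: "\<exists>d. action_chart X A \<omega> F c d \<and> p \<in> fst d" if pL: "p \<in> L" for p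
  proof -
    have "F p = c" using LF pL by blast
    from action_chart_exists[OF this assms(5)[OF pL]] show ?thesis by blast
  qed
  \<comment> \<open>Charts that miss \<open>L\<close> are left out: the coordinate image of an
    action chart always meets height 0, so such a chart is not a slice chart for
    \<open>L\<close>.\<close>
  let ?T = "{restrict_chart L d |d. action_chart X A \<omega> F c d \<and> fst d \<inter> L \<noteq> {}}"
  have slice: "slice_chart X A L d" if d: "action_chart X A \<omega> F c d" "fst d \<inter> L \<noteq> {}" for d
  proof -
    obtain p where "p \<in> fst d" "p \<in> L" using d(2) by blast
    then show ?thesis by (rule action_chart_slice[OF man d(1) assms(3)])
  qed
  interpret S: covered_by_slices X A L
  proof
    show "L \<subseteq> topspace X" by (rule LX)
    fix p assume p: "p \<in> L"
    then obtain d where d: "action_chart X A \<omega> F c d" "p \<in> fst d" using cover by blast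
    moreover have "fst d \<inter> L \<noteq> {}" using d(2) p by blast
    ultimately show "\<exists>c. slice_chart X A L c \<and> p \<in> fst c" using slice by blast
  qed
  have "translation_atlas (subtopology X L) ?T"
  proof
    show "compact_space (subtopology X L)" by (rule compact_space_subtopology[OF assms(4)])
    have "connectedin X L"
      using connectedin_connected_components_of[OF assms(3)] unfolding connectedin_subtopology by blast
    then show "connected_space (subtopology X L)" by (simp add: connectedin_def)
    show "Hausdorff_space (subtopology X L)" by (rule Hausdorff_space_subtopology[OF Hausdorff])
    show "is_chart (subtopology X L) d" if "d \<in> ?T" for d
      using that S.restrict_chart_is_chart slice by blast
    show "(\<Union>d\<in>?T. fst d) = topspace (subtopology X L)"
      unfolding top
    proof (intro equalityI subsetI)
      fix p assume p: "p \<in> L"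
      then obtain d where d: "action_chart X A \<omega> F c d" "p \<in> fst d" using cover by blast
      then have "restrict_chart L d \<in> ?T" using p by blast
      moreover have "p \<in> fst (restrict_chart L d)" using p d(2) by simp
      ultimately show "p \<in> (\<Union>d\<in>?T. fst d)" by blast
    qed auto
    fix d d' p assume "d \<in> ?T" "d' \<in> ?T" and p: "p \<in> fst d" "p \<in> fst d'"
    then obtain e e' where e: "d = restrict_chart L e" "action_chart X A \<omega> F c e"
      and e': "d' = restrict_chart L e'" "action_chart X A \<omega> F c e'" by blast
    have "p \<in> fst e" "p \<in> fst e'" "p \<in> L" using p e(1) e'(1) by auto
    from action_chart_translation[OF e(2) e'(2) LF this]
    show "\<exists>W. openin (subtopology X L) W \<and> p \<in> W \<and> W \<subseteq> fst d \<inter> fst d' \<and>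
        (\<forall>q\<in>W. snd d' q - snd d q = snd d' p - snd d p)"
      unfolding e(1) e'(1) by simp
  qed
  moreover have "?T \<subseteq> slice_charts X A L" unfolding slice_charts_eq using slice by blast
  moreover have "topspace (subtopology X L) \<noteq> {}"
    unfolding top by (rule nonempty_connected_components_of[OF assms(3)])
  ultimately show ?thesis
    by (rule translation_atlas_diffeomorphic_torus[OF S.slice_charts_smooth_manifold])
qed

end
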